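(* Let $\mathbb{K}$ be a field and let $G$ be a connected bipartite graph. The edge ideal $I(G)$ has regularity $3$ if and only if the complement $G^{c}$ has at least one induced cycle (of length $\geq 4$) and the bipartite complement $G^{bc}$ does not have any induced cycle of length $\geq 6$.
   Context: All graphs are finite and simple. For a graph $G$, $R$ is the polynomial ring over $\mathbb{K}$ whose variables are the vertices of $G$, with the standard grading, and the edge ideal $I(G)\subset R$ is generated by the monomials $uv$ with $\{u,v\}\in E(G)$. For a homogeneous ideal $I\subset R$, the graded Betti number $\beta_{i,j}(I)$ is the number of copies of $R(-j)$ in homological degree $i$ in the minimal graded free resolution of $I$ (of the ideal $I$, not of $R/I$; so $\beta_{0,j}(I)$ counts minimal generators of $I$ of degree $j$), and the (Castelnuovo-Mumford) regularity is $\mathrm{reg}(I)=\max\{j-i:\beta_{i,j}(I)\neq 0\}$. The complement $G^{c}$ of $G$ has the same vertex set, and $\{u,v\}$ ($u\neq v$) is an edge of $G^c$ iff it is not an edge of $G$. If $G$ is bipartite with bipartition $V(G)=X\sqcup Y$ (unique since $G$ is connected), its bipartite complement $G^{bc}$ is the bipartite graph on $X\sqcup Y$ with edges $\{x,y\}$, $x\in X$, $y\in Y$, $\{x,y\}\notin E(G)$. The $t$-cycle $C_t$ ($t\geq 4$) is the connected graph on $t$ vertices all of degree two; $t$ is its length. An induced cycle of a graph is an induced subgraph that is a cycle of length $\geq 4$. *)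

theory Defs
  imports
    "Graph_Theory.Pair_Digraph"
    "Graph_Theory.Digraph_Component"
    "HOL-Library.Poly_Mapping"
    "HOL-Library.Extended_Real"
begin

section \<open>Graphs\<close>

text \<open>
  Finite simple graphs are the digraphs satisfying \<^locale>\<open>pair_graph\<close>: finite, loop-free,
  and with a symmetric arc relation, so that an edge \<open>{u,v}\<close> is the pair of arcs \<open>(u,v)\<close>, \<open>(v,u)\<close>.
\<close>

definition bipartition :: "'v pair_pre_digraph \<Rightarrow> 'v set \<Rightarrow> 'v set \<Rightarrow> bool" where
  "bipartition G X Y \<longleftrightarrow> X \<union> Y = pverts G \<and> X \<inter> Y = {} \<and>
     (\<forall>(u, v) \<in> parcs G. (u \<in> X \<and> v \<in> Y) \<or> (u \<in> Y \<and> v \<in> X))"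

definition complement_graph :: "'v pair_pre_digraph \<Rightarrow> 'v pair_pre_digraph" where
  "complement_graph G = \<lparr> pverts = pverts G,
     parcs = {(u, v). u \<in> pverts G \<and> v \<in> pverts G \<and> u \<noteq> v \<and> (u, v) \<notin> parcs G} \<rparr>"

definition bipartite_complement ::
    "'v pair_pre_digraph \<Rightarrow> 'v set \<Rightarrow> 'v set \<Rightarrow> 'v pair_pre_digraph" where
  "bipartite_complement G X Y = \<lparr> pverts = X \<union> Y,
     parcs = {(u, v). ((u \<in> X \<and> v \<in> Y) \<or> (u \<in> Y \<and> v \<in> X)) \<and> (u, v) \<notin> parcs G} \<rparr>"

text \<open>By symmetry of the arc relation, the out-degree is the usual vertex degree.\<close>

definition cycle_graph :: "nat \<Rightarrow> 'v pair_pre_digraph \<Rightarrow> bool" where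
  "cycle_graph t C \<longleftrightarrow> t \<ge> 4 \<and> pair_graph C \<and> Digraph_Component.connected (with_proj C) \<and>
     card (pverts C) = t \<and> (\<forall>v \<in> pverts C. out_degree (with_proj C) v = 2)"

definition has_induced_cycle_ge :: "nat \<Rightarrow> 'v pair_pre_digraph \<Rightarrow> bool" where
  "has_induced_cycle_ge t G \<longleftrightarrow>
     (\<exists>s \<ge> t. \<exists>C. cycle_graph s C \<and> induced_subgraph (with_proj C) (with_proj G))"

section \<open>Polynomial rings and edge ideals\<close>

text \<open>
  A monomial is an exponent vector \<open>'v \<Rightarrow>\<^sub>0 nat\<close>. The type \<open>('v, 'k) mpol\<close> contains the polynomials
  in all variables \<open>v :: 'v\<close>; the ring \<open>\<K>[V]\<close> is the subring \<open>poly_ring V\<close>.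
\<close>

type_synonym ('v, 'k) mpol = "('v \<Rightarrow>\<^sub>0 nat) \<Rightarrow>\<^sub>0 'k"

definition poly_ring :: "'v set \<Rightarrow> ('v, 'k::field) mpol set" where
  "poly_ring V = {p. \<forall>m \<in> Poly_Mapping.keys p. Poly_Mapping.keys m \<subseteq> V}"

definition monom_deg :: "('v \<Rightarrow>\<^sub>0 nat) \<Rightarrow> nat" where
  "monom_deg m = (\<Sum>v \<in> Poly_Mapping.keys m. Poly_Mapping.lookup m v)"

text \<open>The zero polynomial is homogeneous of every degree, and the only one of negative degree.\<close>

definition homogeneous :: "int \<Rightarrow> ('v, 'k::field) mpol \<Rightarrow> bool" where
  "homogeneous d p \<longleftrightarrow> (\<forall>m \<in> Poly_Mapping.keys p. int (monom_deg m) = d)"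

definition var :: "'v \<Rightarrow> ('v, 'k::field) mpol" where
  "var v = Poly_Mapping.single (Poly_Mapping.single v 1) 1"

definition ideal_gen :: "'v set \<Rightarrow> ('v, 'k::field) mpol set \<Rightarrow> ('v, 'k) mpol set" where
  "ideal_gen V S =
     {\<Sum>s\<in>T. q s * s | T q. finite T \<and> T \<subseteq> S \<and> (\<forall>s\<in>T. q s \<in> poly_ring V)}"

definition edge_ideal :: "'v pair_pre_digraph \<Rightarrow> ('v, 'k::field) mpol set" where
  "edge_ideal G = ideal_gen (pverts G) {var u * var v | u v. (u, v) \<in> parcs G}"

section \<open>Minimal graded free resolutions, Betti numbers, regularity\<close>

text \<open>
  A sequence \<open>\<dots> \<rightarrow> F\<^sub>2 \<rightarrow> F\<^sub>1 \<rightarrow> F\<^sub>0 \<rightarrow> R\<close> with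
  \<open>F\<^sub>i = \<Oplus>k<res_rank i. R(-res_shift i k)\<close>. The row \<open>res_aug\<close> represents the map from \<open>F\<^sub>0\<close> to \<open>R\<close>,
  and the matrix \<open>res_diff i\<close>, indexed by rows and then columns, represents the map from
  \<open>F\<^sub>i\<^sub>+\<^sub>1\<close> to \<open>F\<^sub>i\<close>.
\<close>

record (overloaded) ('v, 'k) free_complex =
  res_rank :: "nat \<Rightarrow> nat"
  res_shift :: "nat \<Rightarrow> nat \<Rightarrow> int"
  res_aug :: "nat \<Rightarrow> ('v, 'k) mpol"
  res_diff :: "nat \<Rightarrow> nat \<Rightarrow> nat \<Rightarrow> ('v, 'k) mpol"

definition free_mod :: "'v set \<Rightarrow> nat \<Rightarrow> (nat \<Rightarrow> ('v, 'k::field) mpol) set" where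
  "free_mod V n = {u. (\<forall>k<n. u k \<in> poly_ring V) \<and> (\<forall>k\<ge>n. u k = 0)}"

definition aug_map :: "('v, 'k::field) free_complex \<Rightarrow> (nat \<Rightarrow> ('v, 'k) mpol) \<Rightarrow> ('v, 'k) mpol" where
  "aug_map F u = (\<Sum>k<res_rank F 0. res_aug F k * u k)"

definition diff_map ::
    "('v, 'k::field) free_complex \<Rightarrow> nat \<Rightarrow> (nat \<Rightarrow> ('v, 'k) mpol) \<Rightarrow> nat \<Rightarrow> ('v, 'k) mpol" where
  "diff_map F i u =
     (\<lambda>l. if l < res_rank F i then \<Sum>k<res_rank F (Suc i). res_diff F i l k * u k else 0)"

text \<open>
  A map \<open>R(-a) \<rightarrow> R(-b)\<close> of degree \<open>0\<close> is multiplication by a form of degree \<open>a - b\<close>.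
  The image of the augmentation being \<open>I\<close>, this is a resolution of the ideal \<open>I\<close>, not of \<open>R/I\<close>.
\<close>

definition graded_free_resolution ::
    "'v set \<Rightarrow> ('v, 'k::field) mpol set \<Rightarrow> ('v, 'k) free_complex \<Rightarrow> bool" where
  "graded_free_resolution V I F \<longleftrightarrow>
     (\<forall>k<res_rank F 0. res_aug F k \<in> poly_ring V \<and> homogeneous (res_shift F 0 k) (res_aug F k)) \<and>
     (\<forall>i. \<forall>l<res_rank F i. \<forall>k<res_rank F (Suc i).
        res_diff F i l k \<in> poly_ring V \<and>
        homogeneous (res_shift F (Suc i) k - res_shift F i l) (res_diff F i l k)) \<and>
     aug_map F ` free_mod V (res_rank F 0) = I \<and>
     diff_map F 0 ` free_mod V (res_rank F 1) =
       {u \<in> free_mod V (res_rank F 0). aug_map F u = 0} \<and>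
     (\<forall>i. diff_map F (Suc i) ` free_mod V (res_rank F (Suc (Suc i))) =
       {u \<in> free_mod V (res_rank F (Suc i)). diff_map F i u = (\<lambda>_. 0)})"

text \<open>Minimality: the image of \<open>F\<^sub>i\<^sub>+\<^sub>1\<close> lies in \<open>\<mm>F\<^sub>i\<close>, where \<open>\<mm>\<close> is generated by the variables,
  i.e. no matrix entry has a constant term.\<close>

definition minimal_graded_free_resolution ::
    "'v set \<Rightarrow> ('v, 'k::field) mpol set \<Rightarrow> ('v, 'k) free_complex \<Rightarrow> bool" where
  "minimal_graded_free_resolution V I F \<longleftrightarrow>
     graded_free_resolution V I F \<and>
     (\<forall>i. \<forall>l<res_rank F i. \<forall>k<res_rank F (Suc i). Poly_Mapping.lookup (res_diff F i l k) 0 = 0)"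

text \<open>For \<open>V\<close> finite and \<open>I\<close> a homogeneous ideal of \<open>\<K>[V]\<close> a minimal graded free resolution exists
  and is unique up to isomorphism, so the count below does not depend on the one chosen.\<close>

definition betti :: "'v set \<Rightarrow> ('v, 'k::field) mpol set \<Rightarrow> nat \<Rightarrow> int \<Rightarrow> nat" where
  "betti V I i j =
     (let F = (SOME F. minimal_graded_free_resolution V I F)
      in card {k. k < res_rank F i \<and> res_shift F i k = j})"

text \<open>The supremum of a nonempty finite set of integers is its maximum; for \<open>I = 0\<close>, which occurs
  for the edge ideal of a single vertex, the value is \<open>-\<infinity>\<close>.\<close>

definition regularity :: "'v set \<Rightarrow> ('v, 'k::field) mpol set \<Rightarrow> ereal" where
  "regularity V I = Sup {ereal (real_of_int (j - int i)) | i j. betti V I i j \<noteq> 0}"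

end

theory Submission
  imports Defs
begin

text \<open>
  Why the theorem holds. Write \<open>I\<close> for the edge ideal and \<open>V\<close> for the vertex set. The graded Betti numbers are
  the dimensions of \<open>Tor\<^sub>i(I, \<K>)\<^sub>j\<close>, and \<open>Tor\<close> can be computed either from a minimal free resolution
  of \<open>I\<close> or from the Koszul complex of the variables with coefficients in \<open>I\<close>. The second complex splits
  into multidegrees. In a multidegree with some exponent \<open>\<ge> 2\<close> it is the cochain complex of a
  simplex relative to a cone, hence exact. In the squarefree multidegree \<open>W \<subseteq> V\<close> it computes the cohomology of the full simplex on
  \<open>W\<close> relative to the complex of independent subsets of \<open>W\<close>, hence the reduced cohomology of the
  independence complex of the induced subgraph on \<open>W\<close>. So, with faces counted by cardinality, \<open>reg I\<close> is
  the largest \<open>n + 1\<close> such that some nonempty \<open>W\<close> has an independence complex with nonzero cohomology on faces of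
  cardinality \<open>n\<close> (\<open>regularity_le\<close>, \<open>regularity_ge\<close>).

  For a bipartite graph with sides \<open>X\<close>, \<open>Y\<close>, an independent set is a pair of subsets of \<open>X\<close> and
  \<open>Y\<close> that is completely joined in the bipartite complement. Cohomology on faces of cardinality \<open>2\<close>
  (topological degree 1) is therefore given by functions on the components of the bipartite complement
  (\<open>two_cocycle_normal_form\<close>). It vanishes for all \<open>W\<close> when \<open>G\<close> has no induced \<open>2K\<^sub>2\<close>,
  and is nonzero for the vertex set of an induced \<open>2K\<^sub>2\<close>. Induced \<open>2K\<^sub>2\<close>'s of \<open>G\<close> have the same vertex sets as
  induced cycles of \<open>G\<^sup>c\<close>, because \<open>X\<close> and \<open>Y\<close> are cliques of \<open>G\<^sup>c\<close>.

  Cohomology on larger faces is treated by removing a vertex \<open>y \<in> Y\<close>: the complex is the union of the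
  complex without \<open>y\<close> and the star of \<open>y\<close>, which meet in the link of \<open>y\<close>. By Mayer-Vietoris
  and induction everything vanishes on faces of cardinality \<open>\<ge> 3\<close> as soon as 1-cocycles of the link extend, up to
  coboundaries, to 1-cocycles of the complex without \<open>y\<close>. In terms of components, with adjacency in the bipartite complement, this
  says: two neighbours of \<open>y\<close> that are joined by a path avoiding \<open>y\<close> are joined by a path avoiding \<open>y\<close> all of whose vertices
  in \<open>X\<close> are neighbours of \<open>y\<close>; this is the property \<open>links_connected\<close>. When it fails, a 1-cocycle that does
  not extend gives a nonzero class on faces of cardinality \<open>3\<close>. Finally \<open>links_connected\<close> is equivalent to
  the absence of induced cycles of length \<open>\<ge> 6\<close> in the bipartite complement: a shortest path that violates it
  closes up with \<open>y\<close> to an induced cycle, and conversely the two neighbours of \<open>y\<close> on a long induced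
  cycle violate it inside that cycle.

  Since the Betti numbers are defined from a chosen minimal resolution, the comparison with Koszul cohomology is
  made directly, one syzygy module at a time (\<open>exact_at_up\<close>, \<open>exact_at_down\<close>, \<open>exact_at_top_iff\<close>).
  The same comparison bounds the degrees of the generators of all syzygy modules of \<open>I\<close> by the number of variables,
  which yields the existence of a minimal resolution by finitely generated modules (\<open>minimal_resolution_exists\<close>).
\<close>

section \<open>Signed cochains on simplicial complexes\<close>

text \<open>
  The function \<open>\<iota>\<close> orders the vertices; the sign is that of the face \<open>T - {v}\<close> of the simplex \<open>T\<close> whose
  vertices are listed in increasing order.
\<close>

definition osgn :: "('v \<Rightarrow> nat) \<Rightarrow> 'v \<Rightarrow> 'v set \<Rightarrow> 'r::comm_ring_1" where
  "osgn \<iota> v T = (-1) ^ card {u \<in> T. \<iota> u < \<iota> v}"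

text \<open>
  With \<open>x = 1\<close> this is the simplicial coboundary, with \<open>x = var\<close> the Koszul differential. A cochain is a
  function on all sets, and conditions on it are only tested on the faces of a complex; so a cochain
  can be restricted to a subcomplex, or read on a larger complex, without changing it.
\<close>

definition cobd :: "('v \<Rightarrow> nat) \<Rightarrow> ('v \<Rightarrow> 'r::comm_ring_1) \<Rightarrow> ('v set \<Rightarrow> 'r) \<Rightarrow> 'v set \<Rightarrow> 'r" where
  "cobd \<iota> x f T = (\<Sum>v\<in>T. osgn \<iota> v T * x v * f (T - {v}))"

abbreviation scobd :: "('v \<Rightarrow> nat) \<Rightarrow> ('v set \<Rightarrow> 'r::comm_ring_1) \<Rightarrow> 'v set \<Rightarrow> 'r" where
  "scobd \<iota> \<equiv> cobd \<iota> (\<lambda>_. 1)"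

lemma osgn_sq [simp]: "osgn \<iota> v T * osgn \<iota> v T = (1::'r::comm_ring_1)"
  unfolding osgn_def by (simp flip: power_mult_distrib)

lemma osgn_sq' [simp]: "osgn \<iota> v T * (osgn \<iota> v T * z) = (z::'r::comm_ring_1)"
  by (simp flip: mult.assoc)

lemma osgn_Diff_less:
  assumes "finite T" "u \<in> T" "\<iota> u < \<iota> v"
  shows "osgn \<iota> v (T - {u}) = - (osgn \<iota> v T :: 'r::comm_ring_1)"
proof -
  have "{w \<in> T. \<iota> w < \<iota> v} = insert u {w \<in> T - {u}. \<iota> w < \<iota> v}" using assms by auto
  then have "card {w \<in> T. \<iota> w < \<iota> v} = Suc (card {w \<in> T - {u}. \<iota> w < \<iota> v})"
    using assms by (simp add: card_insert_if)
  then show ?thesis by (simp add: osgn_def)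
qed

lemma osgn_Diff_ge: "\<not> \<iota> u < \<iota> v \<Longrightarrow> osgn \<iota> v (T - {u}) = osgn \<iota> v T"
  unfolding osgn_def by (rule arg_cong[where f="\<lambda>S. (-1) ^ card S"]) auto

lemma osgn_Diff_self [simp]: "osgn \<iota> v (T - {v}) = osgn \<iota> v T"
  by (rule osgn_Diff_ge) simp

lemma osgn_anti:
  assumes "finite T" "inj_on \<iota> T" "u \<in> T" "v \<in> T" "u \<noteq> v"
  shows "osgn \<iota> v T * osgn \<iota> u (T - {v}) = - (osgn \<iota> u T * osgn \<iota> v (T - {u}) :: 'r::comm_ring_1)"
proof -
  consider "\<iota> u < \<iota> v" | "\<iota> v < \<iota> u" using assms by (metis inj_onD linorder_neqE_nat)
  then show ?thesis by cases (use assms in \<open>simp_all add: osgn_Diff_less osgn_Diff_ge\<close>)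
qed

text \<open>
  Removing \<open>u\<close> and \<open>v\<close> in the two possible orders gives opposite signs. The two orders are matched as the
  pairs with \<open>\<iota> v < \<iota> u\<close> and those with \<open>\<iota> u < \<iota> v\<close>; comparing the sum with its negative would only
  show that twice the sum is zero, which says nothing in characteristic 2.
\<close>

lemma cobd_cobd:
  assumes "finite T" "inj_on \<iota> T"
  shows "cobd \<iota> x (cobd \<iota> x f) T = 0"
proof -
  let ?t = "\<lambda>(v,u). osgn \<iota> v T * x v * (osgn \<iota> u (T - {v}) * x u * f (T - {v} - {u}))"
  let ?P = "{(v,u). v \<in> T \<and> u \<in> T \<and> u \<noteq> v}"
  let ?L = "{(v,u). v \<in> T \<and> u \<in> T \<and> \<iota> v < \<iota> u}" and ?G = "{(v,u). v \<in> T \<and> u \<in> T \<and> \<iota> u < \<iota> v}"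
  have P: "?P = ?L \<union> ?G" using assms(2) by (auto simp: inj_on_def) (metis linorder_neqE_nat)
  have fin: "finite ?L" "finite ?G" by (rule finite_subset[OF _ finite_cartesian_product[OF assms(1) assms(1)]], auto)+
  have "cobd \<iota> x (cobd \<iota> x f) T = (\<Sum>v\<in>T. \<Sum>u\<in>T - {v}. ?t (v,u))"
    by (simp add: cobd_def sum_distrib_left)
  also have "\<dots> = sum ?t (Sigma T (\<lambda>v. T - {v}))"
    by (subst sum.Sigma) (use assms in \<open>auto simp: case_prod_unfold\<close>)
  also have "Sigma T (\<lambda>v. T - {v}) = ?P" by auto
  also have "sum ?t ?P = sum ?t ?L + sum ?t ?G"
    unfolding P using fin by (intro sum.union_disjoint) auto
  also have "sum ?t ?G = sum (\<lambda>p. - ?t p) ?L"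
  proof (rule sum.reindex_bij_witness[of _ prod.swap prod.swap], goal_cases)
    case (5 p)
    then obtain v u where p: "p = (v,u)" "v \<in> T" "u \<in> T" "u \<noteq> v" by auto
    have "?t (u,v) = (osgn \<iota> u T * osgn \<iota> v (T - {u})) * (x v * x u * f (T - {v} - {u}))"
      by (simp add: algebra_simps) (metis Diff_insert Diff_insert2)
    also have "\<dots> = - ?t (v,u)" 
      unfolding osgn_anti[OF assms p(2,3) p(4)[symmetric]] by (simp add: algebra_simps)
    finally show ?case using p by simp
  qed auto
  also have "sum ?t ?L + sum (\<lambda>p. - ?t p) ?L = 0" by (simp add: sum_negf)
  finally show ?thesis .
qed

lemma cobd_cong: "(\<And>v. v \<in> T \<Longrightarrow> f (T - {v}) = g (T - {v})) \<Longrightarrow> cobd \<iota> x f T = cobd \<iota> x g T"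
  by (simp add: cobd_def)

lemma cobd_add: "cobd \<iota> x (\<lambda>S. f S + g S) T = cobd \<iota> x f T + cobd \<iota> x g T"
  by (simp add: cobd_def algebra_simps sum.distrib)

lemma cobd_diff: "cobd \<iota> x (\<lambda>S. f S - g S) T = cobd \<iota> x f T - cobd \<iota> x g T"
  by (simp add: cobd_def algebra_simps sum_subtractf)

lemma cobd_mult: "cobd \<iota> x (\<lambda>S. a * f S) T = a * cobd \<iota> x f T"
  by (simp add: cobd_def sum_distrib_left mult_ac)

lemma cobd_sum: "cobd \<iota> x (\<lambda>S. \<Sum>i\<in>A. f i S) T = (\<Sum>i\<in>A. cobd \<iota> x (f i) T)"
  unfolding cobd_def sum_distrib_left by (rule sum.swap)

lemma cobd_zero: "(\<And>v. v \<in> T \<Longrightarrow> f (T - {v}) = 0) \<Longrightarrow> cobd \<iota> x f T = 0"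
  by (simp add: cobd_def)

text \<open>
  Faces are counted by cardinality, so \<open>n\<close> corresponds to topological degree \<open>n - 1\<close>; the empty face is a
  face like any other, hence the cohomology is reduced. The first argument only records the coefficient field.
\<close>

definition acyclic_at :: "'k::field itself \<Rightarrow> ('v \<Rightarrow> nat) \<Rightarrow> nat \<Rightarrow> 'v set set \<Rightarrow> bool" where
  "acyclic_at _ \<iota> n \<Gamma> \<longleftrightarrow> (\<forall>g :: 'v set \<Rightarrow> 'k. (\<forall>T\<in>\<Gamma>. card T = Suc n \<longrightarrow> scobd \<iota> g T = 0) \<longrightarrow>
     (\<exists>h. \<forall>T\<in>\<Gamma>. card T = n \<longrightarrow> g T = scobd \<iota> h T))"

lemma acyclic_atD:
  fixes g :: "'v set \<Rightarrow> 'k::field"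
  assumes "acyclic_at TYPE('k) \<iota> n \<Gamma>" "\<And>T. T \<in> \<Gamma> \<Longrightarrow> card T = Suc n \<Longrightarrow> scobd \<iota> g T = 0"
  obtains h where "\<And>T. T \<in> \<Gamma> \<Longrightarrow> card T = n \<Longrightarrow> g T = scobd \<iota> h T"
  using assms unfolding acyclic_at_def by blast

definition simplicial :: "('v \<Rightarrow> nat) \<Rightarrow> 'v set set \<Rightarrow> bool" where
  "simplicial \<iota> \<Gamma> \<longleftrightarrow> (\<forall>T\<in>\<Gamma>. finite T \<and> inj_on \<iota> T \<and> (\<forall>S. S \<subseteq> T \<longrightarrow> S \<in> \<Gamma>))"

lemma simplicialD:
  assumes "simplicial \<iota> \<Gamma>" "T \<in> \<Gamma>"
  shows "finite T" "inj_on \<iota> T" "S \<subseteq> T \<Longrightarrow> S \<in> \<Gamma>" "T - {v} \<in> \<Gamma>"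
  using assms by (auto simp: simplicial_def)

text \<open>
  The contracting homotopy sends a cochain \<open>g\<close> to \<open>S \<mapsto> \<plusminus> g (S \<union> {p})\<close>, where \<open>p\<close> is the apex.
\<close>

lemma cone_acyclic:
  assumes S: "simplicial \<iota> \<Gamma>" and p: "\<And>T. T \<in> \<Gamma> \<Longrightarrow> insert p T \<in> \<Gamma>"
  shows "acyclic_at TYPE('k::field) \<iota> n \<Gamma>"
  unfolding acyclic_at_def
proof (intro allI impI exI ballI)
  fix g :: "'a set \<Rightarrow> 'k" and T
  assume co: "\<forall>T\<in>\<Gamma>. card T = Suc n \<longrightarrow> scobd \<iota> g T = 0" and T: "T \<in> \<Gamma>" "card T = n"
  let ?h = "\<lambda>S. if p \<in> S then 0 else osgn \<iota> p (insert p S) * g (insert p S)"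
  note fT = simplicialD[OF S T(1)]
  show "g T = scobd \<iota> ?h T"
  proof (cases "p \<in> T")
    case True
    have "scobd \<iota> ?h T = (\<Sum>v\<in>T. if v = p then g T else 0)"
      unfolding cobd_def by (rule sum.cong) (use True in \<open>auto simp: insert_absorb\<close>)
    also have "\<dots> = g T" using True fT by simp
    finally show ?thesis ..
  next
    case False
    let ?U = "insert p T"
    have U: "?U \<in> \<Gamma>" using p T by blast
    note fU = simplicialD[OF S U]
    have "0 = scobd \<iota> g ?U" using co U False fT T by simp
    also have "\<dots> = osgn \<iota> p ?U * g T + (\<Sum>v\<in>T. osgn \<iota> v ?U * g (?U - {v}))"
      unfolding cobd_def using fT False by (simp add: sum.insert)
    finally have e: "(\<Sum>v\<in>T. osgn \<iota> v ?U * g (?U - {v})) = - osgn \<iota> p ?U * g T"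
      by (simp add: eq_neg_iff_add_eq_0 add.commute)
    have "scobd \<iota> ?h T = (\<Sum>v\<in>T. - osgn \<iota> p ?U * (osgn \<iota> v ?U * g (?U - {v})))"
      unfolding cobd_def
    proof (rule sum.cong[OF refl])
      fix v assume v: "v \<in> T"
      then have pv: "p \<noteq> v" using False by auto
      have i: "insert p (T - {v}) = ?U - {v}" "?U - {p} = T" using pv False by auto
      have "osgn \<iota> v ?U * osgn \<iota> p (?U - {v}) = - (osgn \<iota> p ?U * osgn \<iota> v T :: 'k)"
        using osgn_anti[OF fU(1,2), of p v] v pv i(2) by auto
      then have "osgn \<iota> v T * (osgn \<iota> v ?U * (osgn \<iota> v ?U * osgn \<iota> p (?U - {v})))
         = osgn \<iota> v T * (osgn \<iota> v ?U * - (osgn \<iota> p ?U * osgn \<iota> v T :: 'k))" by simp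
      also have "\<dots> = - (osgn \<iota> p ?U * osgn \<iota> v ?U * (osgn \<iota> v T * osgn \<iota> v T))"
        by (simp only: mult_ac mult_minus_right mult_minus_left)
      finally have "osgn \<iota> v T * osgn \<iota> p (?U - {v}) = - (osgn \<iota> p ?U * osgn \<iota> v ?U :: 'k)" by simp
      then show "osgn \<iota> v T * 1 * ?h (T - {v}) = - osgn \<iota> p ?U * (osgn \<iota> v ?U * g (?U - {v}))"
        using False by (simp add: i flip: mult.assoc)
    qed
    also have "\<dots> = g T"
      unfolding sum_distrib_left[symmetric] e by simp
    finally show ?thesis ..
  qed
qed

lemma acyclic_Pow:
  assumes "finite W" "inj_on \<iota> W" "W \<noteq> {} \<or> n \<ge> 1"
  shows "acyclic_at TYPE('k::field) \<iota> n (Pow W)"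
proof (cases "W = {}")
  case True
  then show ?thesis using assms by (auto simp: acyclic_at_def)
next
  case False
  then obtain p where "p \<in> W" by blast
  then show ?thesis using assms
    by (intro cone_acyclic[where p=p]) (auto simp: simplicial_def inj_on_subset finite_subset)
qed

text \<open>
  The last assumption says that restriction from \<open>\<Gamma>\<^sub>1\<close> to \<open>\<Gamma>\<^sub>1 \<inter> \<Gamma>\<^sub>2\<close> is surjective on the cohomology one
  degree lower. It holds with \<open>h = 0\<close> if that cohomology of the intersection vanishes; the general form is
  for intersections that do have cohomology, all of which comes from \<open>\<Gamma>\<^sub>1\<close>.
\<close>

lemma mayer_vietoris:
  assumes S1: "simplicial \<iota> \<Gamma>\<^sub>1" and S2: "simplicial \<iota> \<Gamma>\<^sub>2"
    and A1: "acyclic_at TYPE('k::field) \<iota> (Suc n) \<Gamma>\<^sub>1" and A2: "acyclic_at TYPE('k) \<iota> (Suc n) \<Gamma>\<^sub>2"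
    and ext: "\<And>g :: 'v set \<Rightarrow> 'k. (\<And>T. T \<in> \<Gamma>\<^sub>1 \<inter> \<Gamma>\<^sub>2 \<Longrightarrow> card T = Suc n \<Longrightarrow> scobd \<iota> g T = 0) \<Longrightarrow>
        \<exists>h e. (\<forall>T\<in>\<Gamma>\<^sub>1. card T = Suc n \<longrightarrow> scobd \<iota> h T = 0) \<and>
              (\<forall>T\<in>\<Gamma>\<^sub>1 \<inter> \<Gamma>\<^sub>2. card T = n \<longrightarrow> g T = h T + scobd \<iota> e T)"
  shows "acyclic_at TYPE('k) \<iota> (Suc n) (\<Gamma>\<^sub>1 \<union> \<Gamma>\<^sub>2)"
  unfolding acyclic_at_def
proof (intro allI impI)
  fix g :: "'v set \<Rightarrow> 'k"
  assume g: "\<forall>T\<in>\<Gamma>\<^sub>1 \<union> \<Gamma>\<^sub>2. card T = Suc (Suc n) \<longrightarrow> scobd \<iota> g T = 0"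
  obtain h1 where h1: "\<And>T. T \<in> \<Gamma>\<^sub>1 \<Longrightarrow> card T = Suc n \<Longrightarrow> g T = scobd \<iota> h1 T"
    using A1 g unfolding acyclic_at_def by (metis UnCI)
  obtain h2 where h2: "\<And>T. T \<in> \<Gamma>\<^sub>2 \<Longrightarrow> card T = Suc n \<Longrightarrow> g T = scobd \<iota> h2 T"
    using A2 g unfolding acyclic_at_def by (metis UnCI)
  have "scobd \<iota> (\<lambda>S. h1 S - h2 S) T = 0" if "T \<in> \<Gamma>\<^sub>1 \<inter> \<Gamma>\<^sub>2" "card T = Suc n" for T
    using h1[of T] h2[of T] that by (simp add: cobd_diff)
  from ext[OF this] obtain h e where
    h: "\<And>T. T \<in> \<Gamma>\<^sub>1 \<Longrightarrow> card T = Suc n \<Longrightarrow> scobd \<iota> h T = 0" and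
    e: "\<And>T. T \<in> \<Gamma>\<^sub>1 \<inter> \<Gamma>\<^sub>2 \<Longrightarrow> card T = n \<Longrightarrow> h1 T - h2 T = h T + scobd \<iota> e T" by blast
  \<comment> \<open>The primitives of \<open>g\<close> on the two parts are corrected so that they agree on the intersection.\<close>
  let ?H = "\<lambda>T. if T \<in> \<Gamma>\<^sub>1 then h1 T - h T else h2 T + scobd \<iota> e T"
  have "g T = scobd \<iota> ?H T" if T: "T \<in> \<Gamma>\<^sub>1 \<union> \<Gamma>\<^sub>2" "card T = Suc n" for T
  proof (cases "T \<in> \<Gamma>\<^sub>1")
    case True
    have "scobd \<iota> ?H T = scobd \<iota> (\<lambda>S. h1 S - h S) T"
      by (rule cobd_cong) (use simplicialD[OF S1 True] in auto)
    then show ?thesis using h1[OF True] h[OF True] T by (simp add: cobd_diff)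
  next
    case False
    then have T2: "T \<in> \<Gamma>\<^sub>2" using T by blast
    note f = simplicialD[OF S2 T2]
    have "scobd \<iota> ?H T = scobd \<iota> (\<lambda>S. h2 S + scobd \<iota> e S) T"
    proof (rule cobd_cong)
      fix v assume "v \<in> T"
      then have "card (T - {v}) = n" using T f by simp
      then show "?H (T - {v}) = h2 (T - {v}) + scobd \<iota> e (T - {v})"
        using e[of "T - {v}"] f(4)[of v] by (auto simp: algebra_simps)
    qed
    then show ?thesis using h2[OF T2] T f by (simp add: cobd_add cobd_cobd)
  qed
  then show "\<exists>h. \<forall>T\<in>\<Gamma>\<^sub>1 \<union> \<Gamma>\<^sub>2. card T = Suc n \<longrightarrow> g T = scobd \<iota> h T" by blast
qed

section \<open>Independence complexes of bipartite graphs\<close>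

lemma scobd_pair:
  fixes f :: "'v set \<Rightarrow> 'r::comm_ring_1"
  assumes "\<iota> a < \<iota> b"
  shows "scobd \<iota> f {a,b} = f {b} - f {a}"
proof -
  have "{u \<in> {a,b}. \<iota> u < \<iota> a} = {}" "{u \<in> {a,b}. \<iota> u < \<iota> b} = {a}"
    using assms by auto
  then have s: "osgn \<iota> a {a,b} = (1::'r)" "osgn \<iota> b {a,b} = (-1::'r)"
    unfolding osgn_def by (simp_all only: card.empty) simp_all
  have d: "{a,b} - {a} = {b}" "{a,b} - {b} = {a}" "a \<noteq> b" using assms by auto
  have "scobd \<iota> f {a,b} = osgn \<iota> a {a,b} * f ({a,b} - {a}) + osgn \<iota> b {a,b} * f ({a,b} - {b})"
    using d(3) by (simp add: cobd_def del: Diff_insert0 insert_Diff_single)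
  then show ?thesis unfolding s d by simp
qed

lemma scobd_triple:
  fixes f :: "'v set \<Rightarrow> 'r::comm_ring_1"
  assumes "\<iota> a < \<iota> b" "\<iota> b < \<iota> c"
  shows "scobd \<iota> f {a,b,c} = f {b,c} - f {a,c} + f {a,b}"
proof -
  have "{u \<in> {a,b,c}. \<iota> u < \<iota> a} = {}" "{u \<in> {a,b,c}. \<iota> u < \<iota> b} = {a}"
    "{u \<in> {a,b,c}. \<iota> u < \<iota> c} = {a,b}" and ab: "a \<noteq> b"
    using assms by auto
  then have s: "osgn \<iota> a {a,b,c} = (1::'r)" "osgn \<iota> b {a,b,c} = (-1::'r)" "osgn \<iota> c {a,b,c} = (1::'r)"
    unfolding osgn_def by (simp_all only: card.empty) (use ab in simp_all)
  have d: "{a,b,c} - {a} = {b,c}" "{a,b,c} - {b} = {a,c}" "{a,b,c} - {c} = {a,b}" "a \<noteq> b" "a \<noteq> c" "b \<noteq> c"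
    using assms by auto
  have "scobd \<iota> f {a,b,c} = osgn \<iota> a {a,b,c} * f ({a,b,c} - {a}) + osgn \<iota> b {a,b,c} * f ({a,b,c} - {b})
      + osgn \<iota> c {a,b,c} * f ({a,b,c} - {c})"
    using d(4-6) by (simp add: cobd_def add.assoc del: Diff_insert0 insert_Diff_single)
  then show ?thesis unfolding s d by simp
qed

text \<open>
  The relation \<open>B\<close> is adjacency in the bipartite complement, read from \<open>X\<close> to \<open>Y\<close>. Listing all of \<open>X\<close> before \<open>Y\<close>
  makes every mixed pair have its vertex in \<open>X\<close> first, so that no signs occur in low degrees.
\<close>

locale ordered_bipartite =
  fixes X Y :: "'v set" and B :: "'v \<Rightarrow> 'v \<Rightarrow> bool" and \<iota> :: "'v \<Rightarrow> nat"
  assumes finX: "finite X" and finY: "finite Y"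
    and inj: "inj_on \<iota> (X \<union> Y)"
    and XY: "\<And>x y. x \<in> X \<Longrightarrow> y \<in> Y \<Longrightarrow> \<iota> x < \<iota> y"
begin

definition Ind :: "'v set \<Rightarrow> 'v set set" where
  "Ind W = {T. T \<subseteq> W \<and> (\<forall>x\<in>T \<inter> X. \<forall>y\<in>T \<inter> Y. B x y)}"

text \<open>
  The components of the bipartite complement on \<open>W\<close> are described on the side \<open>X\<close> only: a step goes from
  \<open>a\<close> to \<open>b\<close> through a common neighbour in \<open>Y\<close>.
\<close>

definition step :: "'v set \<Rightarrow> 'v \<Rightarrow> 'v \<Rightarrow> bool" where
  "step W a b \<longleftrightarrow> a \<in> X \<inter> W \<and> b \<in> X \<inter> W \<and> (\<exists>y\<in>Y \<inter> W. B a y \<and> B b y)"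

abbreviation conn :: "'v set \<Rightarrow> 'v \<Rightarrow> 'v \<Rightarrow> bool" where "conn W \<equiv> (step W)\<^sup>*\<^sup>*"

text \<open>
  For \<open>y \<in> Y\<close> the link of \<open>y\<close> in the independence complex of \<open>W\<close> is the independence complex of this set.
\<close>

definition linkset :: "'v set \<Rightarrow> 'v \<Rightarrow> 'v set" where
  "linkset W y = W - {y} - {x \<in> X. \<not> B x y}"

text \<open>
  Geometrically: the link of \<open>y\<close> does not meet a component of the bipartite complement minus \<open>y\<close> in several
  components. This is the form in which the absence of long induced cycles is used.
\<close>

definition links_connected :: bool where
  "links_connected \<longleftrightarrow> (\<forall>W y x x'. W \<subseteq> X \<union> Y \<longrightarrow> y \<in> Y \<inter> W \<longrightarrow> x \<in> X \<inter> W \<longrightarrow> x' \<in> X \<inter> W \<longrightarrow>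
      B x y \<longrightarrow> B x' y \<longrightarrow> conn (W - {y}) x x' \<longrightarrow> conn (linkset W y) x x')"

text \<open>
  A function on \<open>X\<close> viewed as a cochain on faces of cardinality 2: it is supported on the mixed pairs, and its
  value on a mixed pair is read off at the vertex in \<open>X\<close>. The value on the edge \<open>{x, y}\<close> then depends only on the component
  of that edge in the bipartite complement, provided that \<open>l\<close> is constant along steps.
\<close>

definition join_cochain :: "('v \<Rightarrow> 'k::field) \<Rightarrow> 'v set \<Rightarrow> 'k" where
  "join_cochain l T = (if T \<inter> X \<noteq> {} \<and> T \<inter> Y \<noteq> {} then l (THE x. x \<in> T \<inter> X) else 0)"

lemma disj: "X \<inter> Y = {}" using XY by blast

lemma notXY: "x \<in> X \<Longrightarrow> x \<notin> Y" "y \<in> Y \<Longrightarrow> y \<notin> X" using disj by auto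

lemma simp_Ind: "W \<subseteq> X \<union> Y \<Longrightarrow> simplicial \<iota> (Ind W)"
  unfolding simplicial_def
proof (intro ballI conjI allI impI)
  fix T S assume T: "T \<in> Ind W" "W \<subseteq> X \<union> Y"
  then have "T \<subseteq> X \<union> Y" by (auto simp: Ind_def)
  then show "finite T" "inj_on \<iota> T" using finX finY inj by (auto intro: finite_subset[of _ "X \<union> Y"] inj_on_subset)
  assume "S \<subseteq> T" then show "S \<in> Ind W" using T unfolding Ind_def by blast
qed

lemma step_sym: "step W a b \<Longrightarrow> step W b a" by (auto simp: step_def)
lemma conn_sym: "conn W a b \<Longrightarrow> conn W b a"
  by (induction rule: rtranclp_induct) (auto dest: step_sym intro: converse_rtranclp_into_rtranclp)

lemma join_pair [simp]: "x \<in> X \<Longrightarrow> y \<in> Y \<Longrightarrow> join_cochain l {x,y} = l x"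
proof -
  assume a: "x \<in> X" "y \<in> Y"
  then have "{x,y} \<inter> X = {x}" using notXY by auto
  moreover have "{x,y} \<inter> Y \<noteq> {}" using a by auto
  ultimately show ?thesis by (simp add: join_cochain_def)
qed

lemma join_pure: "T \<subseteq> X \<or> T \<subseteq> Y \<Longrightarrow> join_cochain l T = 0"
  using disj by (auto simp: join_cochain_def)

lemma pair_cases:
  assumes "card T = 2" "T \<subseteq> X \<union> Y"
  obtains a b where "T = {a,b}" "a \<noteq> b" "a \<in> X" "b \<in> X" "\<iota> a < \<iota> b"
  | a b where "T = {a,b}" "a \<noteq> b" "a \<in> Y" "b \<in> Y" "\<iota> a < \<iota> b"
  | a b where "T = {a,b}" "a \<in> X" "b \<in> Y" "\<iota> a < \<iota> b"
proof -
  obtain a b where T: "T = {a,b}" "a \<noteq> b" using assms(1) by (auto simp: card_2_iff)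
  then have "\<iota> a \<noteq> \<iota> b" using assms(2) inj by (auto simp: inj_on_def)
  then obtain c d where "T = {c,d}" "\<iota> c < \<iota> d" using T by (metis insert_commute linorder_neqE_nat)
  then show ?thesis using that assms(2) XY by (metis (no_types, lifting) UnE insert_subset less_asym less_irrefl)
qed

lemma triple_cases:
  assumes "card T = 3" "T \<subseteq> X \<union> Y"
  obtains a b c where "T = {a,b,c}" "a \<in> X \<and> b \<in> X \<and> c \<in> X \<or> a \<in> X \<and> b \<in> X \<and> c \<in> Y \<or>
     a \<in> X \<and> b \<in> Y \<and> c \<in> Y \<or> a \<in> Y \<and> b \<in> Y \<and> c \<in> Y" "\<iota> a < \<iota> b" "\<iota> b < \<iota> c"
proof -
  have fT: "finite T" "inj_on \<iota> T" using assms inj by (auto intro: card_ge_0_finite inj_on_subset)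
  define a where "a = arg_min_on \<iota> T"
  have a: "a \<in> T" "\<And>z. z \<in> T \<Longrightarrow> \<iota> a \<le> \<iota> z"
    using arg_min_if_finite[of T \<iota>] fT assms(1) unfolding a_def not_less by force+
  have "card (T - {a}) = 2" "T - {a} \<subseteq> X \<union> Y" using a assms fT by auto
  then obtain b c where bc: "T - {a} = {b,c}" "\<iota> b < \<iota> c" by (rule pair_cases) blast+
  have ab: "\<iota> a < \<iota> b" using a bc fT by (metis DiffE insertCI inj_onD le_neq_implies_less)
  have T: "T = {a,b,c}" using bc a by auto
  then have "a \<in> X \<union> Y" "b \<in> X \<union> Y" "c \<in> X \<union> Y" using assms by auto
  moreover have "\<not> (b \<in> X \<and> a \<in> Y)" "\<not> (c \<in> X \<and> b \<in> Y)"
    using XY[of b a] XY[of c b] ab bc(2) by auto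
  ultimately show ?thesis using that[OF T _ ab bc(2)] by blast
qed

text \<open>
  On a triangle \<open>{a, b, c}\<close> with \<open>a, b \<in> X\<close> and \<open>c \<in> Y\<close> the coboundary is the difference of the values of \<open>l\<close> at
  \<open>a\<close> and \<open>b\<close>, and \<open>c\<close> witnesses a step between these vertices; all other triangles contribute zero or cancelling terms.
\<close>

lemma join_cocycle:
  assumes W: "W \<subseteq> X \<union> Y" and l: "\<And>a b. step W a b \<Longrightarrow> l a = l b"
    and T: "T \<in> Ind W" "card T = 3"
  shows "scobd \<iota> (join_cochain l) T = 0"
proof -
  have TXY: "T \<subseteq> X \<union> Y" using T W by (auto simp: Ind_def)
  obtain a b c where abc: "T = {a,b,c}" "\<iota> a < \<iota> b" "\<iota> b < \<iota> c" and
    "a \<in> X \<and> b \<in> X \<and> c \<in> X \<or> a \<in> X \<and> b \<in> X \<and> c \<in> Y \<or>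
     a \<in> X \<and> b \<in> Y \<and> c \<in> Y \<or> a \<in> Y \<and> b \<in> Y \<and> c \<in> Y"
    by (rule triple_cases[OF T(2) TXY]) blast
  then consider "a \<in> X" "b \<in> X" "c \<in> X" | "a \<in> X" "b \<in> X" "c \<in> Y" | "a \<in> X" "b \<in> Y" "c \<in> Y" | "a \<in> Y" "b \<in> Y" "c \<in> Y"
    by blast
  then show ?thesis
  proof cases
    case 2
    then have "step W a b" using T(1) unfolding abc(1) Ind_def step_def by auto
    from l[OF this] show ?thesis using 2 unfolding abc(1) scobd_triple[of \<iota> a b c, OF abc(2,3)] by (simp add: join_pure)
  qed (simp_all add: abc(1) scobd_triple[of \<iota> a b c, OF abc(2,3)] join_pure)
qed

text \<open>
  The independence complex contains the full simplices on the two sides, where every cocycle is a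
  coboundary; after subtracting these, the cocycle vanishes on the pairs inside a side. The cocycle condition on the
  triangles \<open>{x, y, y'}\<close> and \<open>{x, x', y}\<close> then says that the value on \<open>{x, y}\<close> does not change when one of its vertices is
  replaced by another one on the same side, so it is a function on components.
\<close>

lemma two_cocycle_normal_form:
  fixes h :: "'v set \<Rightarrow> 'k::field"
  assumes W: "W \<subseteq> X \<union> Y" and h: "\<And>T. T \<in> Ind W \<Longrightarrow> card T = 3 \<Longrightarrow> scobd \<iota> h T = 0"
  obtains e l where "\<And>T. T \<in> Ind W \<Longrightarrow> card T = 2 \<Longrightarrow> h T = join_cochain l T + scobd \<iota> e T"
    "\<And>a b. step W a b \<Longrightarrow> l a = l b"
proof -
  have fW: "finite W" "inj_on \<iota> W" using W finX finY inj by (auto intro: finite_subset inj_on_subset)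
  have "\<exists>e :: 'v set \<Rightarrow> 'k. \<forall>T. T \<subseteq> Z \<longrightarrow> card T = 2 \<longrightarrow> h T = scobd \<iota> e T" if Z: "Z \<subseteq> W" "Z \<subseteq> X \<or> Z \<subseteq> Y" for Z
  proof (cases "Z = {}")
    case False
    have "Pow Z \<subseteq> Ind W" using Z disj by (auto simp: Ind_def)
    moreover have "acyclic_at TYPE('k) \<iota> 2 (Pow Z)"
      using Z fW by (intro acyclic_Pow) (auto intro: finite_subset inj_on_subset)
    moreover have "\<forall>T\<in>Pow Z. card T = Suc 2 \<longrightarrow> scobd \<iota> h T = 0" using h calculation(1) by auto
    ultimately obtain e :: "'v set \<Rightarrow> 'k" where "\<And>T. T \<in> Pow Z \<Longrightarrow> card T = 2 \<Longrightarrow> h T = scobd \<iota> e T"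
      by (elim acyclic_atD[of \<iota> 2 "Pow Z" h]) auto
    then show ?thesis by (intro exI[of _ e]) auto
  qed auto
  from this[of "X \<inter> W"] this[of "Y \<inter> W"] obtain e1 e2 :: "'v set \<Rightarrow> 'k" where
    e1: "\<And>T. T \<subseteq> X \<inter> W \<Longrightarrow> card T = 2 \<Longrightarrow> h T = scobd \<iota> e1 T" and
    e2: "\<And>T. T \<subseteq> Y \<inter> W \<Longrightarrow> card T = 2 \<Longrightarrow> h T = scobd \<iota> e2 T"
    by blast
  define e where "e = (\<lambda>T. if T \<subseteq> X then e1 T else e2 T)"
  define k where "k = (\<lambda>T. h T - scobd \<iota> e T)"
  have k3: "scobd \<iota> k T = 0" if "T \<in> Ind W" "card T = 3" for T
    using simplicialD[OF simp_Ind[OF W] that(1)] h[OF that] by (simp add: k_def cobd_diff cobd_cobd)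
  have kX: "k {a,b} = 0" if "a \<in> X \<inter> W" "b \<in> X \<inter> W" "\<iota> a < \<iota> b" for a b
    using e1[of "{a,b}"] that by (cases "a = b") (auto simp: k_def e_def scobd_pair)
  have kY: "k {a,b} = 0" if "a \<in> Y \<inter> W" "b \<in> Y \<inter> W" "\<iota> a < \<iota> b" for a b
    using e2[of "{a,b}"] that notXY by (cases "a = b") (auto simp: k_def e_def scobd_pair)
  define l where "l = (\<lambda>x. k {x, SOME y. y \<in> Y \<inter> W \<and> B x y})"
  have k1: "k {x,y} = k {x,y'}" if "x \<in> X \<inter> W" "y \<in> Y \<inter> W" "y' \<in> Y \<inter> W" "B x y" "B x y'" "\<iota> y < \<iota> y'" for x y y'
  proof -
    have "{x,y,y'} \<in> Ind W" using that notXY by (auto simp: Ind_def)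
    moreover have lt: "\<iota> x < \<iota> y" using that XY by blast
    moreover have "card {x,y,y'} = 3" using lt that by (auto simp: card_insert_if)
    ultimately show ?thesis using k3[of "{x,y,y'}"] that(6) kY[of y y'] that
      by (simp add: scobd_triple)
  qed
  have k2: "k {x,y} = k {x',y}" if "x \<in> X \<inter> W" "x' \<in> X \<inter> W" "y \<in> Y \<inter> W" "B x y" "B x' y" "\<iota> x < \<iota> x'" for x x' y
  proof -
    have "{x,x',y} \<in> Ind W" using that notXY by (auto simp: Ind_def)
    moreover have lt: "\<iota> x' < \<iota> y" using that XY by blast
    moreover have "card {x,x',y} = 3" using lt that by (auto simp: card_insert_if)
    ultimately show ?thesis using k3[of "{x,x',y}"] that(6) kX[of x x'] that
      by (simp add: scobd_triple)
  qed
  have neq: "u = v \<or> \<iota> u < \<iota> v \<or> \<iota> v < \<iota> u" if "u \<in> W" "v \<in> W" for u v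
    using fW(2) that by (metis inj_onD linorder_neqE_nat)
  have kl: "k {x,y} = l x" if xy: "x \<in> X \<inter> W" "y \<in> Y \<inter> W" "B x y" for x y
  proof -
    define y' where "y' = (SOME y. y \<in> Y \<inter> W \<and> B x y)"
    have "y' \<in> Y \<inter> W \<and> B x y'" unfolding y'_def by (rule someI) (use xy in blast)
    then show ?thesis using k1[of x y y'] k1[of x y' y] neq[of y y'] xy unfolding l_def y'_def by auto
  qed
  have "l a = l b" if ab: "step W a b" for a b
  proof -
    obtain y where y: "y \<in> Y \<inter> W" "B a y" "B b y" "a \<in> X \<inter> W" "b \<in> X \<inter> W" using ab by (auto simp: step_def)
    then consider "a = b" | "\<iota> a < \<iota> b" | "\<iota> b < \<iota> a" using neq[of a b] by blast
    then have kk: "k {a,y} = k {b,y}"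
    proof cases
      case 2 then show ?thesis using k2[OF y(4,5,1,2,3)] by simp
    next
      case 3 then show ?thesis using k2[OF y(5,4,1,3,2)] by simp
    qed simp
    have "l a = k {a,y}" using kl[OF y(4,1,2)] ..
    also have "\<dots> = l b" unfolding kk by (rule kl[OF y(5,1,3)])
    finally show ?thesis .
  qed
  moreover have "h T = join_cochain l T + scobd \<iota> e T" if T: "T \<in> Ind W" "card T = 2" for T
  proof -
    have "T \<subseteq> X \<union> Y" "T \<subseteq> W" using T W by (auto simp: Ind_def)
    have "k T = join_cochain l T"
      using T(2) \<open>T \<subseteq> X \<union> Y\<close>
    proof (cases rule: pair_cases)
      case (1 a b) then show ?thesis using kX[of a b] \<open>T \<subseteq> W\<close> by (simp add: join_pure)
    next
      case (2 a b) then show ?thesis using kY[of a b] \<open>T \<subseteq> W\<close> by (simp add: join_pure)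
    next
      case (3 a b)
      then have "B a b" using T by (auto simp: Ind_def)
      then show ?thesis using kl[of a b] \<open>T \<subseteq> W\<close> 3 by simp
    qed
    then show ?thesis by (simp add: k_def diff_eq_eq add.commute)
  qed
  ultimately show ?thesis using that by blast
qed

text \<open>
  The decomposition into the part without \<open>y\<close> and the star of \<open>y\<close>, with the link of \<open>y\<close> as intersection.
\<close>

lemma linkset_Int: 
  assumes "W \<subseteq> X \<union> Y" "y \<in> Y \<inter> W"
  shows "Ind (W - {y}) \<inter> {T \<in> Ind W. insert y T \<in> Ind W} = Ind (linkset W y)"
    and "Ind (W - {y}) \<union> {T \<in> Ind W. insert y T \<in> Ind W} = Ind W"
  using assms notXY by (auto simp: Ind_def linkset_def insert_absorb)

lemma star_acyclic:
  assumes "W \<subseteq> X \<union> Y"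
  shows "simplicial \<iota> {T \<in> Ind W. insert y T \<in> Ind W}"
    "acyclic_at TYPE('k::field) \<iota> n {T \<in> Ind W. insert y T \<in> Ind W}"
proof -
  show s: "simplicial \<iota> {T \<in> Ind W. insert y T \<in> Ind W}"
    using simp_Ind[OF assms] unfolding simplicial_def by (auto intro: insert_mono)
  show "acyclic_at TYPE('k::field) \<iota> n {T \<in> Ind W. insert y T \<in> Ind W}"
    by (rule cone_acyclic[OF s, of y]) auto
qed

text \<open>
  Induction on \<open>W\<close> by removing a vertex \<open>y \<in> Y\<close>, which starts with a simplex when \<open>W\<close> has no vertex in \<open>Y\<close>.
  For \<open>n \<ge> 4\<close> Mayer-Vietoris needs no more than the vanishing for the link. For \<open>n = 3\<close> the link may have
  cohomology on faces of cardinality 2; by the normal form a class is a function on the components of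
  the link, and \<open>links_connected\<close> is what allows it to be extended to the components of \<open>W - {y}\<close>.
\<close>

theorem acyclic_above_2:
  assumes lc: links_connected and "W \<subseteq> X \<union> Y" "n \<ge> 3"
  shows "acyclic_at TYPE('k::field) \<iota> n (Ind W)"
  using assms(2,3)
proof (induction "card W" arbitrary: W n rule: less_induct)
  case less
  note W = less.prems(1)
  have fW: "finite W" "inj_on \<iota> W" using W finX finY inj by (auto intro: finite_subset inj_on_subset)
  show ?case
  proof (cases "Y \<inter> W = {}")
    case True
    then have "Ind W = Pow W" by (auto simp: Ind_def)
    moreover have "acyclic_at TYPE('k) \<iota> n (Pow W)"
      using less.prems by (intro acyclic_Pow[OF fW]) auto
    ultimately show ?thesis by simp
  next
    case False
    then obtain y where y: "y \<in> Y \<inter> W" by blast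
    obtain m where n: "n = Suc m" "m \<ge> 2" using less.prems(2) by (cases n) auto
    let ?S = "{T \<in> Ind W. insert y T \<in> Ind W}"
    have lt: "card (W - {y}) < card W" "card (linkset W y) < card W"
      using y fW by (intro psubset_card_mono; force simp: linkset_def)+
    have sub: "W - {y} \<subseteq> X \<union> Y" "linkset W y \<subseteq> X \<union> Y" using W by (auto simp: linkset_def)
    have "acyclic_at TYPE('k) \<iota> (Suc m) (Ind (W - {y}) \<union> ?S)"
    proof (rule mayer_vietoris[OF simp_Ind[OF sub(1)] star_acyclic(1)[OF W] _ star_acyclic(2)[OF W]])
      show "acyclic_at TYPE('k) \<iota> (Suc m) (Ind (W - {y}))"
        using less.hyps[OF lt(1) sub(1)] n by auto
      fix g :: "'v set \<Rightarrow> 'k"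
      assume "\<And>T. T \<in> Ind (W - {y}) \<inter> ?S \<Longrightarrow> card T = Suc m \<Longrightarrow> scobd \<iota> g T = 0"
      then have g: "\<And>T. T \<in> Ind (linkset W y) \<Longrightarrow> card T = Suc m \<Longrightarrow> scobd \<iota> g T = 0"
        using linkset_Int[OF W y] by auto
      show "\<exists>h e. (\<forall>T\<in>Ind (W - {y}). card T = Suc m \<longrightarrow> scobd \<iota> h T = 0) \<and>
           (\<forall>T\<in>Ind (W - {y}) \<inter> ?S. card T = m \<longrightarrow> g T = h T + scobd \<iota> e T)"
      proof (cases "m = 2")
        case False
        then have "acyclic_at TYPE('k) \<iota> m (Ind (linkset W y))"
          using less.hyps[OF lt(2) sub(2)] n by auto
        then obtain e where "\<forall>T\<in>Ind (linkset W y). card T = m \<longrightarrow> g T = scobd \<iota> e T"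
          using g unfolding acyclic_at_def by blast
        then show ?thesis unfolding linkset_Int[OF W y]
          by (intro exI[of _ "\<lambda>_. 0"] exI[of _ e]) (auto simp: cobd_def)
      next
        case True
        obtain e l where el: "\<And>T. T \<in> Ind (linkset W y) \<Longrightarrow> card T = 2 \<Longrightarrow> g T = join_cochain l T + scobd \<iota> e T"
          and l: "\<And>a b. step (linkset W y) a b \<Longrightarrow> l a = l b"
        proof (rule two_cocycle_normal_form[OF sub(2), of g])
          show "scobd \<iota> g T = 0" if "T \<in> Ind (linkset W y)" "card T = 3" for T
            using g[OF that(1)] that(2) True by simp
        qed blast
        have l': "l a = l b" if "conn (linkset W y) a b" for a b
          using that by induction (auto dest: l)
        let ?P = "\<lambda>z x. x \<in> X \<inter> linkset W y \<and> conn (W - {y}) z x"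
        \<comment> \<open>The extension of \<open>l\<close> takes the value of \<open>l\<close> on components that meet the link, and \<open>0\<close> on the others.\<close>
        define L where "L = (\<lambda>z. if \<exists>x. ?P z x then l (SOME x. ?P z x) else 0)"
        have L: "L z = l x" if zx: "?P z x" for z x
        proof -
          define x' where "x' = (SOME x. ?P z x)"
          have x': "?P z x'" unfolding x'_def using zx by (rule someI)
          then have "conn (W - {y}) x x'" using zx conn_sym by (metis rtranclp_trans)
          then have "conn (linkset W y) x x'"
            using lc W y zx x' unfolding links_connected_def by (auto simp: linkset_def)
          then show ?thesis using zx l' unfolding L_def x'_def by auto
        qed
        have Ls: "L a = L b" if "step (W - {y}) a b" for a b
        proof (cases "\<exists>x. ?P a x")
          case True
          then obtain x where x: "?P a x" by blast
          then have "?P b x" using step_sym[OF that] by (metis converse_rtranclp_into_rtranclp)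
          then show ?thesis using L x by metis
        next
          case False
          then have "\<not> (\<exists>x. ?P b x)" using that by (metis converse_rtranclp_into_rtranclp)
          then show ?thesis unfolding L_def using False by (simp only: if_False)
        qed
        have "join_cochain l T = join_cochain L T" if T: "T \<in> Ind (linkset W y)" "card T = 2" for T
        proof -
          have TS: "T \<subseteq> X \<union> Y" "T \<subseteq> linkset W y" using T sub by (auto simp: Ind_def)
          show ?thesis using T(2) TS(1)
          proof (cases rule: pair_cases)
            case (3 a b)
            then show ?thesis using L[of a a] TS(2) by auto
          qed (auto simp: join_pure)
        qed
        then show ?thesis using el join_cocycle[OF sub(1) Ls] True unfolding linkset_Int[OF W y]
          by (intro exI[of _ "join_cochain L"] exI[of _ e]) auto
      qed
    qed
    then show ?thesis using linkset_Int[OF W y] n by simp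
  qed
qed

text \<open>
  The class is the image under the Mayer-Vietoris connecting map of the indicator \<open>\<alpha>\<close> of the component of \<open>x\<close> in the
  link of \<open>y\<close>. If it were zero, then up to coboundaries \<open>\<alpha>\<close> would extend to \<open>W - {y}\<close>, where the normal form of a cocycle has equal
  values at \<open>x\<close> and \<open>x'\<close>; but \<open>\<alpha>\<close> is 1 at \<open>x\<close> and 0 at \<open>x'\<close>.
\<close>

theorem not_acyclic_3:
  assumes W: "W \<subseteq> X \<union> Y" and y: "y \<in> Y \<inter> W" and x: "x \<in> X \<inter> W" "x' \<in> X \<inter> W" "B x y" "B x' y"
    and c: "conn (W - {y}) x x'" and nc: "\<not> conn (linkset W y) x x'"
  shows "\<not> acyclic_at TYPE('k::field) \<iota> 3 (Ind W)"
proof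
  assume acy: "acyclic_at TYPE('k) \<iota> 3 (Ind W)"
  let ?W2 = "linkset W y" and ?S = "{T \<in> Ind W. insert y T \<in> Ind W}"
  have sub: "W - {y} \<subseteq> X \<union> Y" "?W2 \<subseteq> X \<union> Y" using W by (auto simp: linkset_def)
  define l :: "'v \<Rightarrow> 'k" where "l = (\<lambda>z. if conn ?W2 x z then 1 else 0)"
  define \<alpha> where "\<alpha> = (\<lambda>T. if T \<subseteq> ?W2 then join_cochain l T else 0)"
  \<comment> \<open>The connecting map: extend \<open>\<alpha>\<close> to the star of \<open>y\<close>, and take the coboundary there and zero on the other part.\<close>
  define g where "g = (\<lambda>T. if y \<in> T then scobd \<iota> \<alpha> T else 0)"
  have ls: "l a = l b" if "step ?W2 a b" for a b
    using that step_sym[OF that] unfolding l_def by (metis rtranclp.rtrancl_into_rtrancl)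
  have \<alpha>3: "scobd \<iota> \<alpha> T = 0" if T: "T \<in> Ind ?W2" "card T = 3" for T
  proof -
    have "scobd \<iota> \<alpha> T = scobd \<iota> (join_cochain l) T"
      by (rule cobd_cong) (use T in \<open>auto simp: \<alpha>_def Ind_def\<close>)
    then show ?thesis using join_cocycle[OF sub(2) ls T] by simp
  qed
  have g4: "scobd \<iota> g T = 0" if T: "T \<in> Ind W" "card T = Suc 3" for T
  proof (cases "y \<in> T")
    case True
    note fT = simplicialD[OF simp_Ind[OF W] T(1)]
    have "T - {y} \<in> Ind ?W2" using T True y notXY by (auto simp: Ind_def linkset_def)
    then have *: "scobd \<iota> \<alpha> (T - {y}) = 0" using \<alpha>3 T True fT by simp
    have "scobd \<iota> g T = scobd \<iota> (scobd \<iota> \<alpha>) T"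
      by (rule cobd_cong) (use True * in \<open>auto simp: g_def\<close>)
    then show ?thesis using fT by (simp add: cobd_cobd)
  qed (auto simp: g_def intro: cobd_zero)
  obtain h where h: "\<And>T. T \<in> Ind W \<Longrightarrow> card T = 3 \<Longrightarrow> g T = scobd \<iota> h T"
    using acy g4 unfolding acyclic_at_def by blast
  have "scobd \<iota> h T = 0" if "T \<in> Ind (W - {y})" "card T = 3" for T
  proof -
    have "T \<in> Ind W" "y \<notin> T" using that by (auto simp: Ind_def)
    then show ?thesis using h[of T] that by (simp add: g_def)
  qed
  then obtain e' m where e': "\<And>T. T \<in> Ind (W - {y}) \<Longrightarrow> card T = 2 \<Longrightarrow> h T = join_cochain m T + scobd \<iota> e' T"
    and m: "\<And>a b. step (W - {y}) a b \<Longrightarrow> m a = m b"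
    by (elim two_cocycle_normal_form[OF sub(1), of h]) blast+
  have mx: "m x = m x'" using c by induction (auto dest: m)
  have "scobd \<iota> (\<lambda>S. h S - \<alpha> S) T = 0" if T: "T \<in> ?S" "card T = Suc 2" for T
  proof (cases "y \<in> T")
    case True
    then show ?thesis using h[of T] T by (auto simp: g_def cobd_diff)
  next
    case False
    then have "T \<in> Ind ?W2" using linkset_Int(1)[OF W y] T by (auto simp: Ind_def)
    then show ?thesis using h[of T] T False \<alpha>3[of T] by (auto simp: g_def cobd_diff)
  qed
  then obtain e'' where e'': "\<And>T. T \<in> ?S \<Longrightarrow> card T = 2 \<Longrightarrow> h T - \<alpha> T = scobd \<iota> e'' T"
    using acyclic_atD[OF star_acyclic(2)[OF W, of 2 y], of "\<lambda>S. h S - \<alpha> S"] by blast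
  \<comment> \<open>On the link, \<open>E\<close> is a primitive of the difference of the two normal forms. On single vertices
      it is constant along each side, so this difference has the same value on all mixed pairs.\<close>
  define E where "E = (\<lambda>S. e'' S - e' S)"
  have E: "scobd \<iota> E T = join_cochain m T - join_cochain l T" if T: "T \<in> Ind ?W2" "card T = 2" for T
  proof -
    have "T \<in> Ind (W - {y}) \<inter> ?S" using T linkset_Int(1)[OF W y] by auto
    then have "h T = join_cochain m T + scobd \<iota> e' T" "h T - join_cochain l T = scobd \<iota> e'' T"
      using e'[of T] e''[of T] T by (auto simp: \<alpha>_def Ind_def)
    then have "scobd \<iota> e' T = h T - join_cochain m T" "scobd \<iota> e'' T = h T - join_cochain l T" by simp_all
    then show ?thesis unfolding E_def cobd_diff by simp
  qed
  have EX: "E {a} = E {b}" if "a \<in> ?W2" "b \<in> ?W2" "a \<in> X \<and> b \<in> X \<or> a \<in> Y \<and> b \<in> Y" for a b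
  proof -
    have *: "E {a} = E {b}" if "a \<in> ?W2" "b \<in> ?W2" "a \<in> X \<and> b \<in> X \<or> a \<in> Y \<and> b \<in> Y" "\<iota> a < \<iota> b" for a b
    proof -
      have "{a,b} \<in> Ind ?W2" using that notXY by (auto simp: Ind_def)
      moreover have "a \<noteq> b" using that by auto
      ultimately show ?thesis using E[of "{a,b}"] that scobd_pair[of \<iota> a b E, OF that(4)] by (auto simp: join_pure)
    qed
    have "a = b \<or> \<iota> a < \<iota> b \<or> \<iota> b < \<iota> a" using that inj by (metis UnCI inj_onD linorder_neqE_nat)
    then show ?thesis using *[of a b] *[of b a] that by auto
  qed
  have Exy: "E {z} - E {a} = m a - l a" if "a \<in> X \<inter> ?W2" "z \<in> Y \<inter> ?W2" "B a z" for a z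
  proof -
    have "{a,z} \<in> Ind ?W2" using that notXY by (auto simp: Ind_def)
    then show ?thesis using E[of "{a,z}"] that XY[of a z] scobd_pair[of \<iota> a z E] by (auto simp: card_2_iff)
  qed
  have nx: "x \<noteq> x'" using nc by auto
  have nb: "\<exists>z\<in>Y \<inter> ?W2. B a z" if "conn (W - {y}) a b" "a \<noteq> b" for a b
    using that(1) that(2) by (cases rule: converse_rtranclpE) (auto simp: step_def linkset_def dest: notXY)
  obtain z z' where z: "z \<in> Y \<inter> ?W2" "B x z" "z' \<in> Y \<inter> ?W2" "B x' z'"
    using nb[OF c nx] nb[OF conn_sym[OF c]] nx by blast
  have x2: "x \<in> X \<inter> ?W2" "x' \<in> X \<inter> ?W2" using x y notXY by (auto simp: linkset_def)
  have "m x - l x = m x' - l x'"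
    using Exy[OF x2(1) z(1,2)] Exy[OF x2(2) z(3,4)] EX[of x x'] EX[of z z'] x2 z by auto
  then show False using mx nc by (simp add: l_def)
qed

text \<open>
  Two edges of the bipartite complement without common vertices are joined by a third one, so two
  neighbours of \<open>y\<close> that both have a neighbour besides \<open>y\<close> already have a common one.
\<close>

lemma no_2K2_links_connected:
  assumes "\<And>x x' y y'. x \<in> X \<Longrightarrow> x' \<in> X \<Longrightarrow> y \<in> Y \<Longrightarrow> y' \<in> Y \<Longrightarrow> B x y \<Longrightarrow> B x' y' \<Longrightarrow> B x y' \<or> B x' y"
  shows links_connected
  unfolding links_connected_def
proof (intro allI impI)
  fix W y x x'
  assume W: "W \<subseteq> X \<union> Y" and y: "y \<in> Y \<inter> W" and x: "x \<in> X \<inter> W" "x' \<in> X \<inter> W" "B x y" "B x' y"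
    and c: "conn (W - {y}) x x'"
  show "conn (linkset W y) x x'"
  proof (cases "x = x'")
    case False
    have nb: "\<exists>z\<in>Y \<inter> linkset W y. B a z" if "conn (W - {y}) a b" "a \<noteq> b" for a b
      using that(1) that(2) by (cases rule: converse_rtranclpE) (auto simp: step_def linkset_def dest: notXY)
    obtain z z' where z: "z \<in> Y \<inter> linkset W y" "B x z" "z' \<in> Y \<inter> linkset W y" "B x' z'"
      using nb[OF c False] nb[OF conn_sym[OF c]] False by blast
    then have "B x z' \<or> B x' z" using assms x by blast
    then have "step (linkset W y) x x'" using x y z notXY by (auto simp: step_def linkset_def)
    then show ?thesis by blast
  qed auto
qed

text \<open>
  All edges of the bipartite complement lie in a single component, hence the normal form is one constant \<open>c\<close> on all
  mixed pairs, and this is the coboundary of the function with value \<open>c\<close> on \<open>Y\<close> and \<open>0\<close> on \<open>X\<close>.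
\<close>

theorem no_2K2_acyclic_2:
  assumes B: "\<And>x x' y y'. x \<in> X \<Longrightarrow> x' \<in> X \<Longrightarrow> y \<in> Y \<Longrightarrow> y' \<in> Y \<Longrightarrow> B x y \<Longrightarrow> B x' y' \<Longrightarrow> B x y' \<or> B x' y"
    and W: "W \<subseteq> X \<union> Y"
  shows "acyclic_at TYPE('k::field) \<iota> 2 (Ind W)"
  unfolding acyclic_at_def
proof (intro allI impI)
  fix g :: "'v set \<Rightarrow> 'k"
  assume "\<forall>T\<in>Ind W. card T = Suc 2 \<longrightarrow> scobd \<iota> g T = 0"
  then have "\<And>T. T \<in> Ind W \<Longrightarrow> card T = 3 \<Longrightarrow> scobd \<iota> g T = 0" by simp
  then obtain e l where el: "\<And>T. T \<in> Ind W \<Longrightarrow> card T = 2 \<Longrightarrow> g T = join_cochain l T + scobd \<iota> e T"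
    and l: "\<And>a b. step W a b \<Longrightarrow> l a = l b"
    by (elim two_cocycle_normal_form[OF W, of g]) blast+
  let ?P = "\<lambda>x. x \<in> X \<inter> W \<and> (\<exists>y\<in>Y \<inter> W. B x y)"
  have "\<exists>c. \<forall>x. ?P x \<longrightarrow> l x = c"
  proof (cases "\<exists>x. ?P x")
    case True
    then obtain x\<^sub>0 y\<^sub>0 where x0: "x\<^sub>0 \<in> X \<inter> W" "y\<^sub>0 \<in> Y \<inter> W" "B x\<^sub>0 y\<^sub>0" by blast
    have "l x = l x\<^sub>0" if "x \<in> X \<inter> W" "y \<in> Y \<inter> W" "B x y" for x y
    proof -
      have "B x y\<^sub>0 \<or> B x\<^sub>0 y" using B[of x x\<^sub>0 y y\<^sub>0] x0 that by blast
      then have "step W x x\<^sub>0" using that x0 unfolding step_def by auto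
      then show ?thesis by (rule l)
    qed
    then show ?thesis by blast
  qed blast
  then obtain c where c: "\<And>x. ?P x \<Longrightarrow> l x = c" by blast
  have "g T = scobd \<iota> (\<lambda>S. e S + (if S \<subseteq> Y then c else 0)) T" if T: "T \<in> Ind W" "card T = 2" for T
  proof -
    have TS: "T \<subseteq> X \<union> Y" "T \<subseteq> W" using T W by (auto simp: Ind_def)
    show ?thesis using T(2) TS(1)
    proof (cases rule: pair_cases)
      case (3 a b)
      then have "B a b" using T by (auto simp: Ind_def)
      then have "l a = c" using c 3 TS by auto
      then show ?thesis using 3 el[OF T] notXY by (simp add: cobd_add scobd_pair)
    qed (use el[OF T] notXY in \<open>simp_all add: cobd_add scobd_pair join_pure\<close>)
  qed
  then show "\<exists>h. \<forall>T\<in>Ind W. card T = 2 \<longrightarrow> g T = scobd \<iota> h T" by blast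
qed

text \<open>
  The independence complex of \<open>2K\<^sub>2\<close> is a cycle of length 4.
\<close>

theorem two_K2_not_acyclic_2:
  assumes x: "x \<in> X" "x' \<in> X" "y \<in> Y" "y' \<in> Y" "B x y" "B x' y'" "\<not> B x y'" "\<not> B x' y"
  shows "\<not> acyclic_at TYPE('k::field) \<iota> 2 (Ind {x,x',y,y'})"
proof
  let ?W = "{x,x',y,y'}"
  assume acy: "acyclic_at TYPE('k) \<iota> 2 (Ind ?W)"
  define l :: "'v \<Rightarrow> 'k" where "l = (\<lambda>z. if z = x then 1 else 0)"
  have W: "?W \<subseteq> X \<union> Y" using x by auto
  have "l a = l b" if "step ?W a b" for a b
    using that x notXY by (auto simp: step_def l_def)
  then have "scobd \<iota> (join_cochain l) T = 0" if "T \<in> Ind ?W" "card T = Suc 2" for T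
    using join_cocycle[OF W _ that(1), of l] that(2) by simp
  from acyclic_atD[OF acy this] obtain e where e: "\<And>T. T \<in> Ind ?W \<Longrightarrow> card T = 2 \<Longrightarrow> join_cochain l T = scobd \<iota> e T"
    by blast
  have ne: "x \<noteq> x'" "y \<noteq> y'" using x by auto
  have *: "e {a} = e {b}" if "a \<in> X \<and> b \<in> X \<or> a \<in> Y \<and> b \<in> Y" "a \<in> ?W" "b \<in> ?W" "\<iota> a < \<iota> b" for a b
  proof -
    have "{a,b} \<in> Ind ?W" using that notXY by (auto simp: Ind_def)
    moreover have "a \<noteq> b" using that by auto
    ultimately show ?thesis using e[of "{a,b}"] scobd_pair[of \<iota> a b e, OF that(4)] that by (auto simp: join_pure)
  qed
  have "\<iota> x \<noteq> \<iota> x'" "\<iota> y \<noteq> \<iota> y'" using inj x ne by (auto simp: inj_on_def)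
  then have "e {x} = e {x'}" "e {y} = e {y'}"
    using *[of x x'] *[of x' x] *[of y y'] *[of y' y] x by (auto simp: linorder_neq_iff)
  moreover have "e {b} - e {a} = l a" if "a \<in> X" "b \<in> Y" "B a b" "a \<in> ?W" "b \<in> ?W" for a b
  proof -
    have "{a,b} \<in> Ind ?W" using that notXY by (auto simp: Ind_def)
    moreover have "a \<noteq> b" using that notXY by auto
    ultimately show ?thesis using e[of "{a,b}"] scobd_pair[of \<iota> a b e] XY[of a b] that by auto
  qed
  from this[of x y] this[of x' y'] have "e {y} - e {x} = 1" "e {y'} - e {x'} = 0" using x ne by (auto simp: l_def)
  ultimately show False by simp
qed

end

section \<open>Induced cycles in the complement and in the bipartite complement\<close>

text \<open>
  Induced cycles without reference to subgraphs: the subgraph of \<open>A\<close> induced on \<open>S\<close> is 2-regular, and it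
  is connected in the sense that no proper nonempty subset of \<open>S\<close> is closed under adjacency.
\<close>

definition two_regular_component :: "('v \<times> 'v) set \<Rightarrow> 'v set \<Rightarrow> bool" where
  "two_regular_component A S \<longleftrightarrow> (\<forall>v\<in>S. card {w \<in> S. (v, w) \<in> A} = 2) \<and>
     (\<forall>U. U \<noteq> {} \<longrightarrow> U \<subseteq> S \<longrightarrow> (\<forall>u\<in>U. \<forall>w\<in>S. (u, w) \<in> A \<longrightarrow> w \<in> U) \<longrightarrow> U = S)"

lemma two_regular_componentD:
  assumes "two_regular_component A S"
  shows "v \<in> S \<Longrightarrow> card {w \<in> S. (v, w) \<in> A} = 2"
    "U \<noteq> {} \<Longrightarrow> U \<subseteq> S \<Longrightarrow> (\<And>u w. u \<in> U \<Longrightarrow> w \<in> S \<Longrightarrow> (u, w) \<in> A \<Longrightarrow> w \<in> U) \<Longrightarrow> U = S"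
  using assms unfolding two_regular_component_def by blast+

lemma connected_iff_closed:
  assumes "pair_graph C"
  shows "Digraph_Component.connected (with_proj C) \<longleftrightarrow> pverts C \<noteq> {} \<and>
    (\<forall>U. U \<noteq> {} \<longrightarrow> U \<subseteq> pverts C \<longrightarrow> (\<forall>u\<in>U. \<forall>w\<in>pverts C. (u, w) \<in> parcs C \<longrightarrow> w \<in> U) \<longrightarrow> U = pverts C)"
    (is "_ \<longleftrightarrow> _ \<and> ?R")
proof -
  interpret pair_graph C by fact
  have "symmetric (with_proj C)" by (rule pair_sym_arcs)
  have "Digraph_Component.connected (with_proj C) \<longleftrightarrow> pverts C \<noteq> {} \<and> (\<forall>u\<in>pverts C. \<forall>v\<in>pverts C. (u, v) \<in> rtrancl_on (pverts C) (parcs C))"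
    unfolding Digraph_Component.connected_def strongly_connected_def reachable_def
    using adj_mk_symmetric_eq[OF pair_sym_arcs] by simp
  also have "(\<forall>u\<in>pverts C. \<forall>v\<in>pverts C. (u, v) \<in> rtrancl_on (pverts C) (parcs C)) \<longleftrightarrow> ?R"
  proof
    assume L: "\<forall>u\<in>pverts C. \<forall>v\<in>pverts C. (u, v) \<in> rtrancl_on (pverts C) (parcs C)"
    show ?R
    proof (intro allI impI)
      fix U assume U: "U \<noteq> {}" "U \<subseteq> pverts C" "\<forall>u\<in>U. \<forall>w\<in>pverts C. (u, w) \<in> parcs C \<longrightarrow> w \<in> U"
      obtain u where u: "u \<in> U" using U by blast
      have "v \<in> U" if "(u, v) \<in> rtrancl_on (pverts C) (parcs C)" for v
        using that u
      proof (induction rule: rtrancl_on_induct)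
        case (step y z)
        then show ?case using U(3) by blast
      qed
      then show "U = pverts C" using L U u by blast
    qed
  next
    assume R: ?R
    show "\<forall>u\<in>pverts C. \<forall>v\<in>pverts C. (u, v) \<in> rtrancl_on (pverts C) (parcs C)"
    proof
      fix u assume u: "u \<in> pverts C"
      let ?U = "{v \<in> pverts C. (u, v) \<in> rtrancl_on (pverts C) (parcs C)}"
      have "u \<in> ?U" using u by simp
      moreover have "\<forall>v\<in>?U. \<forall>w\<in>pverts C. (v, w) \<in> parcs C \<longrightarrow> w \<in> ?U"
        by (auto intro: rtrancl_on_into_rtrancl_on)
      ultimately have "?U = pverts C" using R[rule_format, of ?U] by blast
      then show "\<forall>v\<in>pverts C. (u, v) \<in> rtrancl_on (pverts C) (parcs C)" by blast
    qed
  qed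
  finally show ?thesis .
qed

lemma out_degree_pair: "out_degree (with_proj C) v = card {w. (v, w) \<in> parcs C}"
proof -
  have "out_arcs (with_proj C) v = Pair v ` {w. (v, w) \<in> parcs C}" by (auto simp: out_arcs_def)
  then show ?thesis unfolding out_degree_def by (simp add: card_image inj_on_def)
qed

lemma has_induced_cycle_ge_iff:
  assumes H: "pair_graph H" and t: "t \<ge> 4"
  shows "has_induced_cycle_ge t H \<longleftrightarrow> (\<exists>S \<subseteq> pverts H. card S \<ge> t \<and> two_regular_component (parcs H) S)"
proof
  assume "has_induced_cycle_ge t H"
  then obtain s C where s: "s \<ge> t" "cycle_graph s C" and ind: "induced_subgraph (with_proj C) (with_proj H)"
    unfolding has_induced_cycle_ge_def by blast
  have C: "pair_graph C" "Digraph_Component.connected (with_proj C)" "card (pverts C) = s"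
    "\<And>v. v \<in> pverts C \<Longrightarrow> out_degree (with_proj C) v = 2"
    using s(2) by (auto simp: cycle_graph_def)
  interpret C: pair_graph C by (rule C(1))
  have sub: "pverts C \<subseteq> pverts H" using ind by (auto simp: induced_subgraph_def subgraph_def)
  have arcs: "parcs C = {e \<in> parcs H. fst e \<in> pverts C \<and> snd e \<in> pverts C}"
    using conjunct2[OF ind[unfolded induced_subgraph_def]] by (simp only: with_proj_simps)
  have nb: "{w. (v, w) \<in> parcs C} = {w \<in> pverts C. (v, w) \<in> parcs H}" if "v \<in> pverts C" for v
    unfolding arcs using that by auto
  have "two_regular_component (parcs H) (pverts C)" unfolding two_regular_component_def
  proof (intro conjI ballI allI impI)
    show "card {w \<in> pverts C. (v, w) \<in> parcs H} = 2" if "v \<in> pverts C" for v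
      using C(4)[OF that] nb[OF that] by (simp add: out_degree_pair)
    fix U assume U: "U \<noteq> {}" "U \<subseteq> pverts C" "\<forall>u\<in>U. \<forall>w\<in>pverts C. (u, w) \<in> parcs H \<longrightarrow> w \<in> U"
    have "\<forall>u\<in>U. \<forall>w\<in>pverts C. (u, w) \<in> parcs C \<longrightarrow> w \<in> U" using U(3) unfolding arcs by blast
    then show "U = pverts C" using C(2) U(1,2) unfolding connected_iff_closed[OF C(1)] by blast
  qed
  then show "\<exists>S \<subseteq> pverts H. card S \<ge> t \<and> two_regular_component (parcs H) S"
    using sub C(3) s(1) by blast
next
  interpret H: pair_graph H by (rule H)
  assume "\<exists>S \<subseteq> pverts H. card S \<ge> t \<and> two_regular_component (parcs H) S"
  then obtain S where S: "S \<subseteq> pverts H" "card S \<ge> t" "two_regular_component (parcs H) S" by blast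
  let ?C = "\<lparr> pverts = S, parcs = {(u, v) \<in> parcs H. u \<in> S \<and> v \<in> S} \<rparr> :: 'a pair_pre_digraph"
  have fS: "finite S" using S(1) H.pair_finite_verts by (rule finite_subset)
  have "symmetric (with_proj ?C)"
    using H.arcs_symmetric by (auto simp: symmetric_def sym_def)
  moreover have "finite (parcs ?C)" using H.pair_finite_arcs by (rule rev_finite_subset) auto
  ultimately have C: "pair_graph ?C"
    using fS H.no_loops' by unfold_locales auto
  have "S \<noteq> {}" using S(2) t by auto
  have "out_degree (with_proj ?C) v = 2" if "v \<in> S" for v
  proof -
    have "{w. (v, w) \<in> parcs ?C} = {w \<in> S. (v, w) \<in> parcs H}" using that by auto
    then show ?thesis using two_regular_componentD(1)[OF S(3) that] unfolding out_degree_pair by simp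
  qed
  moreover have "Digraph_Component.connected (with_proj ?C)"
    unfolding connected_iff_closed[OF C]
  proof (intro conjI allI impI)
    show "pverts ?C \<noteq> {}" using \<open>S \<noteq> {}\<close> by simp
    fix U assume U: "U \<noteq> {}" "U \<subseteq> pverts ?C" "\<forall>u\<in>U. \<forall>w\<in>pverts ?C. (u, w) \<in> parcs ?C \<longrightarrow> w \<in> U"
    have "U = S" by (rule two_regular_componentD(2)[OF S(3) U(1)]) (use U in auto)
    then show "U = pverts ?C" by simp
  qed
  ultimately have "cycle_graph (card S) ?C"
    unfolding cycle_graph_def using C S(2) t by simp
  moreover have "induced_subgraph (with_proj ?C) (with_proj H)"
    unfolding induced_subgraph_def subgraph_def
    using S(1) pair_wf_digraph.intro C H
    by (auto simp: wf_digraph_wp_iff compatible_def pair_graph_def pair_digraph_def pair_fin_digraph_def)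
  ultimately show "has_induced_cycle_ge t H" unfolding has_induced_cycle_ge_def using S(2) by blast
qed

lemma pair_graph_complement: "pair_graph G \<Longrightarrow> pair_graph (complement_graph G)"
proof -
  assume "pair_graph G"
  then interpret pair_graph G .
  have "finite (parcs (complement_graph G))"
    by (rule finite_subset[of _ "pverts G \<times> pverts G"]) (use pair_finite_verts in \<open>auto simp: complement_graph_def\<close>)
  moreover have "symmetric (with_proj (complement_graph G))"
    using arcs_symmetric by (auto simp: symmetric_def sym_def complement_graph_def)
  ultimately show ?thesis
    using pair_finite_verts by unfold_locales (auto simp: complement_graph_def)
qed

lemma pair_graph_bipartite_complement:
  assumes "pair_graph G" "bipartition G X Y"
  shows "pair_graph (bipartite_complement G X Y)"
proof -
  interpret pair_graph G by fact
  have XY: "X \<union> Y = pverts G" "X \<inter> Y = {}" using assms(2) by (auto simp: bipartition_def)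
  have "finite (parcs (bipartite_complement G X Y))"
    by (rule finite_subset[of _ "pverts G \<times> pverts G"]) (use pair_finite_verts XY in \<open>auto simp: bipartite_complement_def\<close>)
  moreover have "symmetric (with_proj (bipartite_complement G X Y))"
    using arcs_symmetric by (auto simp: symmetric_def sym_def bipartite_complement_def)
  moreover have "finite (X \<union> Y)" using XY pair_finite_verts by simp
  ultimately show ?thesis
    using XY(2) by unfold_locales (auto simp: bipartite_complement_def)
qed

lemma card2_cases: "card {w \<in> S. P w} = 2 \<Longrightarrow> a \<in> S \<Longrightarrow> b \<in> S \<Longrightarrow> a \<noteq> b \<Longrightarrow> P a \<Longrightarrow> P b \<Longrightarrow> {w \<in> S. P w} = {a, b}"
  by (rule card_subset_eq[symmetric]) (auto intro: card_ge_0_finite)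

text \<open>
  The sides \<open>X\<close> and \<open>Y\<close> are cliques of the complement, so a cycle of length \<open>\<ge> 4\<close> has at most two vertices in
  each of them: three would be a triangle, which is a whole 2-regular component. Hence it is a
  4-cycle with one edge inside each side and two edges across; the two remaining pairs across are edges of \<open>G\<close> and form an
  induced \<open>2K\<^sub>2\<close>.
\<close>

lemma complement_cycle_iff_2K2:
  assumes G: "pair_graph G" and bip: "bipartition G X Y"
  shows "has_induced_cycle_ge 4 (complement_graph G) \<longleftrightarrow>
    (\<exists>x\<in>X. \<exists>x'\<in>X. \<exists>y\<in>Y. \<exists>y'\<in>Y. (x, y) \<notin> parcs G \<and> (x', y') \<notin> parcs G \<and> (x, y') \<in> parcs G \<and> (x', y) \<in> parcs G)"
    (is "_ \<longleftrightarrow> ?K")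
proof -
  interpret pair_graph G by fact
  have XY: "X \<union> Y = pverts G" "X \<inter> Y = {}" using bip by (auto simp: bipartition_def)
  have fin: "finite X" "finite Y" using XY(1) pair_finite_verts by (metis finite_Un)+
  have same: "(a, b) \<notin> parcs G" if "a \<in> X \<and> b \<in> X \<or> a \<in> Y \<and> b \<in> Y" for a b
    using bip that XY(2) by (auto simp: bipartition_def)
  let ?A = "parcs (complement_graph G)"
  have A: "(a, b) \<in> ?A \<longleftrightarrow> a \<in> pverts G \<and> b \<in> pverts G \<and> a \<noteq> b \<and> (a, b) \<notin> parcs G" for a b
    by (auto simp: complement_graph_def)
  have pv: "pverts (complement_graph G) = pverts G" by (simp add: complement_graph_def)
  show ?thesis unfolding has_induced_cycle_ge_iff[OF pair_graph_complement[OF G] order_refl] pv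
  proof
    assume "\<exists>S\<subseteq>pverts G. 4 \<le> card S \<and> two_regular_component ?A S"
    then obtain S where S: "S \<subseteq> pverts G" "4 \<le> card S" "two_regular_component ?A S" by blast
    have fS: "finite S" using S(1) pair_finite_verts by (rule finite_subset)
    have deg: "card (S \<inter> P) + card {w \<in> S \<inter> P'. (v, w) \<notin> parcs G} = 3"
      if P: "P = X \<and> P' = Y \<or> P = Y \<and> P' = X" and v: "v \<in> S \<inter> P" for P P' v
    proof -
      have PP: "P \<union> P' = pverts G" "P \<inter> P' = {}" using P XY by auto
      have "{w \<in> S. (v, w) \<in> ?A} = (S \<inter> P - {v}) \<union> {w \<in> S \<inter> P'. (v, w) \<notin> parcs G}"
        using S(1) v PP P same by (auto simp: A)
      moreover have "card \<dots> = card (S \<inter> P - {v}) + card {w \<in> S \<inter> P'. (v, w) \<notin> parcs G}"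
        using fS PP by (intro card_Un_disjoint) auto
      moreover have "Suc (card (S \<inter> P - {v})) = card (S \<inter> P)" using fS v by (intro card_Suc_Diff1) auto
      ultimately show ?thesis using two_regular_componentD(1)[OF S(3), of v] v by auto
    qed
    have le2: "card (S \<inter> P) \<le> 2" if P: "P = X \<and> P' = Y \<or> P = Y \<and> P' = X" for P P'
    proof (rule ccontr)
      assume "\<not> ?thesis"
      then have c3: "card (S \<inter> P) = 3" using deg[OF P] by (cases "S \<inter> P = {}") force+
      have "S \<inter> P = S"
      proof (rule two_regular_componentD(2)[OF S(3)])
        show "S \<inter> P \<noteq> {}" using c3 by auto
        show "w \<in> S \<inter> P" if "u \<in> S \<inter> P" "w \<in> S" "(u, w) \<in> ?A" for u w
        proof -
          have "card {w \<in> S \<inter> P'. (u, w) \<notin> parcs G} = 0" using deg[OF P that(1)] c3 by simp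
          then have "{w \<in> S \<inter> P'. (u, w) \<notin> parcs G} = {}" using fS by simp
          then show ?thesis using that P XY S(1) by (auto simp: A)
        qed
      qed auto
      then show False using c3 S(2) by simp
    qed
    have "S = (S \<inter> X) \<union> (S \<inter> Y)" using S(1) XY by auto
    then have "card S \<le> card (S \<inter> X) + card (S \<inter> Y)" by (metis card_Un_le)
    then have c: "card (S \<inter> X) = 2" "card (S \<inter> Y) = 2" using le2[of X Y] le2[of Y X] S(2) by auto
    then obtain x x' where x: "S \<inter> X = {x, x'}" "x \<noteq> x'" by (auto simp: card_2_iff)
    \<comment> \<open>Each vertex of the cycle has one neighbour on its own side, hence exactly one on the other side.\<close>
    have one: "\<exists>!y. y \<in> S \<inter> Y \<and> (v, y) \<notin> parcs G" if "v \<in> S \<inter> X" for v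
    proof -
      have "card {w \<in> S \<inter> Y. (v, w) \<notin> parcs G} = 1" using deg[of X Y v] that c by simp
      then obtain y where "{w \<in> S \<inter> Y. (v, w) \<notin> parcs G} = {y}" by (rule card_1_singletonE)
      then have "w \<in> S \<inter> Y \<and> (v, w) \<notin> parcs G \<longleftrightarrow> w = y" for w by blast
      then show ?thesis by (intro ex1I[of _ y]) simp_all
    qed
    have one': "card {w \<in> S \<inter> X. (v, w) \<notin> parcs G} = 1" if "v \<in> S \<inter> Y" for v
      using deg[of Y X v] that c by simp
    obtain y where y: "y \<in> S \<inter> Y" "(x, y) \<notin> parcs G" using one[of x] x by auto
    obtain y' where y': "y' \<in> S \<inter> Y" "(x', y') \<notin> parcs G" using one[of x'] x by auto
    have "y \<noteq> y'"
    proof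
      assume "y = y'"
      then have "{w \<in> S \<inter> X. (y, w) \<notin> parcs G} = {x, x'}" using x y y' arcs_symmetric by auto
      then show False using one'[OF y(1)] x(2) by simp
    qed
    then have "(x, y') \<in> parcs G" "(x', y) \<in> parcs G" using one[of x] one[of x'] x y y' by auto
    then show ?K using x y y' by blast
  next
    assume ?K
    then obtain x x' y y' where k: "x \<in> X" "x' \<in> X" "y \<in> Y" "y' \<in> Y" "(x, y) \<notin> parcs G" "(x', y') \<notin> parcs G"
      "(x, y') \<in> parcs G" "(x', y) \<in> parcs G" by blast
    have ne: "x \<noteq> x'" "y \<noteq> y'" "x \<noteq> y" "x \<noteq> y'" "x' \<noteq> y" "x' \<noteq> y'" using k XY by auto
    let ?S = "{x, x', y, y'}"
    have V: "?S \<subseteq> pverts G" using k XY by auto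
    have k': "(y, x) \<notin> parcs G" "(y', x') \<notin> parcs G" "(y', x) \<in> parcs G" "(y, x') \<in> parcs G" 
      "(x, x') \<notin> parcs G" "(x', x) \<notin> parcs G" "(y, y') \<notin> parcs G" "(y', y) \<notin> parcs G"
      using k arcs_symmetric same by blast+
    have VS: "x \<in> pverts G" "x' \<in> pverts G" "y \<in> pverts G" "y' \<in> pverts G" using V by auto
    have n: "{w \<in> ?S. (x, w) \<in> ?A} = {x', y}" "{w \<in> ?S. (x', w) \<in> ?A} = {x, y'}"
      "{w \<in> ?S. (y, w) \<in> ?A} = {x, y'}" "{w \<in> ?S. (y', w) \<in> ?A} = {x', y}"
      unfolding A using k(5-8) k' ne ne[symmetric] VS by blast+
    have "card {w \<in> ?S. (v, w) \<in> ?A} = 2" if v: "v \<in> ?S" for v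
    proof -
      consider "v = x" | "v = x'" | "v = y" | "v = y'" using v by blast
      then show ?thesis
        by cases (use ne in \<open>simp_all only: n, simp_all\<close>)
    qed
    moreover have "U = ?S" if U: "U \<noteq> {}" "U \<subseteq> ?S" "\<forall>u\<in>U. \<forall>w\<in>?S. (u, w) \<in> ?A \<longrightarrow> w \<in> U" for U
    proof -
      have nb: "w \<in> U" if "u \<in> U" "w \<in> {w \<in> ?S. (u, w) \<in> ?A}" for u w using U(3) that by blast
      have "x \<in> U \<Longrightarrow> x' \<in> U \<and> y \<in> U" using nb[of x] unfolding n by blast
      moreover have "x' \<in> U \<Longrightarrow> x \<in> U \<and> y' \<in> U" using nb[of x'] unfolding n by blast
      moreover have "y \<in> U \<Longrightarrow> x \<in> U \<and> y' \<in> U" using nb[of y] unfolding n by blast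
      moreover have "y' \<in> U \<Longrightarrow> x' \<in> U \<and> y \<in> U" using nb[of y'] unfolding n by blast
      ultimately show ?thesis using U(1,2) by blast
    qed
    ultimately have "two_regular_component ?A ?S" unfolding two_regular_component_def by blast
    moreover have "card ?S = 4" using ne by simp
    ultimately show "\<exists>S\<subseteq>pverts G. 4 \<le> card S \<and> two_regular_component ?A S" using V by (intro exI[of _ ?S]) simp
  qed
qed

text \<open>
  A cycle of length \<open>2n\<close> is presented by its two colour classes \<open>p\<close>, \<open>z\<close>, in the cyclic order
  \<open>p 0, z 0, p 1, z 1, \<dots>, z (n - 1)\<close>, so that \<open>z j\<close> is adjacent to \<open>p j\<close> and \<open>p (j + 1)\<close>, with indices modulo \<open>n\<close>.
\<close>

lemma zigzag_two_regular:
  fixes p z :: "nat \<Rightarrow> 'v"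
  assumes n: "n \<ge> 2" and inj: "inj_on p {..<n}" "inj_on z {..<n}" and disj: "p ` {..<n} \<inter> z ` {..<n} = {}"
    and pz: "\<And>i j. i < n \<Longrightarrow> j < n \<Longrightarrow> (p i, z j) \<in> A \<longleftrightarrow> i = j \<or> i = Suc j mod n"
    and zp: "\<And>i j. i < n \<Longrightarrow> j < n \<Longrightarrow> (z j, p i) \<in> A \<longleftrightarrow> i = j \<or> i = Suc j mod n"
    and pp: "\<And>i j. i < n \<Longrightarrow> j < n \<Longrightarrow> (p i, p j) \<notin> A" and zz: "\<And>i j. i < n \<Longrightarrow> j < n \<Longrightarrow> (z i, z j) \<notin> A"
  shows "two_regular_component A (p ` {..<n} \<union> z ` {..<n})"
proof -
  let ?S = "p ` {..<n} \<union> z ` {..<n}"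
  have nz: "{w \<in> ?S. (z j, w) \<in> A} = p ` {j, Suc j mod n}" "card {j, Suc j mod n} = 2" "{j, Suc j mod n} \<subseteq> {..<n}" if "j < n" for j
    using that n zz zp by (auto simp: mod_Suc)
  \<comment> \<open>The cyclic predecessor.\<close>
  define pr where "pr = (\<lambda>i. if i = 0 then n - 1 else i - 1)"
  have pr: "i = Suc j mod n \<longleftrightarrow> j = pr i" if "i < n" "j < n" for i j
    using that n by (auto simp: pr_def mod_Suc)
  have np: "{w \<in> ?S. (p i, w) \<in> A} = z ` {i, pr i}" "card {i, pr i} = 2" "{i, pr i} \<subseteq> {..<n}" if i: "i < n" for i
  proof -
    show s: "{i, pr i} \<subseteq> {..<n}" "card {i, pr i} = 2" using i n by (auto simp: pr_def)
    have "(p i, z j) \<in> A \<longleftrightarrow> j \<in> {i, pr i}" if "j < n" for j using pz[OF i that] pr[OF i that] by auto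
    then show "{w \<in> ?S. (p i, w) \<in> A} = z ` {i, pr i}" using pp[OF i] s(1) by auto
  qed
  show "two_regular_component A ?S" unfolding two_regular_component_def
  proof (intro conjI allI impI ballI)
    fix v assume "v \<in> ?S"
    then consider i where "i < n" "v = p i" | j where "j < n" "v = z j" by auto
    then show "card {w \<in> ?S. (v, w) \<in> A} = 2"
    proof cases
      case 1
      then show ?thesis using np[of i] card_image[OF inj_on_subset[OF inj(2) np(3)[of i]]] by simp
    next
      case 2
      then show ?thesis using nz[of j] card_image[OF inj_on_subset[OF inj(1) nz(3)[of j]]] by simp
    qed
  next
    fix U assume U: "U \<noteq> {}" "U \<subseteq> ?S" "\<forall>u\<in>U. \<forall>w\<in>?S. (u, w) \<in> A \<longrightarrow> w \<in> U"
    have 1: "z i \<in> U" if "p i \<in> U" "i < n" for i using U(3) that pz[of i i] by blast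
    have 2: "p (Suc i mod n) \<in> U" if "z i \<in> U" "i < n" for i
    proof -
      have "Suc i mod n < n" using n by simp
      then show ?thesis using U(3) that zp[of "Suc i mod n" i] by blast
    qed
    have 3: "p i \<in> U" if "z i \<in> U" "i < n" for i using U(3) that zp[of i i] by blast
    obtain a where a: "a < n" "p a \<in> U" using U(1,2) 3 by auto
    have "p ((a + i) mod n) \<in> U" for i
    proof (induction i)
      case (Suc i)
      have "(a + i) mod n < n" using n by simp
      from 2[OF 1[OF Suc this] this] show ?case by (simp add: mod_Suc_eq)
    qed (use a in simp)
    moreover have "b = (a + (b + n - a)) mod n" if "b < n" for b using that a(1) by simp
    ultimately have "p b \<in> U" if "b < n" for b using that by metis
    then show "U = ?S" using U(2) 1 by blast
  qed
qed

context ordered_bipartite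
begin

text \<open>
  The bipartite complement as a symmetric relation on \<open>X \<union> Y\<close>.
\<close>

definition bcomp :: "('v \<times> 'v) set" where
  "bcomp = {(u, v). (u \<in> X \<and> v \<in> Y \<and> B u v) \<or> (u \<in> Y \<and> v \<in> X \<and> B v u)}"

text \<open>
  Adjacency is that of the bipartite complement. Take \<open>y\<close> on the cycle \<open>S\<close>, with neighbours \<open>a\<close> and \<open>b\<close> on it. Removing \<open>y\<close> leaves a path
  from \<open>a\<close> to \<open>b\<close>. Its vertices in \<open>X\<close> other than \<open>a\<close>, \<open>b\<close> are not adjacent to \<open>y\<close>, and \<open>a\<close>, \<open>b\<close> have no common neighbour
  besides \<open>y\<close>, since otherwise \<open>S\<close> would be a cycle of length 4; so \<open>a\<close> and \<open>b\<close> are separated in the link of \<open>y\<close>.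
  That \<open>a\<close> and \<open>b\<close> are connected in \<open>S - {y}\<close> is seen without walking along the cycle: otherwise the component of
  \<open>a\<close> would have exactly one vertex of odd degree.
\<close>

lemma cycle_not_links_connected:
  assumes S: "S \<subseteq> X \<union> Y" "card S \<ge> 6" "two_regular_component bcomp S"
  shows "\<not> links_connected"
proof
  assume lc: links_connected
  have fS: "finite S" using S(1) finX finY finite_subset by blast
  note deg = two_regular_componentD(1)[OF S(3)]
  have nX: "{w \<in> S. (v, w) \<in> bcomp} = {y \<in> Y \<inter> S. B v y}" if "v \<in> X" for v
    using that notXY by (auto simp: bcomp_def)
  have nY: "{w \<in> S. (v, w) \<in> bcomp} = {x \<in> X \<inter> S. B x v}" if "v \<in> Y" for v
    using that notXY by (auto simp: bcomp_def)
  have degX: "card {y \<in> Y \<inter> S. B x y} = 2" if "x \<in> X \<inter> S" for x using deg[of x] nX[of x] that by auto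
  have degY: "card {x \<in> X \<inter> S. B x y} = 2" if "y \<in> Y \<inter> S" for y using deg[of y] nY[of y] that by auto
  have "\<exists>y. y \<in> Y \<inter> S"
  proof -
    obtain v where v: "v \<in> S" using S(2) by fastforce
    show ?thesis
    proof (cases "v \<in> X")
      case True
      then have "card {y \<in> Y \<inter> S. B v y} = 2" using degX[of v] v by blast
      then have "{y \<in> Y \<inter> S. B v y} \<noteq> {}" by (metis card.empty zero_neq_numeral)
      then show ?thesis by blast
    qed (use v S(1) in auto)
  qed
  then obtain y where y: "y \<in> Y \<inter> S" by blast
  obtain a b where ab: "{x \<in> X \<inter> S. B x y} = {a, b}" "a \<noteq> b" using degY[OF y] by (auto simp: card_2_iff)
  have a: "a \<in> X \<inter> S" "B a y" and b: "b \<in> X \<inter> S" "B b y" using ab(1) by blast+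
  have "conn (S - {y}) a b"
  proof (rule ccontr)
    assume nc: "\<not> conn (S - {y}) a b"
    define K where "K = {x \<in> X \<inter> S. conn (S - {y}) a x}"
    define L where "L = {y' \<in> Y \<inter> S - {y}. \<exists>x\<in>K. B x y'}"
    have fin: "finite K" "finite L" using fS by (auto simp: K_def L_def)
    have aK: "a \<in> K" using a by (simp add: K_def)
    have KL: "x' \<in> K" if "x \<in> K" "y' \<in> Y \<inter> S - {y}" "B x y'" "x' \<in> X \<inter> S" "B x' y'" for x x' y'
    proof -
      have "step (S - {y}) x x'" using that y notXY by (auto simp: step_def K_def)
      then show ?thesis using that(1,4) unfolding K_def by (auto intro: rtranclp.rtrancl_into_rtrancl)
    qed
    have eL: "card {x \<in> K. B x y'} = 2" if "y' \<in> L" for y'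
    proof -
      have "{x \<in> K. B x y'} = {x \<in> X \<inter> S. B x y'}" using that KL by (auto simp: L_def K_def)
      then show ?thesis using degY that by (simp add: L_def)
    qed
    have eK: "card {y' \<in> L. B x y'} = (if x = a then 1 else 2)" if x: "x \<in> K" for x
    proof -
      have xX: "x \<in> X \<inter> S" using x by (simp add: K_def)
      have LS: "{y' \<in> L. B x y'} = {y' \<in> Y \<inter> S. B x y'} - {y}" using x by (auto simp: L_def)
      have "x \<noteq> b" using x nc by (auto simp: K_def)
      then have "B x y \<longleftrightarrow> x = a" using ab(1) xX by blast
      then show ?thesis using degX[OF xX] y fS unfolding LS by (auto simp: card_Diff_singleton_if)
    qed
    \<comment> \<open>The edges between \<open>K\<close> and \<open>L\<close>, counted from both sides: an odd number from \<open>K\<close>, an even one from \<open>L\<close>.\<close>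
    have "(\<Sum>x\<in>K. card {y' \<in> L. B x y'}) = (\<Sum>y'\<in>L. card {x \<in> K. B x y'})"
    proof -
      have "(\<Sum>x\<in>K. card {y' \<in> L. B x y'}) = (\<Sum>x\<in>K. \<Sum>y'\<in>L. if B x y' then 1 else 0)"
        using fin by (simp flip: sum.inter_filter)
      also have "\<dots> = (\<Sum>y'\<in>L. \<Sum>x\<in>K. if B x y' then 1 else 0)" by (rule sum.swap)
      also have "\<dots> = (\<Sum>y'\<in>L. card {x \<in> K. B x y'})"
        using fin by (simp flip: sum.inter_filter)
      finally show ?thesis .
    qed
    moreover have "(\<Sum>x\<in>K. card {y' \<in> L. B x y'}) = 1 + 2 * card (K - {a})"
      using eK aK fin by (subst sum.remove[OF fin(1) aK]) (auto intro!: sum.cong)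
    ultimately have "1 + 2 * card (K - {a}) = 2 * card L" using eL by simp
    then show False by presburger
  qed
  then have c: "conn (linkset S y) a b"
    using lc S(1) y a b unfolding links_connected_def by blast
  have "z = a" if "conn (linkset S y) a z" for z
    using that
  proof induction
    case (step z z')
    then have st: "step (linkset S y) a z'" by simp
    show ?case
    proof (rule ccontr)
      assume "z' \<noteq> a"
      then have "z' = b" using st ab(1) by (auto simp: step_def linkset_def)
      then obtain y' where y': "y' \<in> Y \<inter> S" "y' \<noteq> y" "B a y'" "B b y'" using st by (auto simp: step_def linkset_def)
      let ?U = "{a, b, y, y'}"
      have n: "{w \<in> Y \<inter> S. B a w} = {y, y'}" "{w \<in> Y \<inter> S. B b w} = {y, y'}" "{w \<in> X \<inter> S. B w y'} = {a, b}"
        using card2_cases[OF degX[OF a(1)], of y y'] card2_cases[OF degX[OF b(1)], of y y'] card2_cases[OF degY[OF y'(1)], of a b]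
          a b y y' ab(2) by auto
      have "?U = S"
      proof (rule two_regular_componentD(2)[OF S(3)])
        show "?U \<subseteq> S" using a b y y' by auto
        fix u w assume u: "u \<in> ?U" and w: "w \<in> S" "(u, w) \<in> bcomp"
        have "w \<in> {w \<in> S. (u, w) \<in> bcomp}" using w by blast
        then show "w \<in> ?U" using u n ab(1) nX[of a] nX[of b] nY[of y] nY[of y'] a(1) b(1) y y'(1) by auto
      qed simp
      moreover have "card ?U \<le> 4" by (simp add: card_insert_if)
      ultimately show False using S(2) by simp
    qed
  qed simp
  then show False using c ab(2) by blast
qed

text \<open>
  Among all violations of \<open>links_connected\<close> at \<open>y\<close> choose one with a shortest path from \<open>x\<close> to \<open>x'\<close> avoiding
  \<open>y\<close>. Shortness makes the path induced in the bipartite complement, and its inner vertices in \<open>X\<close> are not adjacent to \<open>y\<close>,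
  since such a vertex would split the path into two shorter ones, one of which is again a violation. So the path
  closes up with \<open>y\<close> to an induced cycle. With \<open>k\<close> steps it has length \<open>2k + 2\<close>, and \<open>k = 1\<close> is impossible because a common
  neighbour of \<open>x\<close> and \<open>x'\<close> connects them in the link.
\<close>

lemma not_links_connected_cycle:
  assumes nlc: "\<not> links_connected"
  obtains S where "S \<subseteq> X \<union> Y" "card S \<ge> 6" "two_regular_component bcomp S"
proof -
  obtain W y where W: "W \<subseteq> X \<union> Y" "y \<in> Y \<inter> W" and "\<exists>x x'. x \<in> X \<inter> W \<and> x' \<in> X \<inter> W \<and> B x y \<and> B x' y \<and>
     conn (W - {y}) x x' \<and> \<not> conn (linkset W y) x x'"
    using nlc unfolding links_connected_def by blast
  then have ex: "\<exists>k x x'. x \<in> X \<inter> W \<and> x' \<in> X \<inter> W \<and> B x y \<and> B x' y \<and> (step (W - {y}) ^^ k) x x' \<and> \<not> conn (linkset W y) x x'"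
    by (metis rtranclp_imp_relpowp)
  let ?P = "\<lambda>k x x'. x \<in> X \<inter> W \<and> x' \<in> X \<inter> W \<and> B x y \<and> B x' y \<and> (step (W - {y}) ^^ k) x x' \<and> \<not> conn (linkset W y) x x'"
  define k where "k = (LEAST k. \<exists>x x'. ?P k x x')"
  obtain x x' where P: "?P k x x'" using LeastI_ex[OF ex] unfolding k_def by blast
  have least: "\<And>l a b. ?P l a b \<Longrightarrow> k \<le> l" unfolding k_def by (blast intro: Least_le)
  obtain p where p: "p 0 = x" "p k = x'" "\<And>i. i < k \<Longrightarrow> step (W - {y}) (p i) (p (Suc i))"
    using P by (auto simp: relpowp_fun_conv)
  have seg: "(step (W - {y}) ^^ (j - i)) (p i) (p j)" if "i \<le> j" "j \<le> k" for i j
    unfolding relpowp_fun_conv using that p(3) by (intro exI[of _ "\<lambda>t. p (i + t)"]) auto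
  have "\<forall>i. \<exists>w. i < k \<longrightarrow> w \<in> Y \<inter> W - {y} \<and> B (p i) w \<and> B (p (Suc i)) w"
    using p(3) by (auto simp: step_def)
  then obtain z0 where z0: "\<And>i. i < k \<Longrightarrow> z0 i \<in> Y \<inter> W - {y} \<and> B (p i) (z0 i) \<and> B (p (Suc i)) (z0 i)"
    by metis
  have k0: "k \<noteq> 0" using P by (cases "k = 0") auto
  have pX: "p i \<in> X \<inter> W" if "i \<le> k" for i
    using that p(3)[of i] p(2) P by (cases "i = k") (auto simp: step_def)
  have short: "k \<le> i + l + (k - j)" if "i \<le> k" "j \<le> k" "(step (W - {y}) ^^ l) (p i) (p j)" for i j l
  proof -
    have "(step (W - {y}) ^^ (i + l + (k - j))) x x'"
      using relpowp_trans[OF relpowp_trans[OF seg[of 0 i] that(3)] seg[of j k]] that(1,2) p by simp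
    then have "?P (i + l + (k - j)) x x'" using P by simp
    then show ?thesis by (rule least)
  qed
  have pinj: "inj_on p {..<Suc k}"
  proof -
    have "False" if "i < j" "j \<le> k" "p i = p j" for i j using short[of i j 0] that by simp
    then show ?thesis unfolding inj_on_def by (metis linorder_neqE_nat lessThan_Suc_atMost atMost_iff)
  qed
  have mid: "\<not> B (p i) y" if i: "0 < i" "i < k" for i
  proof
    assume B: "B (p i) y"
    have "conn (linkset W y) x (p i)"
    proof (rule ccontr)
      assume "\<not> ?thesis"
      then have "?P i x (p i)" using P B pX[of i] seg[of 0 i] p i by auto
      then have "k \<le> i" by (rule least)
      then show False using i by simp
    qed
    moreover have "conn (linkset W y) (p i) x'"
    proof (rule ccontr)
      assume "\<not> ?thesis"
      then have "?P (k - i) (p i) x'" using P B pX[of i] seg[of i k] p i by auto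
      then have "k \<le> k - i" by (rule least)
      then show False using i by simp
    qed
    ultimately show False using P by (meson rtranclp_trans)
  qed
  have adj0: "i = j \<or> i = Suc j" if "i \<le> k" "j < k" "B (p i) (z0 j)" for i j
  proof -
    have st: "step (W - {y}) (p i) (p m)" "step (W - {y}) (p m) (p i)" if "m = j \<or> m = Suc j" for m
      using that z0[OF \<open>j < k\<close>] pX[of i] pX[of m] \<open>j < k\<close> \<open>i \<le> k\<close> \<open>B (p i) (z0 j)\<close> W(2) notXY
      by (auto simp: step_def)
    show ?thesis
    proof (rule ccontr)
      assume "\<not> ?thesis"
      then consider "i < j" | "i > Suc j" by linarith
      then show False
      proof cases
        case 1
        have "(step (W - {y}) ^^ 1) (p i) (p (Suc j))" unfolding relpowp_1 by (rule st(1)) simp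
        from short[OF _ _ this] show False using 1 that by simp
      next
        case 2
        have "(step (W - {y}) ^^ 1) (p j) (p i)" unfolding relpowp_1 by (rule st(2)) simp
        from short[OF _ _ this] show False using 2 that by simp
      qed
    qed
  qed
  have k2: "k \<ge> 2"
  proof (rule ccontr)
    assume "\<not> ?thesis"
    then have "k = 1" using k0 by simp
    then have "step (linkset W y) x x'" using z0[of 0] p P W(2) notXY by (auto simp: step_def linkset_def)
    then show False using P by blast
  qed
  define n where "n = Suc k"
  \<comment> \<open>The vertex \<open>y\<close> closes the cycle as the last of the vertices in \<open>Y\<close>.\<close>
  define z where "z = (\<lambda>i. if i = k then y else z0 i)"
  have zY: "z i \<in> Y \<inter> W" if "i < n" for i using z0[of i] that W(2) by (auto simp: z_def n_def)
  have adj: "B (p i) (z j) \<longleftrightarrow> i = j \<or> i = Suc j mod n" if ij: "i < n" "j < n" for i j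
  proof (cases "j = k")
    case True
    have "B (p i) y \<longleftrightarrow> i = k \<or> i = 0" using mid[of i] P p(1,2) ij by (auto simp: n_def) 
    then show ?thesis using True by (auto simp: z_def n_def)
  next
    case False
    then have "j < k" using ij by (simp add: n_def)
    then have "B (p i) (z0 j) \<longleftrightarrow> i = j \<or> i = Suc j" using adj0[of i j] z0[of j] ij by (auto simp: n_def)
    then show ?thesis using False \<open>j < k\<close> by (auto simp: z_def n_def)
  qed
  have zinj: "inj_on z {..<n}"
  proof (rule inj_onI)
    fix i j assume ij: "i \<in> {..<n}" "j \<in> {..<n}" "z i = z j"
    have nb: "{l. l < n \<and> B (p l) (z i)} = {i, Suc i mod n}" if "i < n" for i
    proof -
      have "Suc i mod n < n" by (simp add: n_def)
      then show ?thesis using adj[OF _ that] that by blast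
    qed
    from nb[of i] nb[of j] ij(1,2) have
      "{l. l < n \<and> B (p l) (z i)} = {i, Suc i mod n}" "{l. l < n \<and> B (p l) (z j)} = {j, Suc j mod n}"
      by simp_all
    then have "{i, Suc i mod n} = {j, Suc j mod n}" using ij by simp
    then have "i = j \<or> i = Suc j mod n \<and> Suc i mod n = j" using ij(3) by (simp only: doubleton_eq_iff) blast
    moreover have "\<not> (i = Suc j mod n \<and> Suc i mod n = j)"
    proof
      assume a: "i = Suc j mod n \<and> Suc i mod n = j"
      have "i < n" "j < n" "n \<ge> 3" using ij(1,2) k2 by (simp_all add: n_def)
      moreover have sm: "Suc l = n \<and> Suc l mod n = 0 \<or> Suc l mod n = Suc l" if "l < n" for l
        using that by (simp add: mod_Suc)
      have "Suc j = n \<and> i = 0 \<or> i = Suc j" using sm[OF calculation(2)] unfolding conjunct1[OF a, symmetric] .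
      moreover have "Suc i = n \<and> j = 0 \<or> j = Suc i" using sm[OF \<open>i < n\<close>] unfolding conjunct2[OF a] .
      ultimately show False by linarith
    qed
    ultimately show "i = j" by blast
  qed
  have pXY: "p ` {..<n} \<subseteq> X" and zXY: "z ` {..<n} \<subseteq> Y" using pX zY by (auto simp: n_def)
  have disj: "p ` {..<n} \<inter> z ` {..<n} = {}" using pXY zXY disj by blast
  have "two_regular_component bcomp (p ` {..<n} \<union> z ` {..<n})"
  proof (rule zigzag_two_regular[OF _ _ zinj disj])
    show "2 \<le> n" "inj_on p {..<n}" using k2 pinj by (simp_all add: n_def)
    fix i j assume ij: "i < n" "j < n"
    have m: "p i \<in> X" "p j \<in> X" "z i \<in> Y" "z j \<in> Y" using pX[of i] pX[of j] zY ij by (auto simp: n_def)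
    then show "(p i, z j) \<in> bcomp \<longleftrightarrow> i = j \<or> i = Suc j mod n" "(z j, p i) \<in> bcomp \<longleftrightarrow> i = j \<or> i = Suc j mod n"
      "(p i, p j) \<notin> bcomp" "(z i, z j) \<notin> bcomp"
      using adj[OF ij] notXY by (auto simp: bcomp_def)
  qed
  moreover have "card (p ` {..<n} \<union> z ` {..<n}) = 2 * n"
    using pinj zinj disj by (simp add: card_Un_disjoint card_image n_def)
  moreover have "p ` {..<n} \<union> z ` {..<n} \<subseteq> X \<union> Y" using pXY zXY by blast
  moreover have "2 * n \<ge> 6" using k2 by (simp add: n_def)
  ultimately show ?thesis by (intro that[of "p ` {..<n} \<union> z ` {..<n}"]) simp_all
qed

end

section \<open>Polynomials and the multidegrees of the Koszul complex\<close>

abbreviation lookup where "lookup \<equiv> Poly_Mapping.lookup"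
abbreviation keys where "keys \<equiv> Poly_Mapping.keys"
abbreviation single where "single \<equiv> Poly_Mapping.single"

lemma keys_diff_subset: "keys (a - b) \<subseteq> keys a \<union> keys (b :: 'a \<Rightarrow>\<^sub>0 'b::ab_group_add)"
  by (auto simp: in_keys_iff lookup_minus)

lemma keys_uminus: "keys (- a) = keys (a :: 'a \<Rightarrow>\<^sub>0 'b::ab_group_add)"
  by (auto simp: in_keys_iff)

lemma keys_sum_subset: "keys (sum b I) \<subseteq> (\<Union>i\<in>I. keys (b i))"
proof (induction I rule: infinite_finite_induct)
  case (insert i I)
  then show ?case using keys_add[of "b i" "sum b I"] by auto
qed auto

lemma keys_mono_add: "keys (a + b) = keys a \<union> keys (b :: 'v \<Rightarrow>\<^sub>0 nat)"
  by (auto simp: in_keys_iff lookup_add)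

lemma single_sum: "single k (sum f A) = (\<Sum>i\<in>A. single k (f i))"
  by (induction A rule: infinite_finite_induct) (auto simp: single_add)

lemma lookup_single_mult:
  fixes m k :: "'v \<Rightarrow>\<^sub>0 nat" and p :: "('v, 'k::field) mpol"
  shows "lookup (single k c * p) m = (if \<forall>v. lookup k v \<le> lookup m v then c * lookup p (m - k) else 0)"
proof -
  have ex: "(\<forall>v. lookup k v \<le> lookup m v) \<longleftrightarrow> m = k + (m - k)"
    by (auto simp: poly_mapping_eq_iff fun_eq_iff lookup_add lookup_minus) (metis le_add1)
  have "lookup (single k c * p) m = (\<Sum>l. (c when k = l) * (\<Sum>q. lookup p q when m = l + q))"
    by (simp add: lookup_mult lookup_single)
  also have "\<dots> = (\<Sum>l. c * (\<Sum>q. lookup p q when m = l + q) when k = l)"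
    by (simp add: when_mult)
  also have "\<dots> = c * (\<Sum>q. lookup p q when m = k + q)" by simp
  also have "(\<Sum>q. lookup p q when m = k + q) = (if \<forall>v. lookup k v \<le> lookup m v then lookup p (m - k) else 0)"
  proof (cases "m = k + (m - k)")
    case True
    then have "\<And>q. m = k + q \<longleftrightarrow> q = m - k" by (metis add_diff_cancel_left')
    then show ?thesis using True ex by simp
  next
    case False
    then have "\<And>q. m \<noteq> k + q" by (metis add_diff_cancel_left')
    moreover have "\<not> (\<forall>v. lookup k v \<le> lookup m v)" using False ex by blast
    ultimately show ?thesis by (simp only: if_False when_simps Sum_any.neutral)
  qed
  finally show ?thesis by simp
qed

lemma lookup_const_mult: "lookup (single 0 c * p) m = c * lookup (p :: ('v, 'k::field) mpol) m"
  by (simp add: lookup_single_mult)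

lemma lookup_mult_0: "lookup (p * q) 0 = lookup p 0 * lookup (q :: ('v, 'k::field) mpol) 0"
proof -
  have z: "a + b = 0 \<longleftrightarrow> a = 0 \<and> b = 0" for a b :: "'v \<Rightarrow>\<^sub>0 nat"
    by (auto simp: poly_mapping_eq_iff fun_eq_iff lookup_add)
  have "lookup (p * q) 0 = (\<Sum>l. lookup p l * (\<Sum>r. lookup q r when l = 0 \<and> r = 0))"
    unfolding lookup_mult by (simp add: z eq_commute[of 0])
  also have "\<dots> = (\<Sum>l. lookup p l * lookup q 0 when l = 0)"
    by (intro Sum_any.cong) (auto simp: when_def)
  finally show ?thesis by simp
qed

lemma poly_ring_0 [simp]: "0 \<in> poly_ring V" by (simp add: poly_ring_def)
lemma poly_ring_add: "p \<in> poly_ring V \<Longrightarrow> q \<in> poly_ring V \<Longrightarrow> p + q \<in> poly_ring V"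
  using keys_add[of p q] by (fastforce simp: poly_ring_def)
lemma poly_ring_uminus: "p \<in> poly_ring V \<Longrightarrow> - p \<in> poly_ring V"
  by (simp add: poly_ring_def keys_uminus)
lemma poly_ring_diff: "p \<in> poly_ring V \<Longrightarrow> q \<in> poly_ring V \<Longrightarrow> p - q \<in> poly_ring V"
  using poly_ring_add[OF _ poly_ring_uminus, of p V q] by simp
lemma poly_ring_mult: "p \<in> poly_ring V \<Longrightarrow> q \<in> poly_ring V \<Longrightarrow> p * q \<in> poly_ring V"
  using keys_mult[of p q] by (fastforce simp: poly_ring_def keys_mono_add)
lemma poly_ring_sum: "(\<And>i. i \<in> A \<Longrightarrow> f i \<in> poly_ring V) \<Longrightarrow> sum f A \<in> poly_ring V"
  by (induction A rule: infinite_finite_induct) (auto intro: poly_ring_add)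
lemma poly_ring_single: "keys m \<subseteq> V \<Longrightarrow> single m c \<in> poly_ring V"
  by (simp add: poly_ring_def)
lemma poly_ring_var: "v \<in> V \<Longrightarrow> var v \<in> poly_ring V"
  unfolding var_def by (rule poly_ring_single) simp
lemma poly_ring_1: "1 \<in> poly_ring V"
  using poly_ring_single[of 0 V 1] by simp

lemma monom_deg_alt: "finite A \<Longrightarrow> keys m \<subseteq> A \<Longrightarrow> monom_deg m = (\<Sum>v\<in>A. lookup m v)"
  unfolding monom_deg_def by (rule sum.mono_neutral_left) (auto simp: in_keys_iff)

lemma monom_deg_add: "monom_deg (a + b) = monom_deg a + monom_deg b"
  using monom_deg_alt[of "keys a \<union> keys b" a] monom_deg_alt[of "keys a \<union> keys b" b]
    monom_deg_alt[of "keys a \<union> keys b" "a + b"]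
  by (simp add: keys_mono_add lookup_add sum.distrib)

lemma monom_deg_0 [simp]: "monom_deg 0 = 0" by (simp add: monom_deg_def)

lemma monom_deg_eq_0_iff: "monom_deg m = 0 \<longleftrightarrow> m = 0"
proof
  assume "monom_deg m = 0"
  then have "\<forall>v\<in>keys m. lookup m v = 0" by (simp add: monom_deg_def)
  then show "m = 0" by (intro poly_mapping_eqI) (auto simp: in_keys_iff)
qed simp

lemma monom_deg_single [simp]: "monom_deg (single v n) = n"
  by (simp add: monom_deg_def)

lemma homogeneous_0 [simp]: "homogeneous d 0" by (simp add: homogeneous_def)
lemma homogeneous_add: "homogeneous d p \<Longrightarrow> homogeneous d q \<Longrightarrow> homogeneous d (p + q)"
  using keys_add[of p q] by (fastforce simp: homogeneous_def)
lemma homogeneous_diff: "homogeneous d p \<Longrightarrow> homogeneous d q \<Longrightarrow> homogeneous d (p - q)"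
  using keys_diff_subset[of p q] by (fastforce simp: homogeneous_def)
lemma homogeneous_mult: "homogeneous d p \<Longrightarrow> homogeneous e q \<Longrightarrow> homogeneous (d + e) (p * q)"
  using keys_mult[of p q] by (fastforce simp: homogeneous_def monom_deg_add)
lemma homogeneous_sum: "(\<And>i. i \<in> A \<Longrightarrow> homogeneous d (f i)) \<Longrightarrow> homogeneous d (sum f A)"
  by (induction A rule: infinite_finite_induct) (auto intro: homogeneous_add)
lemma homogeneous_single: "homogeneous (int (monom_deg m)) (single m c)"
  by (simp add: homogeneous_def)
lemma homogeneous_var: "homogeneous 1 (var v)"
  unfolding var_def using homogeneous_single[of "single v 1" 1] by simp

definition hom_part :: "int \<Rightarrow> ('v, 'k::field) mpol \<Rightarrow> ('v, 'k) mpol" where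
  "hom_part d p = Poly_Mapping.mapp (\<lambda>m c. if int (monom_deg m) = d then c else 0) p"

lemma lookup_hom_part: "lookup (hom_part d p) m = (if int (monom_deg m) = d then lookup p m else 0)"
  by (auto simp: hom_part_def lookup_mapp when_def in_keys_iff)

lemma keys_hom_part: "keys (hom_part d p) = {m \<in> keys p. int (monom_deg m) = d}"
  by (auto simp: in_keys_iff lookup_hom_part split: if_splits)

lemma homogeneous_hom_part: "homogeneous d (hom_part d p)"
  by (auto simp: homogeneous_def keys_hom_part)

lemma hom_part_homogeneous: "homogeneous d p \<Longrightarrow> hom_part d p = p"
  by (intro poly_mapping_eqI) (auto simp: lookup_hom_part homogeneous_def in_keys_iff)

lemma poly_ring_hom_part: "p \<in> poly_ring V \<Longrightarrow> hom_part d p \<in> poly_ring V"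
  by (auto simp: poly_ring_def keys_hom_part)

lemma hom_part_0 [simp]: "hom_part d 0 = 0" by (intro poly_mapping_eqI) (simp add: lookup_hom_part)

lemma hom_part_sum: "hom_part d (sum f A) = (\<Sum>i\<in>A. hom_part d (f i))"
  by (intro poly_mapping_eqI) (simp add: lookup_hom_part lookup_sum)

lemma hom_part_mult:
  assumes "homogeneous e f"
  shows "hom_part d (f * p) = f * hom_part (d - e) p"
proof (intro poly_mapping_eqI)
  fix m
  have dec: "f * p = f * hom_part (d - e) p + f * (p - hom_part (d - e) p)" by (simp add: algebra_simps)
  have h: "homogeneous d (f * hom_part (d - e) p)"
    using homogeneous_mult[OF assms homogeneous_hom_part, of "d - e" p] by simp
  show "lookup (hom_part d (f * p)) m = lookup (f * hom_part (d - e) p) m"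
  proof (cases "int (monom_deg m) = d")
    case True
    have "m \<notin> keys (f * (p - hom_part (d - e) p))"
    proof
      assume "m \<in> keys (f * (p - hom_part (d - e) p))"
      then obtain a b where "m = a + b" "a \<in> keys f" "b \<in> keys (p - hom_part (d - e) p)"
        using keys_mult by blast
      then show False using True assms
        by (auto simp: homogeneous_def monom_deg_add in_keys_iff lookup_minus lookup_hom_part split: if_splits)
    qed
    then show ?thesis using True by (subst dec) (simp add: lookup_hom_part lookup_add in_keys_iff)
  next
    case False
    then show ?thesis using h by (auto simp: lookup_hom_part homogeneous_def in_keys_iff)
  qed
qed

lemma sum_hom_part:
  assumes "\<And>m. m \<in> keys p \<Longrightarrow> int (monom_deg m) \<in> D" "finite D"
  shows "p = (\<Sum>d\<in>D. hom_part d p)"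
proof (intro poly_mapping_eqI)
  fix m
  have "lookup (\<Sum>d\<in>D. hom_part d p) m = (\<Sum>d\<in>D. if int (monom_deg m) = d then lookup p m else 0)"
    by (simp add: lookup_sum lookup_hom_part)
  also have "\<dots> = lookup p m" using assms by (auto simp: in_keys_iff)
  finally show "lookup p m = lookup (\<Sum>d\<in>D. hom_part d p) m" ..
qed

definition ind :: "'v set \<Rightarrow> ('v \<Rightarrow>\<^sub>0 nat)" where
  "ind T = (\<Sum>v\<in>T. single v 1)"

lemma lookup_ind: "finite T \<Longrightarrow> lookup (ind T) v = (if v \<in> T then 1 else 0)"
  by (simp add: ind_def lookup_sum lookup_single when_def)

lemma keys_ind: "finite T \<Longrightarrow> keys (ind T) = T"
  by (auto simp: in_keys_iff lookup_ind split: if_splits)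

lemma monom_deg_ind: "finite T \<Longrightarrow> monom_deg (ind T) = card T"
  by (simp add: monom_deg_def keys_ind lookup_ind)

lemma ind_remove: "finite T \<Longrightarrow> v \<in> T \<Longrightarrow> ind T = single v 1 + ind (T - {v})"
  unfolding ind_def by (rule sum.remove)

lemma osgn_single: "osgn \<iota> v T = single 0 (osgn \<iota> v T :: 'k::field)"
proof -
  have "(-1) ^ n = single 0 ((-1) ^ n :: 'k)" for n
    by (induction n) (auto simp: mult_single single_uminus)
  then show ?thesis by (simp add: osgn_def)
qed

lemma osgn_Un:
  assumes "finite Z" "finite T" "Z \<inter> T = {}"
  shows "osgn \<iota> v (Z \<union> T) = osgn \<iota> v Z * (osgn \<iota> v T :: 'k::comm_ring_1)"
proof -
  have "{u \<in> Z \<union> T. \<iota> u < \<iota> v} = {u \<in> Z. \<iota> u < \<iota> v} \<union> {u \<in> T. \<iota> u < \<iota> v}" by auto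
  moreover have "card \<dots> = card {u \<in> Z. \<iota> u < \<iota> v} + card {u \<in> T. \<iota> u < \<iota> v}"
    using assms by (intro card_Un_disjoint) auto
  ultimately show ?thesis by (simp add: osgn_def power_add)
qed

text \<open>
  The Koszul complex is graded by multidegrees, which are recorded by a set \<open>Z\<close> and a monomial \<open>a\<close> without
  variables in \<open>Z\<close>: the multidegree, divided by the product of all variables, has exponent \<open>-1\<close> on \<open>Z\<close> and is
  given by \<open>a\<close> elsewhere. Its part of a cochain \<open>f\<close>
  consists of the coefficients of \<open>f (Z \<union> S)\<close> at \<open>a + ind S\<close>, for \<open>S\<close> disjoint from \<open>Z\<close>. The product of signs accounts for
  the position of \<open>Z\<close> among the vertices and turns the Koszul differential into the simplicial coboundary.
\<close>

definition slice :: "('v \<Rightarrow> nat) \<Rightarrow> 'v set \<Rightarrow> ('v \<Rightarrow>\<^sub>0 nat) \<Rightarrow> ('v set \<Rightarrow> ('v, 'k::field) mpol) \<Rightarrow> 'v set \<Rightarrow> 'k" where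
  "slice \<iota> Z a f S = (\<Prod>u\<in>S. osgn \<iota> u Z) * lookup (f (Z \<union> S)) (a + ind S)"

definition unslice :: "('v \<Rightarrow> nat) \<Rightarrow> 'v set \<Rightarrow> ('v \<Rightarrow>\<^sub>0 nat) \<Rightarrow> ('v set \<Rightarrow> 'k::field) \<Rightarrow> 'v set \<Rightarrow> ('v, 'k) mpol" where
  "unslice \<iota> Z a \<phi> T = (if Z \<subseteq> T then single (a + ind (T - Z)) ((\<Prod>u\<in>T - Z. osgn \<iota> u Z) * \<phi> (T - Z)) else 0)"

lemma prod_osgn_sq: "(\<Prod>u\<in>S. osgn \<iota> u Z) * (\<Prod>u\<in>S. osgn \<iota> u Z) = (1::'k::comm_ring_1)"
  by (simp flip: prod.distrib)

lemma prod_osgn_sq': "(\<Prod>u\<in>S. osgn \<iota> u Z) * ((\<Prod>u\<in>S. osgn \<iota> u Z) * x) = (x::'k::comm_ring_1)"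
  by (simp flip: mult.assoc add: prod_osgn_sq)

lemma slice_unslice: "Z \<inter> S = {} \<Longrightarrow> slice \<iota> Z a (unslice \<iota> Z a \<phi>) S = \<phi> S"
proof -
  assume "Z \<inter> S = {}"
  then have "Z \<union> S - Z = S" by auto
  then show ?thesis by (simp add: slice_def unslice_def prod_osgn_sq')
qed

lemma cobd_unslice:
  assumes fin: "finite T"
  shows "cobd \<iota> var (unslice \<iota> Z a \<phi>) T = unslice \<iota> Z a (scobd \<iota> \<phi>) T"
proof (cases "Z \<subseteq> T")
  case False
  then show ?thesis by (auto simp: cobd_def unslice_def intro!: sum.neutral)
next
  case True
  let ?S = "T - Z"
  let ?c = "\<lambda>v. (\<Prod>u\<in>?S. osgn \<iota> u Z) * (osgn \<iota> v ?S * \<phi> (?S - {v}))"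
  have fS: "finite ?S" "finite Z" using fin True finite_subset by auto
  have "cobd \<iota> var (unslice \<iota> Z a \<phi>) T = (\<Sum>v\<in>?S. osgn \<iota> v T * var v * unslice \<iota> Z a \<phi> (T - {v}))"
    unfolding cobd_def using fin by (intro sum.mono_neutral_right) (auto simp: unslice_def)
  also have "\<dots> = (\<Sum>v\<in>?S. single (a + ind ?S) (?c v))"
  proof (rule sum.cong[OF refl])
    fix v assume v: "v \<in> ?S"
    have e: "T - {v} - Z = ?S - {v}" "Z \<subseteq> T - {v}" using v True by auto
    have "osgn \<iota> v T = osgn \<iota> v Z * (osgn \<iota> v ?S :: 'b)"
      using osgn_Un[OF fS(2,1), of \<iota> v] True by (simp add: Un_absorb1)
    moreover have "(\<Prod>u\<in>?S. osgn \<iota> u Z) = osgn \<iota> v Z * (\<Prod>u\<in>?S - {v}. osgn \<iota> u Z :: 'b)"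
      using v fS by (intro prod.remove)
    moreover have "single v 1 + (a + ind (?S - {v})) = a + ind ?S"
      using ind_remove[OF fS(1) v] by (simp add: add_ac)
    ultimately show "osgn \<iota> v T * var v * unslice \<iota> Z a \<phi> (T - {v}) = single (a + ind ?S) (?c v)"
      using e by (simp add: unslice_def osgn_single[of \<iota> v T] var_def mult_single mult_ac)
  qed
  also have "\<dots> = unslice \<iota> Z a (scobd \<iota> \<phi>) T"
    using True by (simp add: unslice_def cobd_def sum_distrib_left single_sum)
  finally show ?thesis .
qed

lemma lookup_var_mult:
  fixes p :: "('v, 'k::field) mpol"
  shows "lookup (var v * p) m = (if lookup m v = 0 then 0 else lookup p (m - single v 1))"
proof -
  have "(\<forall>w. lookup (single v (1::nat)) w \<le> lookup m w) \<longleftrightarrow> lookup m v \<noteq> 0"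
    by (auto simp: lookup_single when_def)
  then show ?thesis unfolding var_def lookup_single_mult by simp
qed

text \<open>
  The variables in \<open>Z\<close> do not contribute, since the monomial \<open>a + ind S\<close> is not divisible by them.
\<close>

lemma scobd_slice:
  assumes fin: "finite Z" "finite S" and disj: "Z \<inter> S = {}" "keys a \<inter> Z = {}"
  shows "scobd \<iota> (slice \<iota> Z a f) S = slice \<iota> Z a (cobd \<iota> var f) S"
proof -
  let ?m = "a + ind S"
  have "lookup (cobd \<iota> var f (Z \<union> S)) ?m =
      (\<Sum>v\<in>Z \<union> S. osgn \<iota> v (Z \<union> S) * lookup (var v * f (Z \<union> S - {v})) ?m)"
    by (simp add: cobd_def lookup_sum mult.assoc lookup_const_mult osgn_single[of \<iota> _ "Z \<union> S"])
  also have "\<dots> = (\<Sum>v\<in>S. osgn \<iota> v (Z \<union> S) * lookup (var v * f (Z \<union> S - {v})) ?m)"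
    using fin disj by (intro sum.mono_neutral_right)
      (auto simp: lookup_var_mult lookup_add lookup_ind in_keys_iff)
  also have "\<dots> = (\<Sum>v\<in>S. osgn \<iota> v Z * osgn \<iota> v S * lookup (f (Z \<union> (S - {v}))) (a + ind (S - {v})))"
  proof (rule sum.cong[OF refl])
    fix v assume v: "v \<in> S"
    have "Z \<union> S - {v} = Z \<union> (S - {v})" using v disj by auto
    moreover have "?m - single v 1 = a + ind (S - {v})"
      using ind_remove[OF fin(2) v] by (metis add.left_commute add_diff_cancel_left')
    moreover have "lookup ?m v \<noteq> 0" using v fin by (simp add: lookup_add lookup_ind)
    ultimately show "osgn \<iota> v (Z \<union> S) * lookup (var v * f (Z \<union> S - {v})) ?m =
        osgn \<iota> v Z * osgn \<iota> v S * lookup (f (Z \<union> (S - {v}))) (a + ind (S - {v}))"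
      by (simp add: lookup_var_mult osgn_Un[OF fin disj(1)])
  qed
  finally have *: "slice \<iota> Z a (cobd \<iota> var f) S = (\<Sum>v\<in>S. (\<Prod>u\<in>S. osgn \<iota> u Z) *
      (osgn \<iota> v Z * osgn \<iota> v S * lookup (f (Z \<union> (S - {v}))) (a + ind (S - {v}))))"
    by (simp add: slice_def sum_distrib_left)
  also have "\<dots> = (\<Sum>v\<in>S. osgn \<iota> v S * slice \<iota> Z a f (S - {v}))"
  proof (rule sum.cong[OF refl])
    fix v assume v: "v \<in> S"
    have "(\<Prod>u\<in>S. osgn \<iota> u Z) = osgn \<iota> v Z * (\<Prod>u\<in>S - {v}. osgn \<iota> u Z :: 'b)"
      using v fin by (intro prod.remove)
    then show "(\<Prod>u\<in>S. osgn \<iota> u Z) * (osgn \<iota> v Z * osgn \<iota> v S * lookup (f (Z \<union> (S - {v}))) (a + ind (S - {v})))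
       = osgn \<iota> v S * slice \<iota> Z a f (S - {v})"
      by (simp add: slice_def mult_ac)
  qed
  also have "\<dots> = scobd \<iota> (slice \<iota> Z a f) S" by (simp add: cobd_def)
  finally show ?thesis ..
qed

text \<open>
  The finitely many multidegrees that occur in the values of \<open>f\<close> on \<open>F\<close>: a monomial \<open>m\<close> of \<open>f T\<close> has as \<open>Z\<close>
  the part of \<open>T\<close> on which \<open>m\<close> vanishes.
\<close>

definition slices :: "'v set set \<Rightarrow> ('v set \<Rightarrow> ('v, 'k::field) mpol) \<Rightarrow> ('v set \<times> ('v \<Rightarrow>\<^sub>0 nat)) set" where
  "slices F f = (\<lambda>(T, m). ({v \<in> T. lookup m v = 0}, m - ind {v \<in> T. lookup m v \<noteq> 0})) ` (SIGMA T:F. keys (f T))"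

lemma finite_slices: "finite F \<Longrightarrow> finite (slices F f)"
  by (simp add: slices_def)

lemma sliceE:
  assumes "(Z, a) \<in> slices F f" "\<And>T. T \<in> F \<Longrightarrow> finite T"
  obtains T where "T \<in> F" "Z \<subseteq> T" "a + ind (T - Z) \<in> keys (f T)" "keys a \<inter> Z = {}"
proof -
  obtain T m where T: "T \<in> F" "m \<in> keys (f T)" "Z = {v \<in> T. lookup m v = 0}" "a = m - ind {v \<in> T. lookup m v \<noteq> 0}"
    using assms(1) by (auto simp: slices_def)
  have TZ: "{v \<in> T. lookup m v \<noteq> 0} = T - Z" using T by auto
  have f: "finite (T - Z)" "finite T" using assms(2)[OF T(1)] by auto
  have "lookup (m - ind (T - Z) + ind (T - Z)) v = lookup m v" for v
    using f T(3) by (auto simp: lookup_add lookup_minus lookup_ind)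
  then have "a + ind (T - Z) = m" unfolding T(4) TZ by (intro poly_mapping_eqI)
  moreover have "keys a \<inter> Z = {}" using T f by (auto simp: in_keys_iff lookup_minus lookup_ind)
  ultimately show ?thesis using that[of T] T by auto
qed

lemma slices_decomp:
  assumes F: "finite F" "\<And>T. T \<in> F \<Longrightarrow> finite T" and T: "T \<in> F"
  shows "f T = (\<Sum>(Z,a)\<in>slices F f. unslice \<iota> Z a (slice \<iota> Z a f) T)"
proof (intro poly_mapping_eqI)
  fix m
  let ?Z = "{v \<in> T. lookup m v = 0}" and ?a = "m - ind {v \<in> T. lookup m v \<noteq> 0}"
  have fT: "finite T" using F T by blast
  have TZ: "T - ?Z = {v \<in> T. lookup m v \<noteq> 0}" by auto
  have ma: "?a + ind (T - ?Z) = m"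
    unfolding TZ using fT by (intro poly_mapping_eqI) (auto simp: lookup_add lookup_minus lookup_ind)
  have t: "lookup (unslice \<iota> Z a (slice \<iota> Z a f) T) m = (if (Z,a) = (?Z,?a) then lookup (f T) m else 0)"
    if "(Z,a) \<in> slices F f" for Z a
  proof (cases "Z \<subseteq> T \<and> a + ind (T - Z) = m")
    case True
    have dis: "keys a \<inter> Z = {}" using sliceE[OF that F(2)] by metis
    have "Z = ?Z"
      using True dis fT by (auto simp: lookup_add lookup_ind in_keys_iff)
    moreover have "a = ?a" using True \<open>Z = ?Z\<close> TZ by (metis add_diff_cancel_right')
    moreover have "Z \<union> (T - Z) = T" using True by auto
    ultimately show ?thesis using True by (simp add: unslice_def slice_def prod_osgn_sq')
  next
    case False
    then have "(Z,a) \<noteq> (?Z,?a)" using ma by auto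
    then show ?thesis using False by (auto simp: unslice_def lookup_single)
  qed
  have "lookup (\<Sum>(Z,a)\<in>slices F f. unslice \<iota> Z a (slice \<iota> Z a f) T) m =
     (\<Sum>p\<in>slices F f. if p = (?Z,?a) then lookup (f T) m else 0)"
    unfolding lookup_sum
  proof (rule sum.cong[OF refl])
    fix p assume "p \<in> slices F f"
    then show "lookup (case p of (Z, a) \<Rightarrow> unslice \<iota> Z a (slice \<iota> Z a f) T) m = (if p = (?Z,?a) then lookup (f T) m else 0)"
      using t[of "fst p" "snd p"] by (cases p) simp
  qed
  also have "\<dots> = lookup (f T) m"
  proof (cases "lookup (f T) m = 0")
    case False
    then have "(?Z,?a) \<in> slices F f" using T unfolding slices_def in_keys_iff[symmetric] by force
    then show ?thesis using finite_slices[OF F(1), of f] by simp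
  qed (simp add: sum.neutral)
  finally show "lookup (f T) m = lookup (\<Sum>(Z,a)\<in>slices F f. unslice \<iota> Z a (slice \<iota> Z a f) T) m" ..
qed

text \<open>
  Exactness of the cochain complex of the full simplex on \<open>W\<close> relative to \<open>\<Gamma>\<close>, on faces of cardinality \<open>n\<close>.
\<close>

definition rel_exact :: "'k::field itself \<Rightarrow> ('v \<Rightarrow> nat) \<Rightarrow> nat \<Rightarrow> 'v set \<Rightarrow> 'v set set \<Rightarrow> bool" where
  "rel_exact _ \<iota> n W \<Gamma> \<longleftrightarrow> (\<forall>g :: 'v set \<Rightarrow> 'k.
     (\<forall>T\<in>\<Gamma>. card T = n \<longrightarrow> g T = 0) \<longrightarrow> (\<forall>T. T \<subseteq> W \<longrightarrow> card T = Suc n \<longrightarrow> scobd \<iota> g T = 0) \<longrightarrow>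
     (\<exists>h. (\<forall>T\<in>\<Gamma>. Suc (card T) = n \<longrightarrow> h T = 0) \<and> (\<forall>T. T \<subseteq> W \<longrightarrow> card T = n \<longrightarrow> g T = scobd \<iota> h T)))"

lemma rel_exactD:
  fixes g :: "'v set \<Rightarrow> 'k::field"
  assumes "rel_exact TYPE('k) \<iota> n W \<Gamma>" "\<forall>T\<in>\<Gamma>. card T = n \<longrightarrow> g T = 0"
    "\<forall>T. T \<subseteq> W \<longrightarrow> card T = Suc n \<longrightarrow> scobd \<iota> g T = 0"
  obtains h where "\<And>T. T \<in> \<Gamma> \<Longrightarrow> Suc (card T) = n \<Longrightarrow> h T = 0"
    "\<And>T. T \<subseteq> W \<Longrightarrow> card T = n \<Longrightarrow> g T = scobd \<iota> h T"
proof -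
  from assms(1)[unfolded rel_exact_def, THEN spec[of _ g], THEN mp, OF assms(2), THEN mp, OF assms(3)]
  obtain h where h: "\<forall>T\<in>\<Gamma>. Suc (card T) = n \<longrightarrow> h T = 0" "\<forall>T. T \<subseteq> W \<longrightarrow> card T = n \<longrightarrow> g T = scobd \<iota> h T"
    by (elim exE conjE)
  show ?thesis by (rule that[of h]) (use h in simp_all)
qed

text \<open>
  The long exact sequence of the pair: the simplex is acyclic, so relative cohomology is the cohomology
  of \<open>\<Gamma>\<close> one degree lower.
\<close>

lemma rel_exactI:
  assumes W: "finite W" "inj_on \<iota> W" "W \<noteq> {} \<or> n \<ge> 1" and \<Gamma>: "simplicial \<iota> \<Gamma>" "\<Gamma> \<subseteq> Pow W"
    and acy: "n \<ge> 1 \<Longrightarrow> acyclic_at TYPE('k::field) \<iota> (n - 1) \<Gamma>"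
  shows "rel_exact TYPE('k) \<iota> n W \<Gamma>"
  unfolding rel_exact_def
proof (intro allI impI)
  fix g :: "'a set \<Rightarrow> 'k"
  assume g0: "\<forall>T\<in>\<Gamma>. card T = n \<longrightarrow> g T = 0" and g: "\<forall>T. T \<subseteq> W \<longrightarrow> card T = Suc n \<longrightarrow> scobd \<iota> g T = 0"
  obtain h where h: "\<And>T. T \<in> Pow W \<Longrightarrow> card T = n \<Longrightarrow> g T = scobd \<iota> h T"
    by (rule acyclic_atD[OF acyclic_Pow[OF W], of g]) (use g in auto)
  show "\<exists>h. (\<forall>T\<in>\<Gamma>. Suc (card T) = n \<longrightarrow> h T = 0) \<and> (\<forall>T. T \<subseteq> W \<longrightarrow> card T = n \<longrightarrow> g T = scobd \<iota> h T)"
  proof (cases n)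
    case 0
    then show ?thesis using h by (intro exI[of _ h]) auto
  next
    case (Suc k)
    have "acyclic_at TYPE('k) \<iota> k \<Gamma>" using acy Suc by simp
    then obtain e where e: "\<And>T. T \<in> \<Gamma> \<Longrightarrow> card T = k \<Longrightarrow> h T = scobd \<iota> e T"
      by (rule acyclic_atD[of _ _ _ h]) (use h g0 \<Gamma>(2) Suc in \<open>metis subsetD\<close>, blast)
    have "g T = scobd \<iota> (\<lambda>S. h S - scobd \<iota> e S) T" if "T \<subseteq> W" "card T = n" for T
      using h[of T] that W by (simp add: cobd_diff cobd_cobd finite_subset inj_on_subset)
    then show ?thesis using e Suc by (intro exI[of _ "\<lambda>S. h S - scobd \<iota> e S"]) auto
  qed
qed

text \<open>
  A property \<open>Q\<close> of monomials that defines a monomial ideal (or the whole ring) splits the Koszul complex of that ideal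
  into the relative complexes of its multidegrees: the coefficient at \<open>a + ind S\<close> must vanish unless \<open>Q\<close> holds.
  Only the multidegrees that occur in \<open>f\<close> have to be exact.
\<close>

lemma koszul_exact:
  fixes f :: "'v set \<Rightarrow> ('v, 'k::field) mpol"
  assumes V: "finite V"
    and f: "\<And>T. T \<subseteq> V \<Longrightarrow> card T = q \<Longrightarrow> f T \<in> poly_ring V"
    and fQ: "\<And>T m. T \<subseteq> V \<Longrightarrow> card T = q \<Longrightarrow> m \<in> keys (f T) \<Longrightarrow> Q m"
    and co: "\<And>T. T \<subseteq> V \<Longrightarrow> card T = Suc q \<Longrightarrow> cobd \<iota> var f T = 0"
    and ex: "\<And>Z a T. T \<subseteq> V \<Longrightarrow> card T = q \<Longrightarrow> Z \<subseteq> T \<Longrightarrow> a + ind (T - Z) \<in> keys (f T) \<Longrightarrow> keys a \<subseteq> V - Z \<Longrightarrow>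
        rel_exact TYPE('k) \<iota> (q - card Z) (V - Z) {S. S \<subseteq> V - Z \<and> \<not> Q (a + ind S)}"
  obtains w where "\<And>T. T \<subseteq> V \<Longrightarrow> Suc (card T) = q \<Longrightarrow> w T \<in> poly_ring V"
    "\<And>T m. T \<subseteq> V \<Longrightarrow> Suc (card T) = q \<Longrightarrow> m \<in> keys (w T) \<Longrightarrow> Q m"
    "\<And>T. T \<subseteq> V \<Longrightarrow> card T = q \<Longrightarrow> f T = cobd \<iota> var w T"
proof -
  define F where "F = {T. T \<subseteq> V \<and> card T = q}"
  have F: "finite F" "\<And>T. T \<in> F \<Longrightarrow> finite T" using V by (auto simp: F_def intro: finite_subset)
  let ?A = "slices F f"
  let ?P = "\<lambda>Z a h. \<forall>S. S \<subseteq> V - Z \<longrightarrow> (Suc (card S) = q - card Z \<and> \<not> Q (a + ind S) \<longrightarrow> h S = 0) \<and>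
         (card S = q - card Z \<longrightarrow> slice \<iota> Z a f S = scobd \<iota> h S)"
  have ex_h: "\<exists>h. ?P Z a h"
    and A: "Z \<subseteq> V" "keys a \<subseteq> V - Z" "card Z \<le> q" if Za: "(Z,a) \<in> ?A" for Z a
  proof -
    obtain T where T: "T \<in> F" "Z \<subseteq> T" "a + ind (T - Z) \<in> keys (f T)" "keys a \<inter> Z = {}"
      by (rule sliceE[OF Za F(2)])
    have TV: "T \<subseteq> V" "card T = q" "finite T" using T(1) F(2)[OF T(1)] by (auto simp: F_def)
    show "Z \<subseteq> V" using T TV by auto
    have fZ: "finite Z" using T TV finite_subset by blast
    show cZ: "card Z \<le> q" using T TV card_mono by blast
    have "keys (a + ind (T - Z)) \<subseteq> V" using f[OF TV(1,2)] T(3) by (auto simp: poly_ring_def)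
    then show ka: "keys a \<subseteq> V - Z" using T(4) by (auto simp: keys_mono_add)
    have card: "card (Z \<union> S) = card Z + card S" if "S \<subseteq> V - Z" for S
      using that fZ V by (intro card_Un_disjoint) (auto intro: finite_subset)
    have re: "rel_exact TYPE('k) \<iota> (q - card Z) (V - Z) {S. S \<subseteq> V - Z \<and> \<not> Q (a + ind S)}"
      by (rule ex[OF TV(1,2) T(2,3) ka])
    have 1: "\<forall>S\<in>{S. S \<subseteq> V - Z \<and> \<not> Q (a + ind S)}. card S = q - card Z \<longrightarrow> slice \<iota> Z a f S = 0"
    proof (intro ballI impI)
      fix S assume S: "S \<in> {S. S \<subseteq> V - Z \<and> \<not> Q (a + ind S)}" "card S = q - card Z"
      then have "Z \<union> S \<subseteq> V" "card (Z \<union> S) = q" using \<open>Z \<subseteq> V\<close> cZ card by auto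
      then have "a + ind S \<notin> keys (f (Z \<union> S))" using fQ[of "Z \<union> S" "a + ind S"] S(1) by blast
      then show "slice \<iota> Z a f S = 0" by (simp add: slice_def in_keys_iff)
    qed
    have 2: "\<forall>S. S \<subseteq> V - Z \<longrightarrow> card S = Suc (q - card Z) \<longrightarrow> scobd \<iota> (slice \<iota> Z a f) S = 0"
    proof (intro allI impI)
      fix S assume S: "S \<subseteq> V - Z" "card S = Suc (q - card Z)"
      then have "Z \<union> S \<subseteq> V" "card (Z \<union> S) = Suc q" using \<open>Z \<subseteq> V\<close> cZ card by auto
      then have "cobd \<iota> var f (Z \<union> S) = 0" using co by blast
      moreover have "finite S" "Z \<inter> S = {}" using S V by (auto intro: finite_subset)
      ultimately show "scobd \<iota> (slice \<iota> Z a f) S = 0"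
        using scobd_slice[OF fZ, of S a \<iota> f] T(4) by (simp add: slice_def)
    qed
    show "\<exists>h. ?P Z a h"
    proof (rule rel_exactD[OF re 1 2])
      fix h assume h: "\<And>S. S \<in> {S. S \<subseteq> V - Z \<and> \<not> Q (a + ind S)} \<Longrightarrow> Suc (card S) = q - card Z \<Longrightarrow> h S = 0"
        "\<And>S. S \<subseteq> V - Z \<Longrightarrow> card S = q - card Z \<Longrightarrow> slice \<iota> Z a f S = scobd \<iota> h S"
      show ?thesis by (rule exI[of _ h]) (use h in blast)
    qed
  qed
  define h where "h = (\<lambda>Z a. SOME h. ?P Z a h)"
  have hP: "?P Z a (h Z a)" if "(Z,a) \<in> ?A" for Z a
    unfolding h_def using ex_h[OF that] by (rule someI_ex)
  have h: "\<And>Z a S. (Z,a) \<in> ?A \<Longrightarrow> S \<subseteq> V - Z \<Longrightarrow> Suc (card S) = q - card Z \<Longrightarrow> \<not> Q (a + ind S) \<Longrightarrow> h Z a S = 0"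
    "\<And>Z a S. (Z,a) \<in> ?A \<Longrightarrow> S \<subseteq> V - Z \<Longrightarrow> card S = q - card Z \<Longrightarrow> slice \<iota> Z a f S = scobd \<iota> (h Z a) S"
    using hP by blast+
  define w where "w = (\<lambda>T. \<Sum>(Z,a)\<in>?A. unslice \<iota> Z a (h Z a) T)"
  have kw: "Q m \<and> keys m \<subseteq> V" if T: "T \<subseteq> V" "Suc (card T) = q" and m: "m \<in> keys (w T)" for T m
  proof -
    obtain Z a where Za: "(Z,a) \<in> ?A" "m \<in> keys (unslice \<iota> Z a (h Z a) T)"
      using m keys_sum_subset[of "\<lambda>(Z,a). unslice \<iota> Z a (h Z a) T" ?A] unfolding w_def by fastforce
    then have m: "Z \<subseteq> T" "m = a + ind (T - Z)" "h Z a (T - Z) \<noteq> 0"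
      by (auto simp: unslice_def split: if_splits)
    have fT: "finite T" using T V finite_subset by blast
    then have "card (T - Z) = card T - card Z" "card Z \<le> card T"
      using m(1) by (auto simp: card_Diff_subset finite_subset card_mono)
    then have "Suc (card (T - Z)) = q - card Z" using T by simp
    then have "Q m" using h(1)[OF Za(1), of "T - Z"] T m by blast
    moreover have "keys m \<subseteq> V" using A(2)[OF Za(1)] T fT m by (auto simp: keys_mono_add keys_ind)
    ultimately show ?thesis by blast
  qed
  have "f T = cobd \<iota> var w T" if T: "T \<subseteq> V" "card T = q" for T
  proof -
    have fT: "finite T" and TF: "T \<in> F" using T V by (auto simp: F_def intro: finite_subset)
    have "unslice \<iota> Z a (slice \<iota> Z a f) T = cobd \<iota> var (unslice \<iota> Z a (h Z a)) T" if Za: "(Z,a) \<in> ?A" for Z a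
    proof -
      have "Z \<subseteq> T \<Longrightarrow> card (T - Z) = q - card Z"
        using T fT by (simp add: card_Diff_subset finite_subset)
      then have "Z \<subseteq> T \<Longrightarrow> slice \<iota> Z a f (T - Z) = scobd \<iota> (h Z a) (T - Z)"
        using h(2)[OF Za, of "T - Z"] T by auto
      then show ?thesis unfolding cobd_unslice[OF fT] by (simp add: unslice_def)
    qed
    then have "(\<Sum>(Z,a)\<in>?A. unslice \<iota> Z a (slice \<iota> Z a f) T) = (\<Sum>(Z,a)\<in>?A. cobd \<iota> var (unslice \<iota> Z a (h Z a)) T)"
      by (intro sum.cong) auto
    with slices_decomp[OF F TF, of f \<iota>]
    have "f T = (\<Sum>(Z,a)\<in>?A. cobd \<iota> var (unslice \<iota> Z a (h Z a)) T)" by (rule trans)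
    also have "\<dots> = cobd \<iota> var w T" unfolding w_def
      using cobd_sum[of \<iota> var "\<lambda>p. unslice \<iota> (fst p) (snd p) (h (fst p) (snd p))" ?A T] by (simp add: case_prod_unfold)
    finally show ?thesis .
  qed
  then show ?thesis using that[of w] kw by (auto simp: poly_ring_def)
qed

section \<open>Koszul cohomology of syzygy modules\<close>

lemma osgn_hom: "homogeneous 0 (osgn \<iota> v T :: ('v, 'k::field) mpol)"
  using homogeneous_single[of 0] by (simp add: osgn_single)

lemma osgn_poly_ring: "osgn \<iota> v T \<in> poly_ring V"
  by (subst osgn_single) (simp add: poly_ring_single)

lemma hom_part_cobd: "hom_part d (cobd \<iota> var w T) = cobd \<iota> var (\<lambda>S. hom_part (d - 1) (w S)) T"
  unfolding cobd_def hom_part_sum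
  by (simp add: hom_part_mult[OF homogeneous_mult[OF osgn_hom homogeneous_var]])

lemma homogeneous_cobd:
  assumes "\<And>v. v \<in> T \<Longrightarrow> homogeneous d (w (T - {v}))"
  shows "homogeneous (d + 1) (cobd \<iota> var w T)"
  unfolding cobd_def
  using homogeneous_mult[OF homogeneous_mult[OF osgn_hom homogeneous_var] assms]
  by (intro homogeneous_sum) (simp add: add.commute)

lemma lookup_cobd_0:
  fixes w :: "'v set \<Rightarrow> ('v, 'k::field) mpol"
  shows "lookup (cobd \<iota> var w T) 0 = 0"
proof -
  have "lookup (var v) 0 = (0::'k)" for v :: 'v
    by (auto simp: var_def lookup_single when_def poly_mapping_eq_iff fun_eq_iff)
  then show ?thesis by (simp add: cobd_def lookup_sum lookup_mult_0)
qed

lemma homogeneous_lookup_0: "homogeneous d p \<Longrightarrow> d \<noteq> 0 \<Longrightarrow> lookup p 0 = 0"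
  unfolding homogeneous_def by (metis in_keys_iff monom_deg_0 of_nat_0)

text \<open>
  The Koszul differential with coefficients in a module of vectors. On subsets of \<open>V\<close> of cardinality \<open>q\<close> the
  homological degree is \<open>card V - q\<close>; in particular \<open>q = card V\<close> carries \<open>M\<close> itself, and the image of the differential there is
  \<open>\<mm>M\<close>, with \<open>\<mm>\<close> the ideal of the variables.
\<close>

definition koszul_d :: "('v \<Rightarrow> nat) \<Rightarrow> ('v set \<Rightarrow> nat \<Rightarrow> ('v, 'k::field) mpol) \<Rightarrow> 'v set \<Rightarrow> nat \<Rightarrow> ('v, 'k) mpol" where
  "koszul_d \<iota> c T = (\<lambda>k. cobd \<iota> var (\<lambda>S. c S k) T)"

lemma koszul_d_koszul_d: "finite T \<Longrightarrow> inj_on \<iota> T \<Longrightarrow> koszul_d \<iota> (koszul_d \<iota> c) T = (\<lambda>_. 0)"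
  by (simp add: koszul_d_def cobd_cobd)

lemma koszul_d_cong: "(\<And>v. v \<in> T \<Longrightarrow> c (T - {v}) = c' (T - {v})) \<Longrightarrow> koszul_d \<iota> c T = koszul_d \<iota> c' T"
  unfolding koszul_d_def by (intro ext cobd_cong) simp

lemma koszul_d_diff: "koszul_d \<iota> (\<lambda>S k. c S k - c' S k) T = (\<lambda>k. koszul_d \<iota> c T k - koszul_d \<iota> c' T k)"
  by (simp add: koszul_d_def cobd_diff)

text \<open>
  Degree \<open>d\<close> in the graded free module with shifts \<open>s\<close>.
\<close>

definition hom_vec :: "(nat \<Rightarrow> int) \<Rightarrow> int \<Rightarrow> (nat \<Rightarrow> ('v, 'k::field) mpol) \<Rightarrow> bool" where
  "hom_vec s d u \<longleftrightarrow> (\<forall>k. homogeneous (d - s k) (u k))"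

definition hom_part_vec :: "(nat \<Rightarrow> int) \<Rightarrow> int \<Rightarrow> (nat \<Rightarrow> ('v, 'k::field) mpol) \<Rightarrow> nat \<Rightarrow> ('v, 'k) mpol" where
  "hom_part_vec s d u = (\<lambda>k. hom_part (d - s k) (u k))"

lemma hom_vec_hom_part_vec: "hom_vec s d (hom_part_vec s d u)"
  by (simp add: hom_vec_def hom_part_vec_def homogeneous_hom_part)

lemma hom_part_vec_hom_vec: "hom_vec s d u \<Longrightarrow> hom_part_vec s d u = u"
  by (simp add: hom_vec_def hom_part_vec_def hom_part_homogeneous)

lemma free_mod_hom_part_vec: "u \<in> free_mod V n \<Longrightarrow> hom_part_vec s d u \<in> free_mod V n"
  by (simp add: free_mod_def hom_part_vec_def poly_ring_hom_part)

lemma hom_part_vec_koszul_d: "hom_part_vec s d (koszul_d \<iota> w T) = koszul_d \<iota> (\<lambda>S. hom_part_vec s (d - 1) (w S)) T"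
  by (simp add: hom_part_vec_def koszul_d_def hom_part_cobd algebra_simps)

lemma hom_vec_koszul_d:
  assumes "\<And>v. v \<in> T \<Longrightarrow> hom_vec s d (w (T - {v}))"
  shows "hom_vec s (d + 1) (koszul_d \<iota> w T)"
  unfolding hom_vec_def koszul_d_def
proof
  fix k
  have "homogeneous (d - s k + 1) (cobd \<iota> var (\<lambda>S. w S k) T)"
    by (rule homogeneous_cobd) (use assms in \<open>simp add: hom_vec_def\<close>)
  then show "homogeneous (d + 1 - s k) (cobd \<iota> var (\<lambda>S. w S k) T)" by (simp add: algebra_simps)
qed

definition submod :: "'v set \<Rightarrow> (nat \<Rightarrow> ('v, 'k::field) mpol) set \<Rightarrow> bool" where
  "submod V M \<longleftrightarrow> (\<lambda>_. 0) \<in> M \<and> (\<forall>u\<in>M. \<forall>v\<in>M. (\<lambda>k. u k + v k) \<in> M) \<and>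
     (\<forall>r\<in>poly_ring V. \<forall>u\<in>M. (\<lambda>k. r * u k) \<in> M)"

lemma submodD:
  assumes "submod V M"
  shows "(\<lambda>_. 0) \<in> M" "u \<in> M \<Longrightarrow> v \<in> M \<Longrightarrow> (\<lambda>k. u k + v k) \<in> M"
    "r \<in> poly_ring V \<Longrightarrow> u \<in> M \<Longrightarrow> (\<lambda>k. r * u k) \<in> M"
  using assms by (auto simp: submod_def)

lemma submod_sum:
  assumes "submod V M" "\<And>i. i \<in> A \<Longrightarrow> f i \<in> M"
  shows "(\<lambda>k. \<Sum>i\<in>A. f i k) \<in> M"
  using assms(2)
proof (induction A rule: infinite_finite_induct)
  case (insert x F)
  then have "(\<lambda>k. f x k + (\<Sum>i\<in>F. f i k)) \<in> M" by (intro submodD(2)[OF assms(1)]) auto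
  then show ?case using insert by simp
qed (auto simp: submodD(1)[OF assms(1)])

lemma submod_koszul_d:
  assumes "submod V M" "T \<subseteq> V" "\<And>v. v \<in> T \<Longrightarrow> w (T - {v}) \<in> M"
  shows "koszul_d \<iota> w T \<in> M"
  unfolding koszul_d_def cobd_def
  using assms by (intro submod_sum[OF assms(1)] submodD(3)[OF assms(1)] poly_ring_mult osgn_poly_ring poly_ring_var) auto

lemma submod_free_mod: "submod V (free_mod V n)"
  by (auto simp: submod_def free_mod_def poly_ring_add poly_ring_mult)

lemma free_mod_diff: "u \<in> free_mod V n \<Longrightarrow> v \<in> free_mod V n \<Longrightarrow> (\<lambda>k. u k - v k) \<in> free_mod V n"
  by (auto simp: free_mod_def poly_ring_diff)

text \<open>
  The Koszul complex of the ring resolves the residue field: the multidegrees are full simplices, and the only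
  one without vertices is that of the constants in top degree.
\<close>

lemma ring_exact:
  fixes f :: "'v set \<Rightarrow> ('v, 'k::field) mpol"
  assumes V: "finite V" "inj_on \<iota> V"
    and f: "\<And>T. T \<subseteq> V \<Longrightarrow> card T = q \<Longrightarrow> f T \<in> poly_ring V"
    and co: "\<And>T. T \<subseteq> V \<Longrightarrow> card T = Suc q \<Longrightarrow> cobd \<iota> var f T = 0"
    and top: "q = card V \<Longrightarrow> lookup (f V) 0 = 0"
  shows "\<exists>w. (\<forall>T. w T \<in> poly_ring V) \<and> (\<forall>T. T \<subseteq> V \<longrightarrow> card T = q \<longrightarrow> f T = cobd \<iota> var w T)"
proof -
  obtain w where w: "\<And>T. T \<subseteq> V \<Longrightarrow> Suc (card T) = q \<Longrightarrow> w T \<in> poly_ring V"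
    "\<And>T. T \<subseteq> V \<Longrightarrow> card T = q \<Longrightarrow> f T = cobd \<iota> var w T"
  proof (rule koszul_exact[where f=f and V=V and q=q and \<iota>=\<iota> and Q="\<lambda>_. True"])
    fix Z a T
    assume T: "T \<subseteq> V" "card T = q" "Z \<subseteq> T" and m: "a + ind (T - Z) \<in> keys (f T)" and a: "keys a \<subseteq> V - Z"
    have fT: "finite T" using T V finite_subset by blast
    have "V - Z \<noteq> {} \<or> q - card Z \<ge> 1"
    proof (rule ccontr)
      assume "\<not> ?thesis"
      then have "Z = V" using T by auto
      then have "T = V" "q = card V" "a = 0" using T a by (auto simp flip: keys_eq_empty intro: poly_mapping_eqI simp: in_keys_iff)
      then show False using top m \<open>Z = V\<close> by (simp add: in_keys_iff ind_def)
    qed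
    then show "rel_exact TYPE('k) \<iota> (q - card Z) (V - Z) {S. S \<subseteq> V - Z \<and> \<not> True}"
      using V by (intro rel_exactI) (auto simp: simplicial_def acyclic_at_def inj_on_diff)
  qed (use f co V in auto)
  let ?w = "\<lambda>T. if T \<subseteq> V \<and> Suc (card T) = q then w T else 0"
  have "f T = cobd \<iota> var ?w T" if T: "T \<subseteq> V" "card T = q" for T
  proof -
    have "T - {v} \<subseteq> V \<and> Suc (card (T - {v})) = q" if "v \<in> T" for v
      using T V that finite_subset by (metis Diff_subset card_Suc_Diff1 subset_trans)
    then have "cobd \<iota> var w T = cobd \<iota> var ?w T" by (intro cobd_cong) auto
    then show ?thesis using w(2)[OF T] by simp
  qed
  then show ?thesis using w(1) by (intro exI[of _ ?w]) auto
qed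

lemma free_exact:
  fixes c :: "'v set \<Rightarrow> nat \<Rightarrow> ('v, 'k::field) mpol"
  assumes V: "finite V" "inj_on \<iota> V"
    and c: "\<And>T. T \<subseteq> V \<Longrightarrow> card T = q \<Longrightarrow> c T \<in> free_mod V n"
    and co: "\<And>T. T \<subseteq> V \<Longrightarrow> card T = Suc q \<Longrightarrow> koszul_d \<iota> c T = (\<lambda>_. 0)"
    and top: "\<And>k. q = card V \<Longrightarrow> lookup (c V k) 0 = 0"
  obtains w where "\<And>T. w T \<in> free_mod V n" "\<And>T. T \<subseteq> V \<Longrightarrow> card T = q \<Longrightarrow> c T = koszul_d \<iota> w T"
proof -
  let ?P = "\<lambda>k w. (\<forall>T. w T \<in> poly_ring V) \<and> (\<forall>T. T \<subseteq> V \<longrightarrow> card T = q \<longrightarrow> c T k = cobd \<iota> var w T)"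
  have ex: "\<exists>w. ?P k w" if "k < n" for k
  proof (rule ring_exact[OF V])
    show "c T k \<in> poly_ring V" if "T \<subseteq> V" "card T = q" for T
      using c[OF that] \<open>k < n\<close> by (simp add: free_mod_def)
    show "cobd \<iota> var (\<lambda>T. c T k) T = 0" if "T \<subseteq> V" "card T = Suc q" for T
      using co[OF that] unfolding koszul_d_def by meson
    show "q = card V \<Longrightarrow> lookup (c V k) 0 = 0" by (rule top)
  qed
  define W where "W = (\<lambda>k. SOME w. ?P k w)"
  have W: "?P k (W k)" if "k < n" for k
    unfolding W_def by (rule someI_ex[OF ex[OF that]])
  define w where "w = (\<lambda>T k. if k < n then W k T else 0)"
  have w: "?P k (\<lambda>T. w T k)" if "k < n" for k
    using W[OF that] that by (simp add: w_def)
  have "c T = koszul_d \<iota> w T" if T: "T \<subseteq> V" "card T = q" for T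
  proof
    fix k show "c T k = koszul_d \<iota> w T k"
    proof (cases "k < n")
      case True
      then show ?thesis using w[OF True] T by (simp add: koszul_d_def)
    next
      case False
      then show ?thesis using c[OF T] by (simp add: koszul_d_def free_mod_def w_def cobd_def)
    qed
  qed
  moreover have "w T \<in> free_mod V n" for T using w by (auto simp: free_mod_def w_def)
  ultimately show ?thesis using that by blast
qed

definition mat_map :: "nat \<Rightarrow> nat \<Rightarrow> (nat \<Rightarrow> nat \<Rightarrow> ('v, 'k::field) mpol) \<Rightarrow> (nat \<Rightarrow> ('v, 'k) mpol) \<Rightarrow> nat \<Rightarrow> ('v, 'k) mpol" where
  "mat_map n m D u = (\<lambda>l. if l < m then \<Sum>k<n. D l k * u k else 0)"

lemma mat_map_diff: "mat_map n m D (\<lambda>k. u k - v k) = (\<lambda>l. mat_map n m D u l - mat_map n m D v l)"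
  by (auto simp: mat_map_def algebra_simps sum_subtractf)

lemma mat_map_add: "mat_map n m D (\<lambda>k. u k + v k) = (\<lambda>l. mat_map n m D u l + mat_map n m D v l)"
  by (auto simp: mat_map_def algebra_simps sum.distrib)

lemma mat_map_scale: "mat_map n m D (\<lambda>k. r * u k) = (\<lambda>l. r * mat_map n m D u l)"
  by (auto simp: mat_map_def sum_distrib_left mult_ac)

lemma mat_map_0 [simp]: "mat_map n m D (\<lambda>_. 0) = (\<lambda>_. 0)"
  by (auto simp: mat_map_def)

lemma mat_map_koszul_d: "mat_map n m D (koszul_d \<iota> c T) = koszul_d \<iota> (\<lambda>S. mat_map n m D (c S)) T"
proof
  fix l
  show "mat_map n m D (koszul_d \<iota> c T) l = koszul_d \<iota> (\<lambda>S. mat_map n m D (c S)) T l"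
  proof (cases "l < m")
    case True
    have "(\<Sum>k<n. D l k * cobd \<iota> var (\<lambda>S. c S k) T) = cobd \<iota> var (\<lambda>S. \<Sum>k<n. D l k * c S k) T"
      by (simp add: cobd_sum cobd_mult)
    then show ?thesis using True by (simp add: mat_map_def koszul_d_def)
  qed (simp add: mat_map_def koszul_d_def cobd_def)
qed

text \<open>
  In terms of \<open>Tor\<close> this says \<open>Tor\<^sub>i(M, \<K>)\<^sub>j = 0\<close> for \<open>i = card V - q\<close> and \<open>j = d + i\<close>, so \<open>d = j - i\<close> is the number whose
  maximum is the regularity. The chosen normalization gives the cochain and its coboundary
  the degrees \<open>d\<close> and \<open>d + 1\<close>.
\<close>

definition exact_at :: "'v set \<Rightarrow> ('v \<Rightarrow> nat) \<Rightarrow> (nat \<Rightarrow> ('v, 'k::field) mpol) set \<Rightarrow> (nat \<Rightarrow> int) \<Rightarrow> nat \<Rightarrow> int \<Rightarrow> bool" where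
  "exact_at V \<iota> M s q d \<longleftrightarrow> (\<forall>c.
     (\<forall>T. T \<subseteq> V \<longrightarrow> card T = q \<longrightarrow> c T \<in> M \<and> hom_vec s d (c T)) \<longrightarrow>
     (\<forall>T. T \<subseteq> V \<longrightarrow> card T = Suc q \<longrightarrow> koszul_d \<iota> c T = (\<lambda>_. 0)) \<longrightarrow>
     (\<exists>w. (\<forall>T. T \<subseteq> V \<longrightarrow> Suc (card T) = q \<longrightarrow> w T \<in> M) \<and> (\<forall>T. T \<subseteq> V \<longrightarrow> card T = q \<longrightarrow> c T = koszul_d \<iota> w T)))"

lemma exact_atD:
  assumes "exact_at V \<iota> M s q d"
    and "\<And>T. T \<subseteq> V \<Longrightarrow> card T = q \<Longrightarrow> c T \<in> M" "\<And>T. T \<subseteq> V \<Longrightarrow> card T = q \<Longrightarrow> hom_vec s d (c T)"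
    and "\<And>T. T \<subseteq> V \<Longrightarrow> card T = Suc q \<Longrightarrow> koszul_d \<iota> c T = (\<lambda>_. 0)"
  obtains w where "\<And>T. T \<subseteq> V \<Longrightarrow> Suc (card T) = q \<Longrightarrow> w T \<in> M"
    "\<And>T. T \<subseteq> V \<Longrightarrow> card T = q \<Longrightarrow> c T = koszul_d \<iota> w T"
proof -
  have 1: "\<forall>T. T \<subseteq> V \<longrightarrow> card T = q \<longrightarrow> c T \<in> M \<and> hom_vec s d (c T)" 
    and 2: "\<forall>T. T \<subseteq> V \<longrightarrow> card T = Suc q \<longrightarrow> koszul_d \<iota> c T = (\<lambda>_. 0)" using assms(2-4) by simp_all
  from assms(1)[unfolded exact_at_def, THEN spec[of _ c], THEN mp, OF 1, THEN mp, OF 2]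
  obtain w where w: "\<forall>T. T \<subseteq> V \<longrightarrow> Suc (card T) = q \<longrightarrow> w T \<in> M" "\<forall>T. T \<subseteq> V \<longrightarrow> card T = q \<longrightarrow> c T = koszul_d \<iota> w T"
    by (elim exE conjE)
  show ?thesis by (rule that[of w]) (use w in simp_all)
qed

lemma exact_atI:
  assumes "\<And>c. (\<And>T. T \<subseteq> V \<Longrightarrow> card T = q \<Longrightarrow> c T \<in> M) \<Longrightarrow> (\<And>T. T \<subseteq> V \<Longrightarrow> card T = q \<Longrightarrow> hom_vec s d (c T)) \<Longrightarrow>
    (\<And>T. T \<subseteq> V \<Longrightarrow> card T = Suc q \<Longrightarrow> koszul_d \<iota> c T = (\<lambda>_. 0)) \<Longrightarrow>
    \<exists>w. (\<forall>T. T \<subseteq> V \<longrightarrow> Suc (card T) = q \<longrightarrow> w T \<in> M) \<and> (\<forall>T. T \<subseteq> V \<longrightarrow> card T = q \<longrightarrow> c T = koszul_d \<iota> w T)"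
  shows "exact_at V \<iota> M s q d"
  unfolding exact_at_def by (intro allI impI) (rule assms; simp)

lemma exact_at_beyond:
  assumes "finite V" "(\<lambda>_. 0) \<in> M" "q > card V"
  shows "exact_at V \<iota> M s q d"
proof (rule exact_atI)
  fix c
  have "card T \<noteq> q" if "T \<subseteq> V" for T using card_mono[OF assms(1) that] assms(3) by simp
  then show "\<exists>w. (\<forall>T. T \<subseteq> V \<longrightarrow> Suc (card T) = q \<longrightarrow> w T \<in> M) \<and> (\<forall>T. T \<subseteq> V \<longrightarrow> card T = q \<longrightarrow> c T = koszul_d \<iota> w T)"
    using assms(2) by (intro exI[of _ "\<lambda>_ _. 0"]) simp
qed

text \<open>
  In the highest homological degree a cocycle is a vector killed by all variables, hence zero.
\<close>

lemma exact_at_0: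
  assumes V: "finite V" "inj_on \<iota> V" "V \<noteq> {}" and M: "M \<subseteq> free_mod V n"
  shows "exact_at V \<iota> M s 0 d"
proof (rule exact_atI)
  fix c assume c: "\<And>T. T \<subseteq> V \<Longrightarrow> card T = 0 \<Longrightarrow> c T \<in> M"
    and co: "\<And>T. T \<subseteq> V \<Longrightarrow> card T = Suc 0 \<Longrightarrow> koszul_d \<iota> c T = (\<lambda>_. 0)"
  obtain w where w: "\<And>T. T \<subseteq> V \<Longrightarrow> card T = 0 \<Longrightarrow> c T = koszul_d \<iota> w T"
  proof (rule free_exact[OF V(1,2), of 0 c n])
    show "c T \<in> free_mod V n" if "T \<subseteq> V" "card T = 0" for T using c[OF that] M by blast
    show "lookup (c V k) 0 = 0" if "0 = card V" for k using that V by simp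
  qed (use co in auto)
  show "\<exists>w. (\<forall>T. T \<subseteq> V \<longrightarrow> Suc (card T) = 0 \<longrightarrow> w T \<in> M) \<and> (\<forall>T. T \<subseteq> V \<longrightarrow> card T = 0 \<longrightarrow> c T = koszul_d \<iota> w T)"
    using w by (intro exI[of _ w]) simp
qed

text \<open>
  One step of a graded resolution: a matrix of forms from the free module with shifts \<open>s\<close> to the one with shifts \<open>t\<close>.
\<close>

locale syzygy_step =
  fixes V :: "'v set" and \<iota> :: "'v \<Rightarrow> nat" and n m :: nat and s t :: "nat \<Rightarrow> int"
    and D :: "nat \<Rightarrow> nat \<Rightarrow> ('v, 'k::field) mpol"
  assumes V: "finite V" "inj_on \<iota> V"
    and D: "\<And>l k. l < m \<Longrightarrow> k < n \<Longrightarrow> D l k \<in> poly_ring V"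
    and Dh: "\<And>l k. l < m \<Longrightarrow> k < n \<Longrightarrow> homogeneous (s k - t l) (D l k)"
begin

abbreviation "A \<equiv> mat_map n m D"
definition "Img = A ` free_mod V n"
definition "Ker = {u \<in> free_mod V n. A u = (\<lambda>_. 0)}"

lemma A_free: "u \<in> free_mod V n \<Longrightarrow> A u \<in> free_mod V m"
  using D by (auto simp: free_mod_def mat_map_def intro!: poly_ring_sum poly_ring_mult)

lemma hom_part_vec_A: "hom_part_vec t d (A u) = A (hom_part_vec s d u)"
proof
  fix l
  show "hom_part_vec t d (A u) l = A (hom_part_vec s d u) l"
  proof (cases "l < m")
    case True
    have "hom_part (d - t l) (D l k * u k) = D l k * hom_part (d - s k) (u k)" if "k < n" for k
      using hom_part_mult[OF Dh[OF True that], of "d - t l" "u k"] by simp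
    then show ?thesis using True by (simp add: hom_part_vec_def mat_map_def hom_part_sum)
  qed (simp add: hom_part_vec_def mat_map_def)
qed

lemma submod_Ker: "submod V Ker"
  using submod_free_mod[of V n]
  by (auto simp: submod_def Ker_def mat_map_add mat_map_scale)

lemma submod_Img: "submod V Img"
  unfolding submod_def Img_def
proof (intro conjI ballI)
  show "(\<lambda>_. 0) \<in> A ` free_mod V n"
    using submodD(1)[OF submod_free_mod, of V n] by (intro image_eqI[of _ _ "\<lambda>_. 0"]) auto
  fix u v assume "u \<in> A ` free_mod V n" "v \<in> A ` free_mod V n"
  then obtain u' v' where "u = A u'" "v = A v'" "u' \<in> free_mod V n" "v' \<in> free_mod V n" by auto
  then show "(\<lambda>k. u k + v k) \<in> A ` free_mod V n"
    using submodD(2)[OF submod_free_mod[of V n], of u' v'] by (intro image_eqI[of _ _ "\<lambda>k. u' k + v' k"]) (auto simp: mat_map_add)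
next
  fix r :: "('v, 'k) mpol" and u assume "r \<in> poly_ring V" "u \<in> A ` free_mod V n"
  then obtain u' where "u = A u'" "u' \<in> free_mod V n" by auto
  then show "(\<lambda>k. r * u k) \<in> A ` free_mod V n" using \<open>r \<in> poly_ring V\<close>
      submodD(3)[OF submod_free_mod[of V n], of r u'] by (intro image_eqI[of _ _ "\<lambda>k. r * u' k"]) (auto simp: mat_map_scale)
qed

lemma hom_part_vec_Ker: "u \<in> Ker \<Longrightarrow> hom_part_vec s d u \<in> Ker"
  unfolding Ker_def using hom_part_vec_A[of d u] free_mod_hom_part_vec[of u V n s d] by (simp add: hom_part_vec_def)

lemma lift_cochain:
  assumes "\<And>T. P T \<Longrightarrow> u T \<in> Img"
  obtains u' where "\<And>T. u' T \<in> free_mod V n" "\<And>T. P T \<Longrightarrow> A (u' T) = u T"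
proof -
  have "\<exists>v. v \<in> free_mod V n \<and> (P T \<longrightarrow> A v = u T)" for T
  proof (cases "P T")
    case True
    then obtain v where "v \<in> free_mod V n" "u T = A v" using assms unfolding Img_def by blast
    then show ?thesis by auto
  qed (use submodD(1)[OF submod_free_mod, of V n] in auto)
  then have "\<forall>T. \<exists>v. v \<in> free_mod V n \<and> (P T \<longrightarrow> A v = u T)" by blast
  then obtain u' where "\<forall>T. u' T \<in> free_mod V n \<and> (P T \<longrightarrow> A (u' T) = u T)"
    by (rule choice[THEN exE])
  then show ?thesis by (intro that[of u']) auto
qed

lemma lift_homogeneous_cochain:
  assumes "\<And>T. P T \<Longrightarrow> u T \<in> Img" "\<And>T. P T \<Longrightarrow> hom_vec t d (u T)"
  obtains u' where "\<And>T. u' T \<in> free_mod V n" "\<And>T. P T \<Longrightarrow> A (u' T) = u T" "\<And>T. hom_vec s d (u' T)"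
proof -
  obtain u' where u': "\<And>T. u' T \<in> free_mod V n" "\<And>T. P T \<Longrightarrow> A (u' T) = u T"
    by (rule lift_cochain[of P u, OF assms(1)]) blast+
  show ?thesis
  proof (rule that[of "\<lambda>T. hom_part_vec s d (u' T)"])
    show "hom_part_vec s d (u' T) \<in> free_mod V n" for T by (rule free_mod_hom_part_vec[OF u'(1)])
    show "A (hom_part_vec s d (u' T)) = u T" if "P T" for T
      using hom_part_vec_A[of d "u' T"] u'(2)[OF that] hom_part_vec_hom_vec[OF assms(2)[OF that]] by simp
  qed (rule hom_vec_hom_part_vec)
qed

lemma card_remove: "T \<subseteq> V \<Longrightarrow> v \<in> T \<Longrightarrow> Suc (card (T - {v})) = card T"
  using V finite_subset card_Suc_Diff1 by metis

lemma finT: "T \<subseteq> V \<Longrightarrow> finite T" "T \<subseteq> V \<Longrightarrow> inj_on \<iota> T"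
  using V finite_subset inj_on_subset by blast+

end

text \<open>
  Minimality as a property of the kernel: it lies in \<open>\<mm>F\<close>. For a kernel that is the image of the next matrix,
  this means that the next matrix has no constant terms.
\<close>

locale minimal_syzygy_step = syzygy_step +
  assumes minimal: "\<And>u k. u \<in> Ker \<Longrightarrow> lookup (u k) 0 = 0"
begin

text \<open>
  Dimension shifting along \<open>0 \<rightarrow> Ker \<rightarrow> F \<rightarrow> Img \<rightarrow> 0\<close>, as a diagram chase. A cocycle in the kernel bounds in \<open>F\<close>; in the top
  cardinality this is where minimality enters. The image of a bounding cochain is a cocycle in \<open>Img\<close>, and a
  primitive of it corrects the bounding cochain to one with values in the kernel.
\<close>

lemma exact_at_up:
  assumes "exact_at V \<iota> Img t q d"
  shows "exact_at V \<iota> Ker s (Suc q) (d + 1)"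
proof (rule exact_atI)
  fix c
  assume c: "\<And>T. T \<subseteq> V \<Longrightarrow> card T = Suc q \<Longrightarrow> c T \<in> Ker"
    "\<And>T. T \<subseteq> V \<Longrightarrow> card T = Suc q \<Longrightarrow> hom_vec s (d + 1) (c T)"
    "\<And>T. T \<subseteq> V \<Longrightarrow> card T = Suc (Suc q) \<Longrightarrow> koszul_d \<iota> c T = (\<lambda>_. 0)"
  obtain w0 where w0: "\<And>T. w0 T \<in> free_mod V n" "\<And>T. T \<subseteq> V \<Longrightarrow> card T = Suc q \<Longrightarrow> c T = koszul_d \<iota> w0 T"
  proof (rule free_exact[OF V])
    show "c T \<in> free_mod V n" if "T \<subseteq> V" "card T = Suc q" for T using c(1)[OF that] by (simp add: Ker_def)
    show "lookup (c V k) 0 = 0" if "Suc q = card V" for k using minimal c(1)[of V] that by simp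
  qed (use c(3) in auto)
  define w where "w = (\<lambda>T. hom_part_vec s d (w0 T))"
  have w: "\<And>T. w T \<in> free_mod V n" "\<And>T. hom_vec s d (w T)"
    by (auto simp: w_def free_mod_hom_part_vec w0 hom_vec_hom_part_vec)
  have cw: "c T = koszul_d \<iota> w T" if "T \<subseteq> V" "card T = Suc q" for T
  proof -
    have "c T = hom_part_vec s (d + 1) (koszul_d \<iota> w0 T)" using hom_part_vec_hom_vec[OF c(2)[OF that]] w0(2)[OF that] by simp
    then show ?thesis by (simp add: hom_part_vec_koszul_d w_def)
  qed
  obtain u where u: "\<And>T. T \<subseteq> V \<Longrightarrow> Suc (card T) = q \<Longrightarrow> u T \<in> Img"
    "\<And>T. T \<subseteq> V \<Longrightarrow> card T = q \<Longrightarrow> A (w T) = koszul_d \<iota> u T"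
  proof (rule exact_atD[OF assms, of "\<lambda>T. A (w T)"])
    show "A (w T) \<in> Img" for T using w by (simp add: Img_def)
    show "hom_vec t d (A (w T))" for T
      using hom_vec_hom_part_vec[of t d "A (w T)"] hom_part_vec_A[of d "w T"] hom_part_vec_hom_vec[OF w(2)] by simp
    show "koszul_d \<iota> (\<lambda>T. A (w T)) T = (\<lambda>_. 0)" if "T \<subseteq> V" "card T = Suc q" for T
      using c(1)[OF that] cw[OF that] by (simp add: mat_map_koszul_d[symmetric] Ker_def)
  qed blast
  obtain u' where u': "\<And>T. u' T \<in> free_mod V n" "\<And>T. T \<subseteq> V \<and> Suc (card T) = q \<Longrightarrow> A (u' T) = u T"
    by (rule lift_cochain[of "\<lambda>T. T \<subseteq> V \<and> Suc (card T) = q" u]) (use u(1) in auto)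
  define w' where "w' = (\<lambda>T k. w T k - koszul_d \<iota> u' T k)"
  have "w' T \<in> Ker" if T: "T \<subseteq> V" "card T = q" for T
  proof -
    have "koszul_d \<iota> u' T \<in> free_mod V n" by (rule submod_koszul_d[OF submod_free_mod T(1) u'(1)])
    then have "w' T \<in> free_mod V n" unfolding w'_def by (intro free_mod_diff w)
    moreover have "A (koszul_d \<iota> u' T) = koszul_d \<iota> u T"
      unfolding mat_map_koszul_d by (rule koszul_d_cong) (use card_remove[OF T(1)] T in \<open>auto intro!: u'(2)\<close>)
    ultimately show ?thesis using u(2)[OF T] by (simp add: Ker_def w'_def mat_map_diff)
  qed
  moreover have "c T = koszul_d \<iota> w' T" if T: "T \<subseteq> V" "card T = Suc q" for T
    unfolding w'_def koszul_d_diff koszul_d_koszul_d[OF finT[OF T(1)]] using cw[OF T] by simp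
  ultimately show "\<exists>w. (\<forall>T. T \<subseteq> V \<longrightarrow> Suc (card T) = Suc q \<longrightarrow> w T \<in> Ker) \<and> (\<forall>T. T \<subseteq> V \<longrightarrow> card T = Suc q \<longrightarrow> c T = koszul_d \<iota> w T)"
    by auto
qed

text \<open>
  The converse chase. For \<open>q = card V\<close> it breaks down, because the free module has cohomology there.
\<close>

lemma exact_at_down:
  assumes "exact_at V \<iota> Ker s (Suc q) (d + 1)" "q < card V"
  shows "exact_at V \<iota> Img t q d"
proof (rule exact_atI)
  fix c
  assume c: "\<And>T. T \<subseteq> V \<Longrightarrow> card T = q \<Longrightarrow> c T \<in> Img"
    "\<And>T. T \<subseteq> V \<Longrightarrow> card T = q \<Longrightarrow> hom_vec t d (c T)"
    "\<And>T. T \<subseteq> V \<Longrightarrow> card T = Suc q \<Longrightarrow> koszul_d \<iota> c T = (\<lambda>_. 0)"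
  obtain w where w: "\<And>T. w T \<in> free_mod V n" "\<And>T. T \<subseteq> V \<and> card T = q \<Longrightarrow> A (w T) = c T" "\<And>T. hom_vec s d (w T)"
    by (rule lift_homogeneous_cochain[of "\<lambda>T. T \<subseteq> V \<and> card T = q" c d]) (use c in auto)
  obtain u where u: "\<And>T. T \<subseteq> V \<Longrightarrow> Suc (card T) = Suc q \<Longrightarrow> u T \<in> Ker"
    "\<And>T. T \<subseteq> V \<Longrightarrow> card T = Suc q \<Longrightarrow> koszul_d \<iota> w T = koszul_d \<iota> u T"
  proof (rule exact_atD[OF assms(1), of "koszul_d \<iota> w"])
    show "koszul_d \<iota> w T \<in> Ker" if T: "T \<subseteq> V" "card T = Suc q" for T
    proof -
      have "A (koszul_d \<iota> w T) = koszul_d \<iota> c T"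
        unfolding mat_map_koszul_d by (rule koszul_d_cong) (use card_remove[OF T(1)] T in \<open>auto intro!: w(2)\<close>)
      then show ?thesis using submod_koszul_d[OF submod_free_mod T(1) w(1)] c(3)[OF T] by (simp add: Ker_def)
    qed
    show "hom_vec s (d + 1) (koszul_d \<iota> w T)" for T by (rule hom_vec_koszul_d[OF w(3)])
    show "koszul_d \<iota> (koszul_d \<iota> w) T = (\<lambda>_. 0)" if "T \<subseteq> V" for T by (rule koszul_d_koszul_d[OF finT[OF that]])
  qed blast
  obtain x where x: "\<And>T. x T \<in> free_mod V n" "\<And>T. T \<subseteq> V \<Longrightarrow> card T = q \<Longrightarrow> (\<lambda>k. w T k - u T k) = koszul_d \<iota> x T"
  proof (rule free_exact[OF V, where c="\<lambda>T k. w T k - u T k" and q=q and n=n])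
    show "(\<lambda>k. w T k - u T k) \<in> free_mod V n" if "T \<subseteq> V" "card T = q" for T
      using u(1)[OF that(1)] that w(1) by (intro free_mod_diff) (auto simp: Ker_def)
    show "koszul_d \<iota> (\<lambda>T k. w T k - u T k) T = (\<lambda>_. 0)" if "T \<subseteq> V" "card T = Suc q" for T
      using u(2)[OF that] by (simp add: koszul_d_diff)
  qed (use assms(2) in auto)
  have "c T = koszul_d \<iota> (\<lambda>S. A (x S)) T" if T: "T \<subseteq> V" "card T = q" for T
  proof -
    have "A (u T) = (\<lambda>_. 0)" using u(1)[OF T(1)] T by (simp add: Ker_def)
    then have "c T = A (\<lambda>k. w T k - u T k)" using w(2) T by (simp add: mat_map_diff)
    then show ?thesis unfolding x(2)[OF T] mat_map_koszul_d .
  qed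
  moreover have "A (x T) \<in> Img" for T using x(1) by (simp add: Img_def)
  ultimately show "\<exists>w. (\<forall>T. T \<subseteq> V \<longrightarrow> Suc (card T) = q \<longrightarrow> w T \<in> Img) \<and> (\<forall>T. T \<subseteq> V \<longrightarrow> card T = q \<longrightarrow> c T = koszul_d \<iota> w T)"
    by (intro exI[of _ "\<lambda>S. A (x S)"]) auto
qed

text \<open>
  In top cardinality the cohomology is \<open>Img / \<mm>Img\<close>, which by minimality is \<open>F / \<mm>F\<close> and so has one generator in
  degree \<open>s k\<close> for each basis vector \<open>k\<close>.
\<close>

lemma exact_at_top_iff: "exact_at V \<iota> Img t (card V) j \<longleftrightarrow> (\<forall>k<n. s k \<noteq> j)"
proof (intro iffI allI impI notI)
  fix k assume hz: "exact_at V \<iota> Img t (card V) j" and k: "k < n" "s k = j"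
  define e where "e = (\<lambda>i. if i = k then 1 else 0 :: ('a, 'b) mpol)"
  have e: "e \<in> free_mod V n" using k by (auto simp: e_def free_mod_def poly_ring_1)
  have Ae: "A e = (\<lambda>l. if l < m then D l k else 0)"
  proof
    fix l
    have "(\<Sum>i<n. D l i * e i) = (\<Sum>i<n. if i = k then D l i else 0)" by (rule sum.cong) (auto simp: e_def)
    then show "A e l = (if l < m then D l k else 0)" using k by (simp add: mat_map_def)
  qed
  obtain w where w: "\<And>T. T \<subseteq> V \<Longrightarrow> Suc (card T) = card V \<Longrightarrow> w T \<in> Img"
    "\<And>T. T \<subseteq> V \<Longrightarrow> card T = card V \<Longrightarrow> A e = koszul_d \<iota> w T"
  proof (rule exact_atD[OF hz, of "\<lambda>_. A e"])
    show "A e \<in> Img" using e by (simp add: Img_def)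
    show "hom_vec t j (A e)" using Dh k by (auto simp: hom_vec_def Ae)
    show "koszul_d \<iota> (\<lambda>_. A e) T = (\<lambda>_. 0)" if "T \<subseteq> V" "card T = Suc (card V)" for T
      using card_mono[OF V(1) that(1)] that by simp
  qed blast
  obtain w' where w': "\<And>T. w' T \<in> free_mod V n" "\<And>T. T \<subseteq> V \<and> Suc (card T) = card V \<Longrightarrow> A (w' T) = w T"
    by (rule lift_cochain[of "\<lambda>T. T \<subseteq> V \<and> Suc (card T) = card V" w]) (use w(1) in auto)
  let ?u = "\<lambda>i. e i - koszul_d \<iota> w' V i"
  have "?u \<in> free_mod V n" by (intro free_mod_diff e submod_koszul_d[OF submod_free_mod] w') auto
  moreover have "A (koszul_d \<iota> w' V) = koszul_d \<iota> w V"
    unfolding mat_map_koszul_d by (rule koszul_d_cong) (use card_remove[of V] in \<open>auto intro!: w'(2)\<close>)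
  then have "A ?u = (\<lambda>_. 0)" using w(2)[of V] by (simp add: mat_map_diff)
  ultimately have "?u \<in> Ker" by (simp add: Ker_def)
  from minimal[OF this, of k] show False
    by (simp add: e_def lookup_minus koszul_d_def lookup_cobd_0)
next
  assume ne: "\<forall>k<n. s k \<noteq> j"
  show "exact_at V \<iota> Img t (card V) j"
  proof (rule exact_atI)
    fix c
    assume c: "\<And>T. T \<subseteq> V \<Longrightarrow> card T = card V \<Longrightarrow> c T \<in> Img"
      "\<And>T. T \<subseteq> V \<Longrightarrow> card T = card V \<Longrightarrow> hom_vec t j (c T)"
    obtain w where w: "\<And>T. w T \<in> free_mod V n" "\<And>T. T \<subseteq> V \<and> card T = card V \<Longrightarrow> A (w T) = c T" "\<And>T. hom_vec s j (w T)"
      by (rule lift_homogeneous_cochain[of "\<lambda>T. T \<subseteq> V \<and> card T = card V" c j]) (use c in auto)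
    obtain x where x: "\<And>T. x T \<in> free_mod V n" "\<And>T. T \<subseteq> V \<Longrightarrow> card T = card V \<Longrightarrow> w T = koszul_d \<iota> x T"
    proof (rule free_exact[OF V, of "card V" w n])
      show "koszul_d \<iota> w T = (\<lambda>_. 0)" if "T \<subseteq> V" "card T = Suc (card V)" for T
        using card_mono[OF V(1) that(1)] that by simp
      show "lookup (w V k) 0 = 0" for k
      proof (cases "k < n")
        case True
        then show ?thesis using w(3)[of V] ne by (auto simp: hom_vec_def intro!: homogeneous_lookup_0)
      next
        case False
        then show ?thesis using w(1)[of V] by (simp add: free_mod_def)
      qed
    qed (use w(1) in auto)
    have "c T = koszul_d \<iota> (\<lambda>S. A (x S)) T" if T: "T \<subseteq> V" "card T = card V" for T
      using w(2)[of T] x(2)[OF T] T mat_map_koszul_d[of n m D \<iota> x T] by simp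
    moreover have "A (x T) \<in> Img" for T using x(1) by (simp add: Img_def)
    ultimately show "\<exists>w. (\<forall>T. T \<subseteq> V \<longrightarrow> Suc (card T) = card V \<longrightarrow> w T \<in> Img) \<and> (\<forall>T. T \<subseteq> V \<longrightarrow> card T = card V \<longrightarrow> c T = koszul_d \<iota> w T)"
      by (intro exI[of _ "\<lambda>S. A (x S)"]) auto
  qed
qed

end

section \<open>Betti numbers from Koszul cohomology\<close>

text \<open>
  The modules are numbered so that \<open>dm 0\<close> is the augmentation into the ring (of rank 1) and \<open>dm (i + 1)\<close> the \<open>i\<close>-th
  differential; thus \<open>M i\<close> is the \<open>i\<close>-th syzygy module, starting with the resolved ideal \<open>M 0\<close>.
\<close>

locale minimal_resolution =
  fixes V :: "'v set" and \<iota> :: "'v \<Rightarrow> nat" and rk :: "nat \<Rightarrow> nat" and sh :: "nat \<Rightarrow> nat \<Rightarrow> int"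
    and dm :: "nat \<Rightarrow> nat \<Rightarrow> nat \<Rightarrow> ('v, 'k::field) mpol"
  assumes V_ne: "V \<noteq> {}"
    and steps: "\<And>i. minimal_syzygy_step V \<iota> (rk (Suc i)) (rk i) (sh (Suc i)) (sh i) (dm i)"
    and exact: "\<And>i. syzygy_step.Img V (rk (Suc (Suc i))) (rk (Suc i)) (dm (Suc i)) = syzygy_step.Ker V (rk (Suc i)) (rk i) (dm i)"
begin

definition M :: "nat \<Rightarrow> (nat \<Rightarrow> ('v, 'k) mpol) set" where
  "M i = syzygy_step.Img V (rk (Suc i)) (rk i) (dm i)"

sublocale S: minimal_syzygy_step V \<iota> "rk (Suc i)" "rk i" "sh (Suc i)" "sh i" "dm i" for i
  by (rule steps)

lemma M_Suc: "M (Suc i) = S.Ker i"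
  unfolding M_def by (rule exact)

lemma M_free: "M i \<subseteq> free_mod V (rk i)"
  unfolding M_def S.Img_def using S.A_free by blast

lemma exact_at_shift: "i + q \<le> card V \<Longrightarrow> exact_at V \<iota> (M i) (sh i) (i + q) (d + int i) \<longleftrightarrow> exact_at V \<iota> (M 0) (sh 0) q d"
proof (induction i)
  case (Suc i)
  have "exact_at V \<iota> (M (Suc i)) (sh (Suc i)) (Suc (i + q)) (d + int i + 1) \<longleftrightarrow> exact_at V \<iota> (M i) (sh i) (i + q) (d + int i)"
    unfolding M_Suc using S.exact_at_up[of i "i + q" "d + int i"] S.exact_at_down[of i "i + q" "d + int i"] Suc.prems
    unfolding M_def by auto
  then show ?case using Suc by (simp add: algebra_simps)
qed simp

text \<open>
  This covers the syzygy modules beyond the number of variables: their top cohomology is shifted from the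
  highest homological degree of an earlier syzygy module, where it vanishes.
\<close>

lemma exact_at_early: "exact_at V \<iota> (M (r + i)) (sh (r + i)) i (d + int i)"
proof (induction i)
  case 0
  then show ?case using exact_at_0[OF S.V V_ne M_free] by simp
next
  case (Suc i)
  from S.exact_at_up[OF this[unfolded M_def]] show ?case
    using M_Suc[of "r + i"] by (simp add: algebra_simps)
qed

text \<open>
  The generators of \<open>M i\<close> sit in the top cohomology of \<open>M i\<close>, and \<open>i\<close> steps of dimension shifting lead to the ideal.
\<close>

lemma shift_iff:
  "(\<exists>k<rk (Suc i). sh (Suc i) k = j) \<longleftrightarrow> i \<le> card V \<and> \<not> exact_at V \<iota> (M 0) (sh 0) (card V - i) (j - int i)"
proof -
  have "(\<exists>k<rk (Suc i). sh (Suc i) k = j) \<longleftrightarrow> \<not> exact_at V \<iota> (M i) (sh i) (card V) j"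
    unfolding M_def S.exact_at_top_iff by blast
  also have "\<dots> \<longleftrightarrow> i \<le> card V \<and> \<not> exact_at V \<iota> (M 0) (sh 0) (card V - i) (j - int i)"
  proof (cases "i \<le> card V")
    case True
    then show ?thesis using exact_at_shift[of i "card V - i" "j - int i"] by simp
  next
    case False
    then show ?thesis using exact_at_early[of "i - card V" "card V" "j - int (card V)"] by simp
  qed
  finally show ?thesis .
qed

end

text \<open>
  The ideal as a submodule of the free module of rank 1, so that it is treated like the syzygy modules.
\<close>

definition embed_ideal :: "'v set \<Rightarrow> ('v, 'k::field) mpol set \<Rightarrow> (nat \<Rightarrow> ('v, 'k) mpol) set" where
  "embed_ideal V I = {u \<in> free_mod V 1. u 0 \<in> I}"

lemma diff_map_mat: "diff_map F i = mat_map (res_rank F (Suc i)) (res_rank F i) (res_diff F i)"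
  by (simp add: diff_map_def mat_map_def fun_eq_iff)

lemma aug_map_mat: "mat_map (res_rank F 0) (Suc 0) (\<lambda>_. res_aug F) u = (\<lambda>l. if l = 0 then aug_map F u else 0)"
  by (auto simp: aug_map_def mat_map_def fun_eq_iff)

lemma minimal_resolution_of:
  fixes F :: "('v, 'k::field) free_complex"
  assumes V: "finite V" "inj_on \<iota> V" "V \<noteq> {}" and F: "minimal_graded_free_resolution V I F"
    and I: "I \<subseteq> poly_ring V"
  defines "rk \<equiv> case_nat 1 (res_rank F)" and "sh \<equiv> case_nat (\<lambda>_. 0) (res_shift F)"
    and "dm \<equiv> case_nat (\<lambda>_. res_aug F) (res_diff F)"
  shows "minimal_resolution V \<iota> rk sh dm" "minimal_resolution.M V rk dm 0 = embed_ideal V I"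
proof -
  note F' = F[unfolded minimal_graded_free_resolution_def graded_free_resolution_def]
  have hom: "dm i l k \<in> poly_ring V \<and> homogeneous (sh (Suc i) k - sh i l) (dm i l k)"
    if "l < rk i" "k < rk (Suc i)" for i l k
    using F' that by (cases i) (auto simp: rk_def sh_def dm_def)
  have st: "syzygy_step V \<iota> (rk (Suc i)) (rk i) (sh (Suc i)) (sh i) (dm i)" for i
    using V hom by unfold_locales auto
  have ker0: "syzygy_step.Ker V (rk (Suc 0)) (rk 0) (dm 0) = {u \<in> free_mod V (res_rank F 0). aug_map F u = 0}"
    unfolding syzygy_step.Ker_def[OF st] by (auto simp: rk_def dm_def aug_map_mat fun_eq_iff)
  have ex: "syzygy_step.Img V (rk (Suc (Suc i))) (rk (Suc i)) (dm (Suc i)) = syzygy_step.Ker V (rk (Suc i)) (rk i) (dm i)" for i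
  proof (cases i)
    case 0
    then show ?thesis using F' ker0 unfolding syzygy_step.Img_def[OF st]
      by (simp add: rk_def dm_def diff_map_mat)
  next
    case (Suc i')
    then show ?thesis using F' unfolding syzygy_step.Ker_def[OF st] syzygy_step.Img_def[OF st]
      by (simp add: rk_def dm_def diff_map_mat)
  qed
  have lk: "lookup (u k) 0 = 0" if u: "u \<in> syzygy_step.Ker V (rk (Suc i)) (rk i) (dm i)" for i u k
  proof -
    obtain v where v: "u = mat_map (rk (Suc (Suc i))) (rk (Suc i)) (dm (Suc i)) v"
      using u unfolding ex[symmetric] syzygy_step.Img_def[OF st] by blast
    show ?thesis using F' unfolding v by (auto simp: mat_map_def rk_def dm_def lookup_sum lookup_mult_0)
  qed
  show res: "minimal_resolution V \<iota> rk sh dm"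
    by (intro minimal_resolution.intro minimal_syzygy_step.intro minimal_syzygy_step_axioms.intro V(3) st ex lk)
  have "syzygy_step.Img V (rk (Suc 0)) (rk 0) (dm 0) = embed_ideal V I"
  proof -
    have img: "aug_map F ` free_mod V (res_rank F 0) = I" using F' by simp
    have "(\<lambda>l. if l = 0 then p else 0) \<in> free_mod V 1" if "p \<in> I" for p
      using that I by (auto simp: free_mod_def)
    moreover have "u = (\<lambda>l. if l = 0 then u 0 else 0)" if "u \<in> free_mod V 1" for u :: "nat \<Rightarrow> ('v, 'k) mpol"
      using that by (auto simp: free_mod_def fun_eq_iff)
    ultimately have "embed_ideal V I = (\<lambda>p l. if l = 0 then p else 0) ` I"
      unfolding embed_ideal_def by (auto simp: image_iff)
    also have "\<dots> = (\<lambda>u l. if l = 0 then aug_map F u else 0) ` free_mod V (res_rank F 0)"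
      unfolding img[symmetric] by (simp add: image_image)
    finally show ?thesis unfolding syzygy_step.Img_def[OF st]
      by (simp add: rk_def dm_def aug_map_mat[abs_def])
  qed
  then show "minimal_resolution.M V rk dm 0 = embed_ideal V I"
    unfolding minimal_resolution.M_def[OF res] .
qed

text \<open>
  The right-hand side does not mention a resolution, so every minimal resolution has the same nonzero Betti numbers.
\<close>

theorem betti_nonzero_iff:
  fixes I :: "('v, 'k::field) mpol set"
  assumes V: "finite V" "inj_on \<iota> V" "V \<noteq> {}" and ex: "\<exists>F. minimal_graded_free_resolution V I F"
    and I: "I \<subseteq> poly_ring V"
  shows "betti V I i j \<noteq> 0 \<longleftrightarrow> i \<le> card V \<and> \<not> exact_at V \<iota> (embed_ideal V I) (\<lambda>_. 0) (card V - i) (j - int i)"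
proof -
  define F where "F = (SOME F. minimal_graded_free_resolution V I F)"
  have F: "minimal_graded_free_resolution V I F" unfolding F_def using ex by (rule someI_ex)
  note res = minimal_resolution_of[OF V F I]
  have "betti V I i j \<noteq> 0 \<longleftrightarrow> (\<exists>k<res_rank F i. res_shift F i k = j)"
    unfolding betti_def F_def[symmetric] Let_def by (subst card_eq_0_iff) auto
  then show ?thesis using minimal_resolution.shift_iff[OF res(1), of i j] res(2) by simp
qed

section \<open>Existence of minimal graded free resolutions\<close>

lemma finite_monomials: "finite V \<Longrightarrow> finite {m :: 'v \<Rightarrow>\<^sub>0 nat. keys m \<subseteq> V \<and> monom_deg m = n}"
proof -
  assume V: "finite V"
  let ?F = "{f :: 'v \<Rightarrow> nat. \<forall>x. (x \<in> V \<longrightarrow> f x \<in> {..n}) \<and> (x \<notin> V \<longrightarrow> f x = 0)}"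
  have "lookup ` {m. keys m \<subseteq> V \<and> monom_deg m = n} \<subseteq> ?F"
  proof clarify
    fix m :: "'v \<Rightarrow>\<^sub>0 nat" and x assume m: "keys m \<subseteq> V" "n = monom_deg m"
    have "lookup m x \<le> monom_deg m"
    proof (cases "x \<in> keys m")
      case True
      then show ?thesis unfolding monom_deg_def by (intro member_le_sum) auto
    qed (simp add: in_keys_iff)
    then show "(x \<in> V \<longrightarrow> lookup m x \<in> {..monom_deg m}) \<and> (x \<notin> V \<longrightarrow> lookup m x = 0)"
      using m by (auto simp: in_keys_iff)
  qed
  moreover have "finite ?F" by (rule finite_set_of_finite_funs) (use V in auto)
  ultimately have "finite (lookup ` {m :: 'v \<Rightarrow>\<^sub>0 nat. keys m \<subseteq> V \<and> monom_deg m = n})" by (rule finite_subset)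
  then show ?thesis by (rule finite_imageD) (rule inj_onI, simp only: lookup_inject)
qed

text \<open>
  Elimination of coordinates, one at a time: an element \<open>b\<close> with nonzero coordinate \<open>x\<close> reduces all others to the subspace
  where that coordinate vanishes. This is the finite-dimensionality of graded pieces, phrased for generating submodules.
\<close>

lemma coordinate_generators:
  fixes U :: "(nat \<Rightarrow> ('v, 'k::field) mpol) set"
  assumes "finite A" "\<And>u v c. u \<in> U \<Longrightarrow> v \<in> U \<Longrightarrow> (\<lambda>k. u k - single 0 c * v k) \<in> U"
    "\<And>u. u \<in> U \<Longrightarrow> (\<And>l m. (l, m) \<in> A \<Longrightarrow> lookup (u l) m = 0) \<Longrightarrow> u = (\<lambda>_. 0)"
  shows "\<exists>B. finite B \<and> B \<subseteq> U \<and> (\<forall>S. submod V S \<longrightarrow> B \<subseteq> S \<longrightarrow> U \<subseteq> S)"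
  using assms
proof (induction A arbitrary: U rule: finite_induct)
  case empty
  then have "U \<subseteq> {\<lambda>_. 0}" by blast
  then show ?case by (intro exI[of _ "{}"]) (auto simp: submod_def)
next
  case (insert x A)
  obtain l m where x: "x = (l, m)" by (cases x)
  show ?case
  proof (cases "\<forall>u\<in>U. lookup (u l) m = 0")
    case True
    have "u = (\<lambda>_. 0)" if u: "u \<in> U" "\<And>l m. (l, m) \<in> A \<Longrightarrow> lookup (u l) m = 0" for u
      by (rule insert.prems(2)[OF u(1)]) (use True u x in auto)
    from insert.IH[OF insert.prems(1) this] show ?thesis by blast
  next
    case False
    then obtain b where b: "b \<in> U" "lookup (b l) m \<noteq> 0" by blast
    define U' where "U' = {u \<in> U. lookup (u l) m = 0}"
    have "\<exists>B. finite B \<and> B \<subseteq> U' \<and> (\<forall>S. submod V S \<longrightarrow> B \<subseteq> S \<longrightarrow> U' \<subseteq> S)"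
    proof (rule insert.IH)
      show "(\<lambda>k. u k - single 0 c * v k) \<in> U'" if "u \<in> U'" "v \<in> U'" for u v c
        using insert.prems(1) that by (simp add: U'_def lookup_minus lookup_const_mult)
      show "u = (\<lambda>_. 0)" if u: "u \<in> U'" "\<And>l m. (l, m) \<in> A \<Longrightarrow> lookup (u l) m = 0" for u
        by (rule insert.prems(2)) (use u x in \<open>auto simp: U'_def\<close>)
    qed
    then obtain B where B: "finite B" "B \<subseteq> U'" "\<And>S. submod V S \<Longrightarrow> B \<subseteq> S \<Longrightarrow> U' \<subseteq> S" by auto
    have "U \<subseteq> S" if S: "submod V S" "insert b B \<subseteq> S" for S
    proof
      fix u assume u: "u \<in> U"
      define c where "c = lookup (u l) m / lookup (b l) m"
      have "(\<lambda>k. u k - single 0 c * b k) \<in> U'"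
        using insert.prems(1)[OF u b(1), of c] b by (simp add: U'_def lookup_minus lookup_const_mult c_def)
      then have 1: "(\<lambda>k. u k - single 0 c * b k) \<in> S" using B(3)[OF S(1)] S(2) by blast
      have "(\<lambda>k. single 0 c * b k) \<in> S" using S by (intro submodD(3)[OF S(1)]) (auto simp: poly_ring_single)
      from submodD(2)[OF S(1) 1 this] show "u \<in> S" by simp
    qed
    then show ?thesis using B(1,2) b(1) by (intro exI[of _ "insert b B"]) (auto simp: U'_def)
  qed
qed

definition generates :: "'v set \<Rightarrow> (nat \<Rightarrow> ('v, 'k::field) mpol) set \<Rightarrow> (nat \<Rightarrow> int) \<Rightarrow> nat \<Rightarrow> (nat \<Rightarrow> nat \<Rightarrow> ('v, 'k) mpol) \<Rightarrow> (nat \<Rightarrow> int) \<Rightarrow> bool" where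
  "generates V M t n g s \<longleftrightarrow> (\<forall>k<n. g k \<in> M \<and> hom_vec t (s k) (g k)) \<and>
     (\<forall>S. submod V S \<longrightarrow> (\<forall>k<n. g k \<in> S) \<longrightarrow> M \<subseteq> S)"

text \<open>
  In degrees above \<open>card V\<close> the top Koszul cohomology \<open>M / \<mm>M\<close> vanishes, so elements of such degree are
  combinations of elements of one degree less. Hence \<open>M\<close> is generated by its graded pieces of
  degree \<open>\<le> card V\<close>; only finitely many of them are nonzero, and each has finitely many generators.
\<close>

lemma graded_generators:
  fixes M :: "(nat \<Rightarrow> ('v, 'k::field) mpol) set"
  assumes V: "finite V" and M: "submod V M" "M \<subseteq> free_mod V m" "\<And>u d. u \<in> M \<Longrightarrow> hom_part_vec t d u \<in> M"
    and hz: "\<And>d. d > int (card V) \<Longrightarrow> exact_at V \<iota> M t (card V) d"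
  shows "\<exists>n g s. generates V M t n g s"
proof -
  define G where "G = (\<lambda>d. {u \<in> M. hom_vec t d u})"
  have "\<exists>B. finite B \<and> B \<subseteq> G d \<and> (\<forall>S. submod V S \<longrightarrow> B \<subseteq> S \<longrightarrow> G d \<subseteq> S)" for d
  proof (rule coordinate_generators)
    show "finite (SIGMA l:{..<m}. {x. keys x \<subseteq> V \<and> monom_deg x = nat (d - t l)})"
      using finite_monomials[OF V] by (intro finite_SigmaI) auto
    show "(\<lambda>k. u k - single 0 c * v k) \<in> G d" if u: "u \<in> G d" and v: "v \<in> G d" for u v c
    proof -
      have "(\<lambda>k. single 0 (- c) * v k) \<in> M" using v M by (intro submodD(3)[OF M(1)]) (auto simp: G_def poly_ring_single)
      then have "(\<lambda>k. u k + single 0 (- c) * v k) \<in> M" using u by (intro submodD(2)[OF M(1)]) (auto simp: G_def)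
      then have "(\<lambda>k. u k - single 0 c * v k) \<in> M" by (simp add: single_uminus)
      moreover have "homogeneous (d - t k) (single 0 c * v k)" for k
        using v homogeneous_mult[OF homogeneous_single[of 0 c], of "d - t k" "v k"] by (simp add: G_def hom_vec_def)
      ultimately show ?thesis using u by (simp add: G_def hom_vec_def homogeneous_diff)
    qed
    show "u = (\<lambda>_. 0)" if u: "u \<in> G d" and
      z: "\<And>l x. (l, x) \<in> (SIGMA l:{..<m}. {x. keys x \<subseteq> V \<and> monom_deg x = nat (d - t l)}) \<Longrightarrow> lookup (u l) x = 0" for u
    proof
      fix l
      have uf: "u \<in> free_mod V m" using u M by (auto simp: G_def)
      show "u l = 0"
      proof (cases "l < m")
        case True
        have "x \<notin> keys (u l)" for x
        proof
          assume x: "x \<in> keys (u l)"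
          then have "keys x \<subseteq> V" using uf True by (auto simp: free_mod_def poly_ring_def)
          moreover have "int (monom_deg x) = d - t l" using u x by (auto simp: G_def hom_vec_def homogeneous_def)
          then have "monom_deg x = nat (d - t l)" by simp
          ultimately show False using z[of l x] True x by (simp add: in_keys_iff)
        qed
        then show ?thesis by (intro poly_mapping_eqI) (auto simp: in_keys_iff)
      qed (use uf in \<open>simp add: free_mod_def\<close>)
    qed
  qed
  then have "\<forall>d. \<exists>B. finite B \<and> B \<subseteq> G d \<and> (\<forall>S. submod V S \<longrightarrow> B \<subseteq> S \<longrightarrow> G d \<subseteq> S)" by blast
  from choice[OF this] obtain B where "\<forall>d. finite (B d) \<and> B d \<subseteq> G d \<and> (\<forall>S. submod V S \<longrightarrow> B d \<subseteq> S \<longrightarrow> G d \<subseteq> S)" ..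
  then have B: "\<And>d. finite (B d)" "\<And>d. B d \<subseteq> G d" "\<And>d S. submod V S \<Longrightarrow> B d \<subseteq> S \<Longrightarrow> G d \<subseteq> S"
    by simp_all
  \<comment> \<open>A lower bound for the degrees that occur.\<close>
  define lo where "lo = (if m = 0 then 0 else Min (t ` {..<m}))"
  have lo: "lo \<le> t l" if "l < m" for l using that by (auto simp: lo_def)
  have neg: "G d \<subseteq> {\<lambda>_. 0}" if "d < lo" for d
  proof clarify
    fix u assume u: "u \<in> G d"
    show "u = (\<lambda>_. 0)"
    proof
      fix l
      have uf: "u \<in> free_mod V m" using u M by (auto simp: G_def)
      show "u l = 0"
      proof (cases "l < m")
        case True
        have "homogeneous (d - t l) (u l)" "d - t l < 0" using u lo[OF True] that by (auto simp: G_def hom_vec_def)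
        then have "keys (u l) = {}" by (force simp: homogeneous_def)
        then show ?thesis by (intro poly_mapping_eqI) (auto simp: in_keys_iff)
      qed (use uf in \<open>simp add: free_mod_def\<close>)
    qed
  qed
  define P where "P = (SIGMA d:{lo..int (card V)}. B d)"
  have fP: "finite P" unfolding P_def using B(1) by blast
  then obtain h where h: "bij_betw h {0..<card P} P" using ex_bij_betw_nat_finite by blast
  define g where "g = (\<lambda>k. snd (h k))"
  define s where "s = (\<lambda>k. fst (h k))"
  have hk: "h k \<in> P" if "k < card P" for k using h that by (auto simp: bij_betw_def)
  have "M \<subseteq> S" if S: "submod V S" "\<forall>k<card P. g k \<in> S" for S
  proof -
    have BS: "B d \<subseteq> S" if "lo \<le> d" "d \<le> int (card V)" for d
    proof
      fix b assume "b \<in> B d"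
      then have "(d, b) \<in> P" using that by (simp add: P_def)
      moreover have "h ` {0..<card P} = P" using h by (simp add: bij_betw_def)
      ultimately obtain k where "k \<in> {0..<card P}" "(d, b) = h k" by blast
      then have "k < card P" "h k = (d, b)" by auto
      then show "b \<in> S" using S(2) by (auto simp: g_def)
    qed
    \<comment> \<open>Degrees from \<open>card V\<close> upwards, by descent through the image of the Koszul differential.\<close>
    have GS: "G (int (card V) + int i) \<subseteq> S" for i
    proof (induction i)
      case 0
      show ?case
      proof (cases "int (card V) < lo")
        case True
        then show ?thesis using neg submodD(1)[OF S(1)] by force
      next
        case False
        then show ?thesis using B(3)[OF S(1)] BS by simp
      qed
    next
      case (Suc i)
      show ?case
      proof
        fix u assume "u \<in> G (int (card V) + int (Suc i))"
        then have u: "u \<in> M" "hom_vec t (int (card V) + int i + 1) u" by (auto simp: G_def algebra_simps)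
        obtain w where w: "\<And>T. T \<subseteq> V \<Longrightarrow> Suc (card T) = card V \<Longrightarrow> w T \<in> M"
           "\<And>T. T \<subseteq> V \<Longrightarrow> card T = card V \<Longrightarrow> u = koszul_d \<iota> w T"
        proof (rule exact_atD[OF hz[of "int (card V) + int i + 1"], of "\<lambda>_. u"])
          show "koszul_d \<iota> (\<lambda>_. u) T = (\<lambda>_. 0)" if "T \<subseteq> V" "card T = Suc (card V)" for T
            using card_mono[OF V that(1)] that by simp
          show "u \<in> M" "hom_vec t (int (card V) + int i + 1) u" by (rule u)+
        qed (blast | simp)+
        have "u = hom_part_vec t (int (card V) + int i + 1) (koszul_d \<iota> w V)" using w(2)[of V] hom_part_vec_hom_vec[OF u(2)] by simp
        also have "\<dots> = koszul_d \<iota> (\<lambda>S. hom_part_vec t (int (card V) + int i) (w S)) V" by (simp add: hom_part_vec_koszul_d)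
        also have "\<dots> \<in> S"
        proof (rule submod_koszul_d[OF S(1)])
          fix v assume "v \<in> V"
          then have "w (V - {v}) \<in> M" by (intro w(1) card_Suc_Diff1 V) auto
          then have "hom_part_vec t (int (card V) + int i) (w (V - {v})) \<in> G (int (card V) + int i)"
            using M(3) by (simp add: G_def hom_vec_hom_part_vec)
          then show "hom_part_vec t (int (card V) + int i) (w (V - {v})) \<in> S" using Suc by blast
        qed simp
        finally show "u \<in> S" .
      qed
    qed
    have GS': "G d \<subseteq> S" for d
    proof -
      consider "d < lo" | "lo \<le> d" "d \<le> int (card V)" | "d > int (card V)" by linarith
      then show ?thesis
      proof cases
        case 1
        then show ?thesis using neg submodD(1)[OF S(1)] by force
      next
        case 2
        then show ?thesis using B(3)[OF S(1)] BS by simp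
      next
        case 3
        then show ?thesis using GS[of "nat (d - int (card V))"] by simp
      qed
    qed
    show "M \<subseteq> S"
    proof
      fix u assume u: "u \<in> M"
      then have uf: "u \<in> free_mod V m" using M by blast
      define E where "E = (\<Union>l<m. (\<lambda>x. int (monom_deg x) + t l) ` keys (u l))"
      have fE: "finite E" by (simp add: E_def)
      have "u k = (\<Sum>d\<in>E. hom_part_vec t d u k)" for k
      proof (cases "k < m")
        case True
        have "u k = (\<Sum>d\<in>(\<lambda>d. d - t k) ` E. hom_part d (u k))"
          by (rule sum_hom_part) (use fE True in \<open>force simp: E_def image_iff\<close>)+
        also have "\<dots> = (\<Sum>d\<in>E. hom_part (d - t k) (u k))"
          by (subst sum.reindex) (auto simp: inj_on_def)
        finally show ?thesis by (simp add: hom_part_vec_def)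
      next
        case False
        then show ?thesis using uf by (simp add: free_mod_def hom_part_vec_def)
      qed
      moreover have "(\<lambda>k. \<Sum>d\<in>E. hom_part_vec t d u k) \<in> S"
      proof (rule submod_sum[OF S(1)])
        fix d
        have "hom_part_vec t d u \<in> G d" using M(3)[OF u] by (simp add: G_def hom_vec_hom_part_vec)
        then show "hom_part_vec t d u \<in> S" using GS' by blast
      qed
      moreover have "u = (\<lambda>k. \<Sum>d\<in>E. hom_part_vec t d u k)" using calculation(1) by (rule ext)
      ultimately show "u \<in> S" by metis
    qed
  qed
  moreover have "g k \<in> M \<and> hom_vec t (s k) (g k)" if "k < card P" for k
  proof -
    have "snd (h k) \<in> G (fst (h k))" using hk[OF that] subsetD[OF B(2)] by (auto simp: P_def)
    then show ?thesis by (simp add: g_def s_def G_def)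
  qed
  ultimately show ?thesis unfolding generates_def by blast
qed

text \<open>
  Take a homogeneous generating family with the least number of elements. A relation with a nonzero constant
  coefficient at \<open>k\<^sub>0\<close> has a homogeneous component in which this coefficient is a nonzero scalar, so the generator \<open>g k\<^sub>0\<close>
  could be left out.
\<close>

lemma minimal_presentation:
  fixes M :: "(nat \<Rightarrow> ('v, 'k::field) mpol) set"
  assumes V: "finite V" "inj_on \<iota> V" and M: "submod V M" "M \<subseteq> free_mod V m"
    and ex: "\<exists>n g s. generates V M t n g s"
  obtains n s D where "minimal_syzygy_step V \<iota> n m s t D" "M = syzygy_step.Img V n m D"
proof -
  define n where "n = (LEAST n. \<exists>g s. generates V M t n g s)"
  obtain g s where gs: "generates V M t n g s" using LeastI_ex[OF ex] unfolding n_def by blast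
  have least: "n \<le> n'" if "generates V M t n' g' s'" for n' g' s'
    unfolding n_def using that by (blast intro: Least_le)
  have g: "g k \<in> M" "hom_vec t (s k) (g k)" if "k < n" for k using gs that by (auto simp: generates_def)
  define D where "D = (\<lambda>l k. g k l)"
  have gf: "g k \<in> free_mod V m" if "k < n" for k using g[OF that] M by blast
  interpret S: syzygy_step V \<iota> n m s t D
    using V g gf by unfold_locales (auto simp: D_def free_mod_def hom_vec_def)
  have Au: "S.A u l = (\<Sum>k<n. u k * g k l)" for u l
    using gf by (auto simp: mat_map_def D_def mult.commute free_mod_def intro!: sum.neutral)
  have e: "g k \<in> S.Img" if k: "k < n" for k
  proof -
    define e where "e = (\<lambda>i. if i = k then 1 else 0 :: ('v, 'k) mpol)"
    have "e \<in> free_mod V n" using k by (auto simp: e_def free_mod_def poly_ring_1)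
    moreover have "S.A e l = g k l" for l
    proof -
      have "(\<Sum>i<n. e i * g i l) = (\<Sum>i<n. if i = k then g i l else 0)" by (rule sum.cong) (auto simp: e_def)
      then show ?thesis using k by (simp add: Au)
    qed
    then have "S.A e = g k" by blast
    ultimately show ?thesis unfolding S.Img_def by (metis imageI)
  qed
  have "M \<subseteq> S.Img" using gs e S.submod_Img unfolding generates_def by blast
  moreover have "S.Img \<subseteq> M"
  proof
    fix u assume "u \<in> S.Img"
    then obtain v where v: "v \<in> free_mod V n" "u = S.A v" by (auto simp: S.Img_def)
    have "(\<lambda>l. \<Sum>k<n. v k * g k l) \<in> M"
      using v g by (intro submod_sum[OF M(1)] submodD(3)[OF M(1)]) (auto simp: free_mod_def)
    moreover have "u = (\<lambda>l. \<Sum>k<n. v k * g k l)" unfolding v(2) by (rule ext) (rule Au)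
    ultimately show "u \<in> M" by simp
  qed
  moreover have "lookup (u k\<^sub>0) 0 = 0" if u: "u \<in> S.Ker" for u k\<^sub>0
  proof (rule ccontr)
    assume ne: "lookup (u k\<^sub>0) 0 \<noteq> 0"
    have uf: "u \<in> free_mod V n" using u by (simp add: S.Ker_def)
    have k0: "k\<^sub>0 < n"
    proof (rule ccontr)
      assume "\<not> ?thesis"
      then have "u k\<^sub>0 = 0" using uf by (simp add: free_mod_def)
      then show False using ne by simp
    qed
    define v where "v = hom_part_vec s (s k\<^sub>0) u"
    have v: "v \<in> S.Ker" "v \<in> free_mod V n" using S.hom_part_vec_Ker[OF u] by (auto simp: v_def S.Ker_def)
    define c where "c = lookup (u k\<^sub>0) 0"
    have vk0: "v k\<^sub>0 = single 0 c"
      by (intro poly_mapping_eqI) (auto simp: v_def hom_part_vec_def lookup_hom_part c_def monom_deg_eq_0_iff lookup_single when_def)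
    have c: "c \<noteq> 0" using ne by (simp add: c_def)
    have rel: "g k\<^sub>0 l = (\<Sum>k\<in>{..<n} - {k\<^sub>0}. (- single 0 (1 / c) * v k) * g k l)" for l
    proof -
      have "0 = S.A v l" using v by (simp add: S.Ker_def)
      also have "\<dots> = v k\<^sub>0 * g k\<^sub>0 l + (\<Sum>k\<in>{..<n} - {k\<^sub>0}. v k * g k l)"
        unfolding Au using k0 by (intro sum.remove) auto
      finally have "v k\<^sub>0 * g k\<^sub>0 l = - (\<Sum>k\<in>{..<n} - {k\<^sub>0}. v k * g k l)"
        by (simp add: eq_neg_iff_add_eq_0)
      then have "single 0 (1 / c) * (single 0 c * g k\<^sub>0 l) = - single 0 (1 / c) * (\<Sum>k\<in>{..<n} - {k\<^sub>0}. v k * g k l)"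
        by (simp add: vk0)
      moreover have "single 0 (1 / c) * (single 0 c * g k\<^sub>0 l) = g k\<^sub>0 l"
        using c by (simp flip: mult.assoc add: mult_single)
      ultimately show ?thesis by (simp add: sum_distrib_left mult.assoc)
    qed
    \<comment> \<open>Renumbering of the remaining generators: the last one takes the place of the omitted one.\<close>
    define \<tau> where "\<tau> = (\<lambda>k. if k = k\<^sub>0 then n - 1 else k)"
    have \<tau>: "\<exists>i<n - 1. \<tau> i = k" if "k < n" "k \<noteq> k\<^sub>0" for k
    proof (cases "k = n - 1")
      case True
      then show ?thesis using that k0 by (intro exI[of _ "k\<^sub>0"]) (auto simp: \<tau>_def)
    next
      case False
      then show ?thesis using that by (intro exI[of _ k]) (auto simp: \<tau>_def)
    qed
    have "generates V M t (n - 1) (g \<circ> \<tau>) (s \<circ> \<tau>)"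
      unfolding generates_def
    proof (intro conjI allI impI)
      fix k assume "k < n - 1"
      then have "\<tau> k < n" by (auto simp: \<tau>_def)
      then show "(g \<circ> \<tau>) k \<in> M" "hom_vec t ((s \<circ> \<tau>) k) ((g \<circ> \<tau>) k)" using g by auto
    next
      fix S assume S: "submod V S" "\<forall>k<n - 1. (g \<circ> \<tau>) k \<in> S"
      have gS: "g k \<in> S" if "k < n" "k \<noteq> k\<^sub>0" for k using \<tau>[OF that] S(2) by auto
      have "(\<lambda>l. \<Sum>k\<in>{..<n} - {k\<^sub>0}. (- single 0 (1 / c) * v k) * g k l) \<in> S"
        using v gS by (intro submod_sum[OF S(1)] submodD(3)[OF S(1)] poly_ring_mult poly_ring_uminus poly_ring_single)
           (auto simp: free_mod_def)
      moreover have "g k\<^sub>0 = (\<lambda>l. \<Sum>k\<in>{..<n} - {k\<^sub>0}. (- single 0 (1 / c) * v k) * g k l)"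
        by (rule ext) (rule rel)
      ultimately have "g k\<^sub>0 \<in> S" by metis
      then have "\<forall>k<n. g k \<in> S" using gS by blast
      then show "M \<subseteq> S" using gs S(1) unfolding generates_def by blast
    qed
    then show False using least k0 by fastforce
  qed
  ultimately show ?thesis
    by (intro that[of n s D]) (auto intro!: minimal_syzygy_step.intro S.syzygy_step_axioms minimal_syzygy_step_axioms.intro)
qed

text \<open>
  The invariant of the construction of a resolution, for a graded submodule \<open>M\<close> of a free module of rank \<open>m\<close> with shifts \<open>t\<close>.
  The last condition says that \<open>Tor\<^sub>i(M, \<K>)\<^sub>j\<close> vanishes for \<open>j > card V\<close>. It is inherited by syzygy
  modules and bounds the degrees of generators at every step.
\<close>

definition resolvable :: "'v set \<Rightarrow> ('v \<Rightarrow> nat) \<Rightarrow> nat \<times> (nat \<Rightarrow> int) \<times> (nat \<Rightarrow> ('v, 'k::field) mpol) set \<Rightarrow> bool" where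
  "resolvable V \<iota> \<sigma> = (case \<sigma> of (m, t, M) \<Rightarrow> submod V M \<and> M \<subseteq> free_mod V m \<and> (\<forall>u\<in>M. \<forall>d. hom_part_vec t d u \<in> M) \<and>
     (\<forall>q d. d > int q \<longrightarrow> exact_at V \<iota> M t q d))"

definition syzygy_of :: "'v set \<Rightarrow> ('v \<Rightarrow> nat) \<Rightarrow> (nat \<Rightarrow> nat \<Rightarrow> ('v, 'k::field) mpol) \<Rightarrow>
    nat \<times> (nat \<Rightarrow> int) \<times> (nat \<Rightarrow> ('v, 'k) mpol) set \<Rightarrow> nat \<times> (nat \<Rightarrow> int) \<times> (nat \<Rightarrow> ('v, 'k) mpol) set \<Rightarrow> bool" where
  "syzygy_of V \<iota> D \<sigma> \<sigma>' = (case (\<sigma>, \<sigma>') of ((m, t, M), (n, s, N)) \<Rightarrow>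
     minimal_syzygy_step V \<iota> n m s t D \<and> M = syzygy_step.Img V n m D \<and> N = syzygy_step.Ker V n m D)"

text \<open>
  Dimension shifting raises \<open>q\<close> and \<open>d\<close> together, so the bound \<open>d > q\<close> of the invariant is preserved.
\<close>

lemma next_syzygy:
  assumes V: "finite V" "inj_on \<iota> V" "V \<noteq> {}" and res: "resolvable V \<iota> \<sigma>"
  shows "\<exists>\<sigma>'. resolvable V \<iota> \<sigma>' \<and> (\<exists>D. syzygy_of V \<iota> D \<sigma> \<sigma>')"
proof -
  obtain m t M where \<sigma>: "\<sigma> = (m, t, M)" by (cases \<sigma>)
  have M: "submod V M" "M \<subseteq> free_mod V m" "\<And>u d. u \<in> M \<Longrightarrow> hom_part_vec t d u \<in> M" "\<And>q d. d > int q \<Longrightarrow> exact_at V \<iota> M t q d"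
    using res by (auto simp: resolvable_def \<sigma>)
  obtain n s D where nsD: "minimal_syzygy_step V \<iota> n m s t D" "M = syzygy_step.Img V n m D"
    using minimal_presentation[OF V(1,2) M(1,2) graded_generators[OF V(1) M]] by blast
  interpret S: minimal_syzygy_step V \<iota> n m s t D by (rule nsD(1))
  have KF: "S.Ker \<subseteq> free_mod V n" by (auto simp: S.Ker_def)
  have "exact_at V \<iota> S.Ker s q d" if "d > int q" for q d
  proof (cases q)
    case 0
    then show ?thesis using exact_at_0[OF V KF] by simp
  next
    case (Suc q')
    then show ?thesis using S.exact_at_up[of q' "d - 1"] M(4)[of q' "d - 1"] that nsD(2) by simp
  qed
  then have "resolvable V \<iota> (n, s, S.Ker)"
    using S.submod_Ker KF S.hom_part_vec_Ker by (simp add: resolvable_def)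
  moreover have "syzygy_of V \<iota> D \<sigma> (n, s, S.Ker)" using nsD by (simp add: syzygy_of_def \<sigma>)
  ultimately show ?thesis by blast
qed

theorem minimal_resolution_exists:
  fixes I :: "('v, 'k::field) mpol set"
  assumes V: "finite V" "inj_on \<iota> V" "V \<noteq> {}"
    and I: "resolvable V \<iota> (1, \<lambda>_. 0, embed_ideal V I)" "I \<subseteq> poly_ring V"
  shows "\<exists>F. minimal_graded_free_resolution V I F"
proof -
  have "\<exists>f. \<forall>i. (resolvable V \<iota> (f i) \<and> (i = 0 \<longrightarrow> f i = (1, \<lambda>_. 0, embed_ideal V I))) \<and> (\<exists>D. syzygy_of V \<iota> D (f i) (f (Suc i)))"
    by (rule dependent_nat_choice) (use I next_syzygy[OF V] in auto)
  then obtain f where f: "\<And>i. \<exists>D. syzygy_of V \<iota> D (f i) (f (Suc i))" "f 0 = (1, \<lambda>_. 0, embed_ideal V I)"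
    by blast
  define dm where "dm = (\<lambda>i. SOME D. syzygy_of V \<iota> D (f i) (f (Suc i)))"
  have dm: "syzygy_of V \<iota> (dm i) (f i) (f (Suc i))" for i unfolding dm_def by (rule someI_ex[OF f(1)])
  define rk where "rk = (\<lambda>i. fst (f i))"
  define sh where "sh = (\<lambda>i. fst (snd (f i)))"
  have sy: "minimal_syzygy_step V \<iota> (rk (Suc i)) (rk i) (sh (Suc i)) (sh i) (dm i)"
    "snd (snd (f i)) = syzygy_step.Img V (rk (Suc i)) (rk i) (dm i)"
    "snd (snd (f (Suc i))) = syzygy_step.Ker V (rk (Suc i)) (rk i) (dm i)" for i
    using dm[of i] unfolding syzygy_of_def rk_def sh_def by (simp_all add: case_prod_unfold)
  have r0: "rk 0 = 1" "sh 0 = (\<lambda>_. 0)" "snd (snd (f 0)) = embed_ideal V I" using f(2) by (auto simp: rk_def sh_def)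
  interpret S: minimal_syzygy_step V \<iota> "rk (Suc i)" "rk i" "sh (Suc i)" "sh i" "dm i" for i by (rule sy(1))
  define F where "F = \<lparr> res_rank = (\<lambda>i. rk (Suc i)), res_shift = (\<lambda>i. sh (Suc i)), res_aug = dm 0 0, res_diff = (\<lambda>i. dm (Suc i)) \<rparr>"
  have dF: "diff_map F i = S.A (Suc i)" for i by (simp add: diff_map_mat F_def)
  have aF: "aug_map F u = S.A 0 u 0" for u by (simp add: aug_map_def mat_map_def F_def r0)
  have aF0: "S.A 0 u = (\<lambda>_. 0) \<longleftrightarrow> aug_map F u = 0" for u
    unfolding aF by (auto simp: mat_map_def r0 fun_eq_iff)
  have ex: "S.Img (Suc i) = S.Ker i" for i using sy(2)[of "Suc i"] sy(3)[of i] by simp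
  have res: "aug_map F ` free_mod V (rk (Suc 0)) = I"
  proof -
    have "aug_map F ` free_mod V (rk (Suc 0)) = (\<lambda>u. u 0) ` S.Img 0"
      by (auto simp: S.Img_def aF image_image)
    also have "S.Img 0 = embed_ideal V I" using sy(2)[of 0] r0(3) by simp
    also have "(\<lambda>u. u 0) ` embed_ideal V I = I"
    proof
      show "I \<subseteq> (\<lambda>u. u 0) ` embed_ideal V I"
      proof
        fix p assume "p \<in> I"
        then have "(\<lambda>l. if l = 0 then p else 0) \<in> embed_ideal V I"
          using I(2) by (auto simp: embed_ideal_def free_mod_def)
        then show "p \<in> (\<lambda>u. u 0) ` embed_ideal V I" by (rule rev_image_eqI) simp
      qed
    qed (auto simp: embed_ideal_def)
    finally show ?thesis .
  qed
  have mini: "lookup (dm (Suc i) l k) 0 = 0" if "l < rk (Suc i)" "k < rk (Suc (Suc i))" for i l k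
  proof -
    define e where "e = (\<lambda>i. if i = k then 1 else 0 :: ('v, 'k) mpol)"
    have "e \<in> free_mod V (rk (Suc (Suc i)))" using that by (auto simp: e_def free_mod_def poly_ring_1)
    then have "S.A (Suc i) e \<in> S.Ker i" unfolding ex[symmetric] S.Img_def by blast
    from S.minimal[OF this, of l] have "lookup (S.A (Suc i) e l) 0 = 0" .
    moreover have "S.A (Suc i) e l = dm (Suc i) l k"
    proof -
      have "(\<Sum>j<rk (Suc (Suc i)). dm (Suc i) l j * e j) = (\<Sum>j<rk (Suc (Suc i)). if j = k then dm (Suc i) l j else 0)"
        by (rule sum.cong) (auto simp: e_def)
      then show ?thesis using that by (simp add: mat_map_def)
    qed
    ultimately show ?thesis by simp
  qed
  have "minimal_graded_free_resolution V I F"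
    unfolding minimal_graded_free_resolution_def graded_free_resolution_def
  proof (intro conjI allI impI)
    fix k assume "k < res_rank F 0"
    then show "res_aug F k \<in> poly_ring V" "homogeneous (res_shift F 0 k) (res_aug F k)"
      using S.D[of 0 0 k] S.Dh[of 0 0 k] by (auto simp: F_def r0)
  next
    fix i l k assume "l < res_rank F i" "k < res_rank F (Suc i)"
    then show "res_diff F i l k \<in> poly_ring V" "homogeneous (res_shift F (Suc i) k - res_shift F i l) (res_diff F i l k)"
      "lookup (res_diff F i l k) 0 = 0"
      using S.D[of l "Suc i" k] S.Dh[of l "Suc i" k] mini by (auto simp: F_def)
  next
    show "aug_map F ` free_mod V (res_rank F 0) = I" using res by (simp add: F_def)
    show "diff_map F 0 ` free_mod V (res_rank F 1) = {u \<in> free_mod V (res_rank F 0). aug_map F u = 0}"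
      using ex[of 0] unfolding S.Img_def S.Ker_def aF0 dF by (simp add: F_def)
  next
    fix i
    show "diff_map F (Suc i) ` free_mod V (res_rank F (Suc (Suc i))) = {u \<in> free_mod V (res_rank F (Suc i)). diff_map F i u = (\<lambda>_. 0)}"
      using ex[of "Suc i"] unfolding S.Img_def S.Ker_def dF by (simp add: F_def)
  qed
  then show ?thesis by blast
qed

section \<open>Koszul cohomology and regularity of edge ideals\<close>

definition has_edge :: "('v \<times> 'v) set \<Rightarrow> 'v set \<Rightarrow> bool" where
  "has_edge E S \<longleftrightarrow> (\<exists>(u, v)\<in>E. u \<in> S \<and> v \<in> S)"

definition indep_cx :: "('v \<times> 'v) set \<Rightarrow> 'v set \<Rightarrow> 'v set set" where
  "indep_cx E W = {T. T \<subseteq> W \<and> \<not> has_edge E T}"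

definition edge_mono_ideal :: "'v set \<Rightarrow> ('v \<times> 'v) set \<Rightarrow> ('v, 'k::field) mpol set" where
  "edge_mono_ideal V E = {p \<in> poly_ring V. \<forall>m\<in>keys p. has_edge E (keys m)}"

lemma has_edge_mono: "has_edge E S \<Longrightarrow> S \<subseteq> T \<Longrightarrow> has_edge E T"
  unfolding has_edge_def by blast

lemma not_has_edge_empty [simp]: "\<not> has_edge E {}" by (simp add: has_edge_def)

lemma edge_mono_ideal_add: "p \<in> edge_mono_ideal V E \<Longrightarrow> q \<in> edge_mono_ideal V E \<Longrightarrow> p + q \<in> edge_mono_ideal V E"
  using keys_add[of p q] by (auto simp: edge_mono_ideal_def poly_ring_add)

lemma edge_mono_ideal_mult:
  assumes r: "r \<in> poly_ring V" and p: "p \<in> edge_mono_ideal V E"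
  shows "r * p \<in> edge_mono_ideal V E"
proof -
  have "has_edge E (keys m)" if m: "m \<in> keys (r * p)" for m
  proof -
    obtain a b where "m = a + b" "b \<in> keys p" using subsetD[OF keys_mult m] by blast
    then show ?thesis using p has_edge_mono[of E "keys b" "keys m"] by (auto simp: edge_mono_ideal_def keys_mono_add)
  qed
  then show ?thesis using r p by (simp add: edge_mono_ideal_def poly_ring_mult)
qed

lemma edge_mono_ideal_sum: "(\<And>i. i \<in> A \<Longrightarrow> f i \<in> edge_mono_ideal V E) \<Longrightarrow> sum f A \<in> edge_mono_ideal V E"
proof (induction A rule: infinite_finite_induct)
  case (insert i A)
  then show ?case by (simp add: edge_mono_ideal_add)
qed (simp_all add: edge_mono_ideal_def)

lemma ideal_gen_add: "p \<in> ideal_gen V S \<Longrightarrow> q \<in> ideal_gen V S \<Longrightarrow> p + q \<in> ideal_gen V S"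
proof -
  assume "p \<in> ideal_gen V S" "q \<in> ideal_gen V S"
  then obtain T f T' f' where p: "p = (\<Sum>s\<in>T. f s * s)" "finite T" "T \<subseteq> S" "\<forall>s\<in>T. f s \<in> poly_ring V"
    and q: "q = (\<Sum>s\<in>T'. f' s * s)" "finite T'" "T' \<subseteq> S" "\<forall>s\<in>T'. f' s \<in> poly_ring V"
    unfolding ideal_gen_def by blast
  let ?g = "\<lambda>s. (if s \<in> T then f s else 0) + (if s \<in> T' then f' s else 0)"
  have 1: "(\<Sum>s\<in>T \<union> T'. (if s \<in> T then f s else 0) * s) = p"
    unfolding p(1) using p(2) q(2) by (intro sum.mono_neutral_cong_right) auto
  have 2: "(\<Sum>s\<in>T \<union> T'. (if s \<in> T' then f' s else 0) * s) = q"
    unfolding q(1) using p(2) q(2) by (intro sum.mono_neutral_cong_right) auto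
  have "p + q = (\<Sum>s\<in>T \<union> T'. ?g s * s)"
    unfolding distrib_right sum.distrib 1 2 ..
  moreover have "\<forall>s\<in>T \<union> T'. ?g s \<in> poly_ring V" using p(4) q(4) by (auto intro: poly_ring_add)
  ultimately show "p + q \<in> ideal_gen V S"
    unfolding ideal_gen_def using p(2,3) q(2,3) by (intro CollectI exI[of _ "T \<union> T'"] exI[of _ ?g]) auto
qed

text \<open>
  The edge ideal is a monomial ideal, so membership is decided monomial by monomial.
\<close>

lemma edge_ideal_eq:
  assumes "pair_graph G"
  shows "(edge_ideal G :: ('v, 'k::field) mpol set) = edge_mono_ideal (pverts G) (parcs G)"
proof
  interpret pair_graph G by fact
  let ?V = "pverts G" and ?E = "parcs G"
  let ?S = "{var u * var v | u v. (u, v) \<in> ?E} :: ('v, 'k) mpol set"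
  have gen: "s \<in> edge_mono_ideal ?V ?E" if s: "s \<in> ?S" for s
  proof -
    obtain u v where uv: "s = var u * var v" "(u, v) \<in> ?E" using s by blast
    then have "s = single (single u 1 + single v 1) 1" by (simp add: var_def mult_single)
    then show ?thesis using uv wellformed' by (auto simp: edge_mono_ideal_def poly_ring_def keys_mono_add has_edge_def)
  qed
  show "edge_ideal G \<subseteq> (edge_mono_ideal ?V ?E :: ('v, 'k) mpol set)"
  proof
    fix p :: "('v, 'k) mpol" assume "p \<in> edge_ideal G"
    then obtain T q where "p = (\<Sum>s\<in>T. q s * s)" "T \<subseteq> ?S" "\<forall>s\<in>T. q s \<in> poly_ring ?V"
      unfolding edge_ideal_def ideal_gen_def by blast
    then show "p \<in> edge_mono_ideal ?V ?E"
      using gen by (simp only:) (intro edge_mono_ideal_sum edge_mono_ideal_mult; blast)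
  qed
  show "edge_mono_ideal ?V ?E \<subseteq> (edge_ideal G :: ('v, 'k) mpol set)"
  proof
    fix p :: "('v, 'k) mpol" assume p: "p \<in> edge_mono_ideal ?V ?E"
    have "(\<Sum>m\<in>F. single m (lookup p m)) \<in> edge_ideal G" if "finite F" "F \<subseteq> keys p" for F
      using that
    proof (induction F rule: finite_induct)
      case empty
      show ?case unfolding edge_ideal_def ideal_gen_def by (auto intro!: exI[of _ "{}"])
    next
      case (insert m F)
      then have m: "m \<in> keys p" by blast
      then obtain u v where uv: "(u, v) \<in> ?E" "u \<in> keys m" "v \<in> keys m"
        using p by (auto simp: edge_mono_ideal_def has_edge_def)
      have ne: "u \<noteq> v" using uv no_loops' by blast
      let ?e = "single u 1 + single v 1 :: 'v \<Rightarrow>\<^sub>0 nat"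
      have me: "(m - ?e) + ?e = m"
        using uv ne by (intro poly_mapping_eqI) (auto simp: lookup_add lookup_minus lookup_single when_def in_keys_iff)
      have "single m (lookup p m) = single (m - ?e) (lookup p m) * (var u * var v)"
        using me by (simp add: var_def mult_single)
      moreover have "keys (m - ?e) \<subseteq> keys m" by (auto simp: in_keys_iff lookup_minus)
      then have "keys (m - ?e) \<subseteq> ?V" using p m by (auto simp: edge_mono_ideal_def poly_ring_def)
      ultimately have "single m (lookup p m) \<in> edge_ideal G"
        unfolding edge_ideal_def ideal_gen_def using uv(1)
        by (intro CollectI exI[of _ "{var u * var v}"] exI[of _ "\<lambda>_. single (m - ?e) (lookup p m)"]) (auto intro: poly_ring_single)
      then show ?case using insert ideal_gen_add unfolding edge_ideal_def by simp
    qed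
    from this[of "keys p"] have "(\<Sum>m\<in>keys p. single m (lookup p m)) \<in> edge_ideal G" by simp
    moreover have "(\<Sum>m\<in>keys p. single m (lookup p m)) = p"
      by (intro poly_mapping_eqI) (auto simp: lookup_sum lookup_single when_def in_keys_iff)
    ultimately show "p \<in> edge_ideal G" by simp
  qed
qed

lemma embed_cobd:
  assumes "f T = cobd \<iota> var w T"
  shows "(\<lambda>k. if k = 0 then f T else 0) = koszul_d \<iota> (\<lambda>S k. if k = 0 then w S else (0 :: ('v, 'k::field) mpol)) T"
  using assms by (auto simp: koszul_d_def fun_eq_iff cobd_def)

text \<open>
  Consider a multidegree \<open>(Z, a)\<close> that occurs. If \<open>a \<noteq> 0\<close>, the sets \<open>S\<close> for which \<open>a + ind S\<close> is not in the ideal form a cone with apex any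
  variable of \<open>a\<close>. If \<open>a = 0\<close>, they form the independence complex on \<open>V - Z\<close>, and the cardinality of the faces concerned is
  exactly \<open>d\<close>. For \<open>d > q\<close> the second case cannot occur, since the faces have at most \<open>q\<close> elements.
\<close>

theorem edge_ideal_exact_at:
  assumes V: "finite V" "inj_on \<iota> V"
    and acy: "d \<le> int q \<Longrightarrow> (\<And>W. W \<subseteq> V \<Longrightarrow> acyclic_at TYPE('k::field) \<iota> (nat d - 1) (indep_cx E W))"
  shows "exact_at V \<iota> (embed_ideal V (edge_mono_ideal V E :: ('v, 'k) mpol set)) (\<lambda>_. 0) q d"
proof (rule exact_atI)
  fix c :: "'v set \<Rightarrow> nat \<Rightarrow> ('v, 'k) mpol"
  let ?I = "edge_mono_ideal V E :: ('v, 'k) mpol set"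
  assume c: "\<And>T. T \<subseteq> V \<Longrightarrow> card T = q \<Longrightarrow> c T \<in> embed_ideal V ?I"
    "\<And>T. T \<subseteq> V \<Longrightarrow> card T = q \<Longrightarrow> hom_vec (\<lambda>_. 0) d (c T)"
    "\<And>T. T \<subseteq> V \<Longrightarrow> card T = Suc q \<Longrightarrow> koszul_d \<iota> c T = (\<lambda>_. 0)"
  define f where "f = (\<lambda>T. c T 0)"
  have f: "f T \<in> ?I" "homogeneous d (f T)" "c T = (\<lambda>k. if k = 0 then f T else 0)" if "T \<subseteq> V" "card T = q" for T
    using c(1,2)[OF that] by (auto simp: embed_ideal_def hom_vec_def f_def free_mod_def)
  obtain w where w: "\<And>T. T \<subseteq> V \<Longrightarrow> Suc (card T) = q \<Longrightarrow> w T \<in> poly_ring V"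
    "\<And>T m. T \<subseteq> V \<Longrightarrow> Suc (card T) = q \<Longrightarrow> m \<in> keys (w T) \<Longrightarrow> has_edge E (keys m)"
    "\<And>T. T \<subseteq> V \<Longrightarrow> card T = q \<Longrightarrow> f T = cobd \<iota> var w T"
  proof (rule koszul_exact[where f=f and V=V and q=q and \<iota>=\<iota> and Q="\<lambda>m. has_edge E (keys m)"])
    show "cobd \<iota> var f T = 0" if "T \<subseteq> V" "card T = Suc q" for T
      using fun_cong[OF c(3)[OF that], of 0] by (simp add: koszul_d_def f_def)
    fix Z a T
    assume T: "T \<subseteq> V" "card T = q" "Z \<subseteq> T" and m: "a + ind (T - Z) \<in> keys (f T)" and a: "keys a \<subseteq> V - Z"
    have fT: "finite T" using T V finite_subset by blast
    have fW: "finite (V - Z)" "inj_on \<iota> (V - Z)" using V by (auto intro: inj_on_subset)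
    have n: "card (T - Z) = q - card Z" using T fT by (simp add: card_Diff_subset finite_subset)
    have he: "has_edge E (keys (a + ind (T - Z)))" using f(1)[OF T(1,2)] m by (auto simp: edge_mono_ideal_def)
    have deg: "int (monom_deg a) + int (q - card Z) = d"
      using f(2)[OF T(1,2)] m fT n by (auto simp: homogeneous_def monom_deg_add monom_deg_ind)
    let ?\<Gamma> = "{S. S \<subseteq> V - Z \<and> \<not> has_edge E (keys (a + ind S))}"
    have keyS: "keys (a + ind S) = keys a \<union> S" if "S \<subseteq> V - Z" for S
      using that fW(1) finite_subset by (metis keys_mono_add keys_ind)
    have simp: "simplicial \<iota> ?\<Gamma>" unfolding simplicial_def
    proof (intro ballI conjI allI impI)
      fix S S' assume S: "S \<in> ?\<Gamma>"
      then show "finite S" "inj_on \<iota> S" using fW by (auto intro: finite_subset inj_on_subset)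
      assume S': "S' \<subseteq> S"
      then have "S' \<subseteq> V - Z" using S by blast
      then show "S' \<in> ?\<Gamma>" using S S' keyS[of S] keyS[of S'] has_edge_mono[of E "keys a \<union> S'" "keys a \<union> S"] by auto
    qed
    show "rel_exact TYPE('k) \<iota> (q - card Z) (V - Z) ?\<Gamma>"
    proof (cases "a = 0")
      case False
      then obtain p where p: "p \<in> keys a" by (metis ex_in_conv in_keys_iff lookup_zero poly_mapping_eqI)
      have "insert p S \<in> ?\<Gamma>" if "S \<in> ?\<Gamma>" for S
        using that keyS[of S] keyS[of "insert p S"] p a by (auto simp: insert_absorb)
      from cone_acyclic[OF simp this] have "acyclic_at TYPE('k) \<iota> (q - card Z - 1) ?\<Gamma>" .
      then show ?thesis using p a by (intro rel_exactI fW simp) auto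
    next
      case True
      then have nd: "int (q - card Z) = d" using deg by simp
      have "card (T - Z) \<noteq> 0"
      proof
        assume "card (T - Z) = 0"
        then have "T - Z = {}" using fT by simp
        then have "ind (T - Z) = 0" by (simp only: ind_def sum.empty)
        then show False using he True by simp
      qed
      then have n1: "q - card Z \<ge> 1" using n by simp
      have "?\<Gamma> = indep_cx E (V - Z)" using keyS True by (auto simp: indep_cx_def)
      moreover have "acyclic_at TYPE('k) \<iota> (nat d - 1) (indep_cx E (V - Z))" by (rule acy) (use nd in auto)
      moreover have "nat d = q - card Z" using nd by linarith
      ultimately show ?thesis using n1 by (intro rel_exactI fW simp) auto
    qed
  qed (use f V in \<open>auto simp: edge_mono_ideal_def\<close>)
  let ?w = "\<lambda>S k. if k = (0::nat) then w S else 0"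
  have "?w T \<in> embed_ideal V ?I" if "T \<subseteq> V" "Suc (card T) = q" for T
    using w(1,2)[OF that] by (auto simp: embed_ideal_def free_mod_def edge_mono_ideal_def)
  moreover have "c T = koszul_d \<iota> ?w T" if "T \<subseteq> V" "card T = q" for T
    using embed_cobd[of f T \<iota> w, OF w(3)[OF that]] f(3)[OF that] by simp
  ultimately show "\<exists>w. (\<forall>T. T \<subseteq> V \<longrightarrow> Suc (card T) = q \<longrightarrow> w T \<in> embed_ideal V ?I) \<and> (\<forall>T. T \<subseteq> V \<longrightarrow> card T = q \<longrightarrow> c T = koszul_d \<iota> w T)"
    by (intro exI[of _ ?w] conjI allI impI)
qed

text \<open>
  If \<open>g\<close> represents a nonzero class of the independence complex of \<open>W\<close>, its coboundary on the full simplex is a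
  relative cocycle that does not bound; placed in the squarefree multidegree of \<open>W\<close> it is a Koszul cocycle
  with values in the ideal.
\<close>

theorem edge_ideal_not_exact_at:
  assumes V: "finite V" "inj_on \<iota> V" and W: "W \<subseteq> V" and n: "n \<ge> 1"
    and nacy: "\<not> acyclic_at TYPE('k::field) \<iota> n (indep_cx E W)"
  shows "\<not> exact_at V \<iota> (embed_ideal V (edge_mono_ideal V E :: ('v, 'k) mpol set)) (\<lambda>_. 0) (card (V - W) + Suc n) (int (Suc n))"
proof
  let ?I = "edge_mono_ideal V E :: ('v, 'k) mpol set" and ?Z = "V - W"
  assume hz: "exact_at V \<iota> (embed_ideal V ?I) (\<lambda>_. 0) (card ?Z + Suc n) (int (Suc n))"
  obtain g :: "'v set \<Rightarrow> 'k" where g: "\<And>T. T \<in> indep_cx E W \<Longrightarrow> card T = Suc n \<Longrightarrow> scobd \<iota> g T = 0"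
    and ng: "\<not> (\<exists>h. \<forall>T\<in>indep_cx E W. card T = n \<longrightarrow> g T = scobd \<iota> h T)"
    using nacy unfolding acyclic_at_def by blast
  have fW: "finite W" "inj_on \<iota> W" "finite ?Z" using V W by (auto intro: finite_subset inj_on_subset)
  define f where "f = unslice \<iota> ?Z 0 (scobd \<iota> g)"
  have TZ: "T - ?Z \<subseteq> W" "?Z \<subseteq> T \<Longrightarrow> card T = card ?Z + card (T - ?Z)" if "T \<subseteq> V" for T
  proof -
    show "T - ?Z \<subseteq> W" using that by auto
    have "finite T" using V that finite_subset by blast
    then show "?Z \<subseteq> T \<Longrightarrow> card T = card ?Z + card (T - ?Z)"
      by (metis card_Diff_subset card_mono finite_subset le_add_diff_inverse)
  qed
  have fT: "f T \<in> ?I" "homogeneous (int (Suc n)) (f T)" if T: "T \<subseteq> V" "card T = card ?Z + Suc n" for T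
  proof -
    have fin: "finite (T - ?Z)" using T V finite_subset by blast
    have "f T \<in> ?I \<and> homogeneous (int (Suc n)) (f T)"
    proof (cases "?Z \<subseteq> T \<and> scobd \<iota> g (T - ?Z) \<noteq> 0")
      case True
      then have c: "card (T - ?Z) = Suc n" using TZ(2)[OF T(1)] T(2) by simp
      have "T - ?Z \<notin> indep_cx E W" using True g c by blast
      then have "has_edge E (T - ?Z)" using TZ(1)[OF T(1)] by (simp add: indep_cx_def)
      then show ?thesis using fin c T by (auto simp: f_def unslice_def edge_mono_ideal_def poly_ring_def keys_ind homogeneous_def monom_deg_ind split: if_splits)
    next
      case False
      then have "f T = 0" by (auto simp: f_def unslice_def)
      then show ?thesis by (simp add: edge_mono_ideal_def)
    qed
    then show "f T \<in> ?I" "homogeneous (int (Suc n)) (f T)" by auto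
  qed
  have co: "cobd \<iota> var f T = 0" if T: "T \<subseteq> V" for T
  proof -
    have fin: "finite T" "inj_on \<iota> T" using T V by (auto intro: finite_subset inj_on_subset)
    have "scobd \<iota> (scobd \<iota> g) (T - ?Z) = 0" using fin by (intro cobd_cobd) (auto intro: inj_on_subset)
    then show ?thesis unfolding f_def cobd_unslice[OF fin(1)] by (simp add: unslice_def)
  qed
  obtain w where w: "\<And>T. T \<subseteq> V \<Longrightarrow> Suc (card T) = card ?Z + Suc n \<Longrightarrow> w T \<in> embed_ideal V ?I"
    "\<And>T. T \<subseteq> V \<Longrightarrow> card T = card ?Z + Suc n \<Longrightarrow> (\<lambda>k. if k = 0 then f T else 0) = koszul_d \<iota> w T"
  proof (rule exact_atD[OF hz, of "\<lambda>T k. if k = 0 then f T else 0"])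
    show "(\<lambda>k. if k = 0 then f T else 0) \<in> embed_ideal V ?I" "hom_vec (\<lambda>_. 0) (int (Suc n)) (\<lambda>k. if k = 0 then f T else 0)"
      if "T \<subseteq> V" "card T = card ?Z + Suc n" for T
      using fT[OF that] by (auto simp: embed_ideal_def free_mod_def hom_vec_def edge_mono_ideal_def)
    show "koszul_d \<iota> (\<lambda>T k. if k = 0 then f T else 0) T = (\<lambda>_. 0)" if "T \<subseteq> V" for T
    proof
      fix k show "koszul_d \<iota> (\<lambda>T k. if k = 0 then f T else 0) T k = 0"
        using co[OF that] by (cases "k = 0") (simp_all add: koszul_d_def cobd_def)
    qed
  qed blast
  define u where "u = (\<lambda>T. w T 0)"
  have u1: "u T \<in> ?I" if "T \<subseteq> V" "card T = card ?Z + n" for T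
    using w(1)[of T] that by (simp add: u_def embed_ideal_def)
  have u2: "f T = cobd \<iota> var u T" if "T \<subseteq> V" "card T = card ?Z + Suc n" for T
    using fun_cong[OF w(2)[OF that], of 0] by (simp add: koszul_d_def u_def)
  have cZ: "card (?Z \<union> S) = card ?Z + card S" "?Z \<union> S \<subseteq> V" "?Z \<inter> S = {}" if "S \<subseteq> W" for S
  proof -
    show "?Z \<inter> S = {}" "?Z \<union> S \<subseteq> V" using that W by auto
    moreover have "finite S" using that fW(1) by (rule finite_subset)
    ultimately show "card (?Z \<union> S) = card ?Z + card S" using fW(3) by (simp add: card_Un_disjoint)
  qed
  have s1: "slice \<iota> ?Z 0 u S = 0" if S: "S \<in> indep_cx E W" "card S = n" for S
  proof -
    have SW: "S \<subseteq> W" "finite S" using S fW by (auto simp: indep_cx_def intro: finite_subset)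
    have "ind S \<notin> keys (u (?Z \<union> S))"
      using u1[of "?Z \<union> S"] cZ[OF SW(1)] S SW by (auto simp: edge_mono_ideal_def indep_cx_def keys_ind)
    then show ?thesis by (simp add: slice_def in_keys_iff)
  qed
  have s2: "scobd \<iota> g S = scobd \<iota> (slice \<iota> ?Z 0 u) S" if S: "S \<subseteq> W" "card S = Suc n" for S
  proof -
    have fS: "finite S" using S fW finite_subset by blast
    have "scobd \<iota> g S = slice \<iota> ?Z 0 f S" unfolding f_def by (rule slice_unslice[symmetric, OF cZ(3)[OF S(1)]])
    also have "\<dots> = slice \<iota> ?Z 0 (cobd \<iota> var u) S"
      using u2[of "?Z \<union> S"] cZ[OF S(1)] S(2) by (simp add: slice_def)
    also have "\<dots> = scobd \<iota> (slice \<iota> ?Z 0 u) S"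
      by (rule scobd_slice[symmetric, OF fW(3) fS cZ(3)[OF S(1)]]) simp
    finally show ?thesis .
  qed
  have "acyclic_at TYPE('k) \<iota> n (Pow W)" using fW n by (intro acyclic_Pow) auto
  then obtain h where h: "\<And>T. T \<in> Pow W \<Longrightarrow> card T = n \<Longrightarrow> g T - slice \<iota> ?Z 0 u T = scobd \<iota> h T"
  proof (rule acyclic_atD[where g="\<lambda>T. g T - slice \<iota> ?Z 0 u T"])
    show "scobd \<iota> (\<lambda>T. g T - slice \<iota> ?Z 0 u T) T = 0" if "T \<in> Pow W" "card T = Suc n" for T
      using s2[of T] that by (simp add: cobd_diff)
  qed blast
  have "g T = scobd \<iota> h T" if "T \<in> indep_cx E W" "card T = n" for T
    using h[of T] s1[OF that] that by (simp add: indep_cx_def)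
  then show False using ng by blast
qed

theorem edge_betti_nonzero_iff:
  assumes V: "finite V" "inj_on \<iota> V" "V \<noteq> {}"
  shows "betti V (edge_mono_ideal V E :: ('v, 'k::field) mpol set) i j \<noteq> 0 \<longleftrightarrow>
    i \<le> card V \<and> \<not> exact_at V \<iota> (embed_ideal V (edge_mono_ideal V E :: ('v, 'k) mpol set)) (\<lambda>_. 0) (card V - i) (j - int i)"
proof (rule betti_nonzero_iff[OF V])
  let ?I = "edge_mono_ideal V E :: ('v, 'k) mpol set"
  show IR: "?I \<subseteq> poly_ring V" by (auto simp: edge_mono_ideal_def)
  have "resolvable V \<iota> (1, \<lambda>_. 0, embed_ideal V ?I)"
    unfolding resolvable_def split
  proof (intro conjI ballI allI impI)
    show "submod V (embed_ideal V ?I)"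
      unfolding submod_def embed_ideal_def
      using submodD[OF submod_free_mod[of V 1]]
      by (auto intro: edge_mono_ideal_add edge_mono_ideal_mult) (simp add: edge_mono_ideal_def)
    show "embed_ideal V ?I \<subseteq> free_mod V 1" by (auto simp: embed_ideal_def)
    show "hom_part_vec (\<lambda>_. 0) d u \<in> embed_ideal V ?I" if "u \<in> embed_ideal V ?I" for u d
      using that free_mod_hom_part_vec[of u V 1 "\<lambda>_. 0" d] by (auto simp: embed_ideal_def hom_part_vec_def edge_mono_ideal_def poly_ring_hom_part keys_hom_part)
    show "exact_at V \<iota> (embed_ideal V ?I) (\<lambda>_. 0) q d" if "d > int q" for q d
      by (rule edge_ideal_exact_at[OF V(1,2)]) (use that in auto)
  qed
  then show "\<exists>F. minimal_graded_free_resolution V ?I F"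
    by (rule minimal_resolution_exists[OF V _ IR])
qed

theorem regularity_le:
  assumes V: "finite V" "inj_on \<iota> V" "V \<noteq> {}"
    and acy: "\<And>n W. n \<ge> r \<Longrightarrow> W \<subseteq> V \<Longrightarrow> acyclic_at TYPE('k::field) \<iota> n (indep_cx E W)"
  shows "regularity V (edge_mono_ideal V E :: ('v, 'k) mpol set) \<le> ereal (real r)"
  unfolding regularity_def
proof (rule Sup_least)
  fix x assume "x \<in> {ereal (real_of_int (j - int i)) |i j. betti V (edge_mono_ideal V E :: ('v, 'k) mpol set) i j \<noteq> 0}"
  then obtain i j where x: "x = ereal (real_of_int (j - int i))" and b: "betti V (edge_mono_ideal V E :: ('v, 'k) mpol set) i j \<noteq> 0"
    by blast
  have "j - int i \<le> int r"
  proof (rule ccontr)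
    assume "\<not> ?thesis"
    then have "exact_at V \<iota> (embed_ideal V (edge_mono_ideal V E :: ('v, 'k) mpol set)) (\<lambda>_. 0) (card V - i) (j - int i)"
      by (intro edge_ideal_exact_at V(1,2) acy) auto
    then show False using b unfolding edge_betti_nonzero_iff[OF V] by blast
  qed
  then have "real_of_int (j - int i) \<le> real_of_int (int r)" by (simp only: of_int_le_iff)
  then show "x \<le> ereal (real r)" by (simp add: x)
qed

text \<open>
  The class lives in homological degree \<open>card W - n - 1\<close>; it cannot lie below zero, because in cardinalities above
  \<open>card V\<close> there are no cochains at all.
\<close>

theorem regularity_ge:
  assumes V: "finite V" "inj_on \<iota> V" "V \<noteq> {}" and W: "W \<subseteq> V" and n: "n \<ge> 1"
    and nacy: "\<not> acyclic_at TYPE('k::field) \<iota> n (indep_cx E W)"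
  shows "ereal (real (Suc n)) \<le> regularity V (edge_mono_ideal V E :: ('v, 'k) mpol set)"
proof -
  let ?I = "edge_mono_ideal V E :: ('v, 'k) mpol set" and ?q = "card (V - W) + Suc n"
  have nhz: "\<not> exact_at V \<iota> (embed_ideal V ?I) (\<lambda>_. 0) ?q (int (Suc n))"
    by (rule edge_ideal_not_exact_at[OF V(1,2) W n nacy])
  have "?q \<le> card V"
  proof (rule ccontr)
    assume "\<not> ?thesis"
    then show False using nhz exact_at_beyond[OF V(1), of "embed_ideal V ?I" ?q]
      by (simp add: embed_ideal_def free_mod_def edge_mono_ideal_def)
  qed
  then have "betti V ?I (card V - ?q) (int (Suc n) + int (card V - ?q)) \<noteq> 0"
    unfolding edge_betti_nonzero_iff[OF V] using nhz by simp
  then show ?thesis unfolding regularity_def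
    by (intro Sup_upper CollectI exI[of _ "card V - ?q"] exI[of _ "int (Suc n) + int (card V - ?q)"] conjI) auto
qed

section \<open>Edge ideals of bipartite graphs of regularity three\<close>

text \<open>
  Koszul cohomology may be computed with any order of the variables; this one suits the bipartition.
\<close>

lemma separating_order:
  assumes "finite X" "finite Y" "X \<inter> Y = {}"
  obtains \<iota> :: "'v \<Rightarrow> nat" where "inj_on \<iota> (X \<union> Y)" "\<And>x y. x \<in> X \<Longrightarrow> y \<in> Y \<Longrightarrow> \<iota> x < \<iota> y"
proof -
  obtain f :: "'v \<Rightarrow> nat" and n where f: "f ` (X \<union> Y) = {i. i < n}" "inj_on f (X \<union> Y)"
    using finite_imp_inj_to_nat_seg[of "X \<union> Y"] assms by auto
  have fn: "f v < n" if "v \<in> X \<union> Y" for v using f(1) that by blast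
  define \<iota> where "\<iota> = (\<lambda>v. if v \<in> X then f v else n + f v)"
  have "inj_on \<iota> (X \<union> Y)"
  proof (rule inj_onI)
    fix u v assume u: "u \<in> X \<union> Y" and v: "v \<in> X \<union> Y" and e: "\<iota> u = \<iota> v"
    have "f u = f v" using e fn[OF u] fn[OF v] by (auto simp: \<iota>_def split: if_splits)
    then show "u = v" using inj_onD[OF f(2)] u v by blast
  qed
  moreover have "\<iota> x < \<iota> y" if "x \<in> X" "y \<in> Y" for x y
    using fn[of x] that assms(3) by (auto simp: \<iota>_def)
  ultimately show ?thesis by (rule that)
qed

theorem theorem3p1:
  fixes G :: "'v pair_pre_digraph" and X Y :: "'v set"
  assumes "pair_graph G"
    and "Digraph_Component.connected (with_proj G)"
    and "bipartition G X Y"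
  shows "regularity (pverts G) (edge_ideal G :: ('v, 'k::field) mpol set) = 3 \<longleftrightarrow>
    has_induced_cycle_ge 4 (complement_graph G) \<and>
    \<not> has_induced_cycle_ge 6 (bipartite_complement G X Y)"
proof -
  interpret G: pair_graph G by fact
  let ?V = "pverts G" and ?E = "parcs G" and ?B = "\<lambda>x y. (x, y) \<notin> parcs G"
  let ?reg = "regularity ?V (edge_mono_ideal ?V ?E :: ('v, 'k) mpol set)"
  have bip: "X \<union> Y = ?V" "X \<inter> Y = {}" "\<And>u v. (u, v) \<in> ?E \<Longrightarrow> u \<in> X \<and> v \<in> Y \<or> u \<in> Y \<and> v \<in> X"
    using assms(3) by (auto simp: bipartition_def)
  have fin: "finite X" "finite Y" using bip(1) G.pair_finite_verts by (metis finite_Un)+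
  obtain \<iota> :: "'v \<Rightarrow> nat" where \<iota>: "inj_on \<iota> (X \<union> Y)" "\<And>x y. x \<in> X \<Longrightarrow> y \<in> Y \<Longrightarrow> \<iota> x < \<iota> y"
    using separating_order[OF fin bip(2)] by blast
  interpret ordered_bipartite X Y ?B \<iota> using fin \<iota> by unfold_locales
  have V: "finite ?V" "inj_on \<iota> ?V" "?V \<noteq> {}"
    using G.pair_finite_verts \<iota>(1) bip(1) assms(2) connected_iff_closed[OF assms(1)] by simp_all
  have Ind: "Ind W = indep_cx ?E W" for W
    unfolding Ind_def indep_cx_def has_edge_def using bip(3) G.arcs_symmetric by fast
  have bc: "parcs (bipartite_complement G X Y) = bcomp" "pverts (bipartite_complement G X Y) = X \<union> Y"
    using G.arcs_symmetric by (auto simp: bipartite_complement_def bcomp_def)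
  have cyc6: "has_induced_cycle_ge 6 (bipartite_complement G X Y) \<longleftrightarrow> \<not> links_connected"
    using cycle_not_links_connected not_links_connected_cycle
    unfolding has_induced_cycle_ge_iff[OF pair_graph_bipartite_complement[OF assms(1,3)], of 6, simplified] bc by metis
  note cyc4 = complement_cycle_iff_2K2[OF assms(1,3)]
  have "?reg = 3 \<longleftrightarrow> has_induced_cycle_ge 4 (complement_graph G) \<and> links_connected"
  proof (cases "has_induced_cycle_ge 4 (complement_graph G)")
    case False
    then have no: "(x, y') \<notin> ?E \<or> (x', y) \<notin> ?E" if "x \<in> X" "x' \<in> X" "y \<in> Y" "y' \<in> Y" "(x, y) \<notin> ?E" "(x', y') \<notin> ?E" for x x' y y'
      using that unfolding cyc4 by blast
    \<comment> \<open>Without an induced \<open>2K\<^sub>2\<close> the condition on long cycles is automatic, so the vanishing on larger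
        faces is available here as well.\<close>
    have lc: links_connected using no by (rule no_2K2_links_connected)
    have "?reg \<le> ereal (real 2)"
    proof (rule regularity_le[OF V])
      fix n W assume nW: "(2::nat) \<le> n" "W \<subseteq> ?V"
      show "acyclic_at TYPE('k) \<iota> n (indep_cx ?E W)"
      proof (cases "n = 2")
        case True
        then show ?thesis using no_2K2_acyclic_2[OF no, of W] nW bip(1) Ind by simp
      next
        case False
        then show ?thesis using acyclic_above_2[OF lc, of W n] nW bip(1) Ind by simp
      qed
    qed
    then have "?reg \<noteq> 3" by auto
    then show ?thesis using False by simp
  next
    case c4: True
    show ?thesis
    proof (cases links_connected)
      case lc: True
      obtain x x' y y' where k: "x \<in> X" "x' \<in> X" "y \<in> Y" "y' \<in> Y" "(x, y) \<notin> ?E" "(x', y') \<notin> ?E" "(x, y') \<in> ?E" "(x', y) \<in> ?E"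
        using c4 unfolding cyc4 by blast
      have "\<not> acyclic_at TYPE('k) \<iota> 2 (indep_cx ?E {x, x', y, y'})"
        using two_K2_not_acyclic_2[of x x' y y'] k unfolding Ind by simp
      then have "ereal (real (Suc 2)) \<le> ?reg"
        by (intro regularity_ge[OF V, where W="{x, x', y, y'}"]) (use k bip(1) in auto)
      moreover have "?reg \<le> ereal (real 3)"
      proof (rule regularity_le[OF V])
        show "acyclic_at TYPE('k) \<iota> n (indep_cx ?E W)" if "3 \<le> n" "W \<subseteq> ?V" for n W
          using acyclic_above_2[OF lc, of W n] that bip(1) Ind by simp
      qed
      ultimately have "?reg = 3" by (intro antisym) simp_all
      then show ?thesis using c4 lc by simp
    next
      case nlc: False
      then obtain W y x x' where W: "W \<subseteq> X \<union> Y" "y \<in> Y \<inter> W" "x \<in> X \<inter> W" "x' \<in> X \<inter> W" "(x, y) \<notin> ?E" "(x', y) \<notin> ?E"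
        "conn (W - {y}) x x'" "\<not> conn (linkset W y) x x'"
        unfolding links_connected_def by blast
      have "\<not> acyclic_at TYPE('k) \<iota> 3 (indep_cx ?E W)"
        using not_acyclic_3[OF W] unfolding Ind .
      then have "ereal (real (Suc 3)) \<le> ?reg"
        by (intro regularity_ge[OF V, where W=W]) (use W(1) bip(1) in auto)
      then have "?reg \<noteq> 3" by auto
      then show ?thesis using nlc by simp
    qed
  qed
  then show ?thesis unfolding edge_ideal_eq[OF assms(1)] cyc6 by simp
qed

end
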